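(* Suppose the real input sequence $\{x_i\}_{i\ge 0}$ satisfies (A1), (A2) or (A3). Let $H_n=((x_{i+j}))_{1\le i,j\le n}$ (Hankel) and $RC_n=((x_{(i+j)\bmod n}))_{1\le i,j\le n}$ (Reverse Circulant), and let $\widetilde{H}_n=S_n\odot H_n$ and $\widetilde{RC}_n=S_n\odot RC_n$ be their skew-symmetric versions. Then the LSDs of $n^{-1/2}\widetilde{H}_n$ and of $n^{-1/2}\widetilde{RC}_n$ exist and are universal (each is the same for every input sequence satisfying (A1), (A2) or (A3)). Moreover, the LSD of $n^{-1/2}\widetilde{H}_n$ is different from the LSD of $n^{-1/2}H_n$, and the LSD of $n^{-1/2}\widetilde{RC}_n$ is different from the LSD of $n^{-1/2}RC_n$.
   Context: Assumptions on the real input random variables: (A1) they are independent and uniformly bounded with mean $0$ and variance $1$; (A2) they are i.i.d. with mean $0$ and variance $1$; (A3) they are independent with mean $0$ and variance $1$, and with uniformly bounded moments of all orders. $S_n=((s_{ij}))_{1\le i,j\le n}$ is the skew-symmetric sign matrix with $s_{ij}=1$ if $i<j$, $s_{ii}=0$, $s_{ij}=-1$ if $i>j$. The symbol $\odot$ denotes the entrywise (Schur–Hadamard) product. For a real symmetric $n\times n$ matrix $A$ with eigenvalues $\lambda_1,\dots,\lambda_n$, the empirical spectral distribution is $F^A(x)=\frac1n\#\{j:\lambda_j\le x\}$. For a real skew-symmetric $n\times n$ matrix $A$ with (purely imaginary) eigenvalues $\lambda_1,\dots,\lambda_n$, it is the distribution function on $\mathbb{R}$ given by $F^A(x)=\frac1n\#\{j: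 \mathrm{i}\lambda_j\le x\}$, where $\mathrm{i}=\sqrt{-1}$. A non-random distribution function $F$ is the limiting spectral distribution (LSD) of a sequence $A_n$ if, outside a null set, $F^{A_n}(x)\to F(x)$ as $n\to\infty$ at all continuity points $x$ of $F$. It is known that under any of (A1), (A2), (A3) the LSDs of $n^{-1/2}H_n$ and $n^{-1/2}RC_n$ exist and do not depend on the distribution of the input sequence. *)

theory Defs
  imports "HOL-Probability.Probability" "Jordan_Normal_Form.Char_Poly"
begin

section \<open>Input sequences\<close>

text \<open>If a random variable on a probability space has second moment 1 in the sense of the
  Bochner integral, then its square is integrable, hence so is the variable itself;
  the integrability requirement below is therefore redundant, and \<^term>\<open>prob_space.variance\<close>
  is the variance in the usual sense.\<close>

context prob_space
begin

definition standardized :: "('a \<Rightarrow> real) \<Rightarrow> bool" where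
  "standardized X \<longleftrightarrow> integrable M X \<and> expectation X = 0 \<and> variance X = 1"

definition input_A1 :: "(nat \<Rightarrow> 'a \<Rightarrow> real) \<Rightarrow> bool" where
  "input_A1 x \<longleftrightarrow>
     indep_vars (\<lambda>_. borel) x UNIV \<and> (\<forall>i. standardized (x i)) \<and>
     (\<exists>C. \<forall>i. AE \<omega> in M. \<bar>x i \<omega>\<bar> \<le> C)"

definition input_A2 :: "(nat \<Rightarrow> 'a \<Rightarrow> real) \<Rightarrow> bool" where
  "input_A2 x \<longleftrightarrow>
     indep_vars (\<lambda>_. borel) x UNIV \<and> (\<forall>i. standardized (x i)) \<and>
     (\<forall>i j. distr M borel (x i) = distr M borel (x j))"

text \<open>The bound on the moments may depend on the order \<open>k\<close>, but not on the index \<open>i\<close>.\<close>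

definition input_A3 :: "(nat \<Rightarrow> 'a \<Rightarrow> real) \<Rightarrow> bool" where
  "input_A3 x \<longleftrightarrow>
     indep_vars (\<lambda>_. borel) x UNIV \<and> (\<forall>i. standardized (x i)) \<and>
     (\<forall>k. \<exists>C. \<forall>i. integrable M (\<lambda>\<omega>. \<bar>x i \<omega>\<bar> ^ k) \<and> expectation (\<lambda>\<omega>. \<bar>x i \<omega>\<bar> ^ k) \<le> C)"

end

definition input_sequence :: "'w measure \<Rightarrow> (nat \<Rightarrow> 'w \<Rightarrow> real) \<Rightarrow> bool" where
  "input_sequence M x \<longleftrightarrow> prob_space M \<and>
     (prob_space.input_A1 M x \<or> prob_space.input_A2 M x \<or> prob_space.input_A3 M x)"


section \<open>Patterned matrices\<close>

text \<open>Matrix indices of \<^const>\<open>mat\<close> start at 0, those of the pattern \<open>x\<^bsub>i+j\<^esub>\<close> at 1;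
  hence the successors.\<close>

definition hankel :: "nat \<Rightarrow> (nat \<Rightarrow> real) \<Rightarrow> real mat" where
  "hankel n x = mat n n (\<lambda>(i, j). x (Suc i + Suc j))"

definition reverse_circulant :: "nat \<Rightarrow> (nat \<Rightarrow> real) \<Rightarrow> real mat" where
  "reverse_circulant n x = mat n n (\<lambda>(i, j). x ((Suc i + Suc j) mod n))"

definition sign_mat :: "nat \<Rightarrow> real mat" where
  "sign_mat n = mat n n (\<lambda>(i, j). if i < j then 1 else if i = j then 0 else - 1)"

definition schur_prod :: "real mat \<Rightarrow> real mat \<Rightarrow> real mat" where
  "schur_prod A B = mat (dim_row A) (dim_col A) (\<lambda>ij. A $$ ij * B $$ ij)"

definition skew_hankel :: "nat \<Rightarrow> (nat \<Rightarrow> real) \<Rightarrow> real mat" where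
  "skew_hankel n x = schur_prod (sign_mat n) (hankel n x)"

definition skew_reverse_circulant :: "nat \<Rightarrow> (nat \<Rightarrow> real) \<Rightarrow> real mat" where
  "skew_reverse_circulant n x = schur_prod (sign_mat n) (reverse_circulant n x)"

definition scaled :: "(nat \<Rightarrow> (nat \<Rightarrow> real) \<Rightarrow> real mat) \<Rightarrow> nat \<Rightarrow> (nat \<Rightarrow> real) \<Rightarrow> real mat" where
  "scaled P n x = (1 / sqrt (real n)) \<cdot>\<^sub>m P n x"


section \<open>Empirical and limiting spectral distributions\<close>

text \<open>The complex eigenvalues, with algebraic multiplicity.\<close>

definition spectrum_mset :: "real mat \<Rightarrow> complex multiset" where
  "spectrum_mset A = proots (char_poly (map_mat complex_of_real A))"

text \<open>The eigenvalues \<open>\<lambda>\<close> of a symmetric matrix and the numbers \<open>\<i> \<lambda>\<close> for a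
  skew-symmetric matrix are real; \<^const>\<open>Re\<close> only converts them to type \<^typ>\<open>real\<close>.\<close>

definition esd_sym :: "real mat \<Rightarrow> real \<Rightarrow> real" where
  "esd_sym A t = real (size {# l \<in># spectrum_mset A. Re l \<le> t #}) / real (dim_row A)"

definition esd_skew :: "real mat \<Rightarrow> real \<Rightarrow> real" where
  "esd_skew A t = real (size {# l \<in># spectrum_mset A. Re (\<i> * l) \<le> t #}) / real (dim_row A)"

definition distribution_function :: "(real \<Rightarrow> real) \<Rightarrow> bool" where
  "distribution_function F \<longleftrightarrow> (\<exists>\<mu>. real_distribution \<mu> \<and> F = cdf \<mu>)"

text \<open>\<open>E\<close> is the empirical spectral distribution in use, \<^const>\<open>esd_sym\<close> or
  \<^const>\<open>esd_skew\<close>, and \<open>A n \<omega>\<close> is the \<open>n\<close>-th random matrix at the outcome \<open>\<omega>\<close>;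
  \<^const>\<open>weak_conv\<close> is convergence at all continuity points of the limit.\<close>

definition is_lsd ::
  "'w measure \<Rightarrow> (real mat \<Rightarrow> real \<Rightarrow> real) \<Rightarrow> (nat \<Rightarrow> 'w \<Rightarrow> real mat) \<Rightarrow> (real \<Rightarrow> real) \<Rightarrow> bool"
where
  "is_lsd M E A F \<longleftrightarrow>
     distribution_function F \<and> (AE \<omega> in M. weak_conv (\<lambda>n. E (A n \<omega>)) F)"

end

theory Submission
  imports Defs "Jordan_Normal_Form.Schur_Decomposition" "HOL-Number_Theory.Cong" "HOL-Combinatorics.Multiset_Permutations" "HOL-Complex_Analysis.Cauchy_Integral_Formula"
begin

text \<open>The proof is by the method of moments. A Hankel matrix is a corner of a reverse circulant matrix of twice its
  size, so all four ensembles have entries \<open>\<phi>(i/N, j/N) y\<^bsub>(i + j) mod N\<^esub>\<close> with \<open>N = d n\<close>, a weight \<open>\<phi>\<close>, and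
  \<open>d = 2\<close> or \<open>d = 1\<close>; the skew-symmetric ones become Hermitian after multiplication by \<open>\<i>\<close>. The trace
  of the \<open>p\<close>-th power is a sum over closed walks whose \<open>t\<close>-th step leads from \<open>a\<close> to \<open>l\<^bsub>t\<^esub> - a\<close> modulo \<open>N\<close>,
  for a word of labels \<open>l\<close>. If all moments are bounded, only words in which each letter occurs exactly twice
  contribute, their weights are Riemann sums, and a fourth-moment bound gives almost sure convergence.
  For i.i.d. input with variance \<open>1\<close>, truncation changes the characteristic function of the spectral
  distribution by an amount controlled by the \<open>L\<^sup>2\<close> norm of the removed part, by a Lipschitz bound for
  spectral sums and a maximal inequality. The limits for \<open>\<phi>\<close> and its skew version have different sixth moments:
  no word contributes more to the skew limit, and the word \<open>abcabc\<close> contributes strictly less.\<close>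

section \<open>Hermitian matrices\<close>

no_notation inner (infix "\<bullet>" 70)
no_notation Finite_Cartesian_Product.vec_nth (infixl "$" 90)

text \<open>On the torus a start and a word of labels determine a walk, and closing up is a single
  linear congruence: in even length the start drops out of it, in odd length it has at most two
  solutions. For even powers the same counting would bound the variance of the normalised trace only
  by order 1/n, which is not summable; this is why fourth moments, of order n^-2, are needed,
  whereas for odd powers the second moment already has that order. The weights may jump on the
  diagonal and at multiples of 1/2, so word sums are treated by dominated convergence at generic
  points, and only the existence of their limits is used. Up to a geometric factor the moment of
  order 2k is at most (2k)!/k!, so the limiting characteristic function is a power series and
  determines the moments; this is what turns unequal moments into unequal distributions. Order six
  is the first one where a difference can be expected: in orders two and four only walks that
  retrace their steps survive in the limit, and their weights are products of squared moduli of
  \<phi>, which agree for both ensembles off the diagonal.\<close>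

definition adj :: "complex mat \<Rightarrow> complex mat" where
  "adj A = mat (dim_col A) (dim_row A) (\<lambda>(i, j). cnj (A $$ (j, i)))"

lemma adj_carrier [simp]: "A \<in> carrier_mat m n \<Longrightarrow> adj A \<in> carrier_mat n m"
  by (auto simp: adj_def)

lemma adj_dim [simp]: "dim_row (adj A) = dim_col A" "dim_col (adj A) = dim_row A"
  by (auto simp: adj_def)

lemma adj_index [simp]: "i < dim_col A \<Longrightarrow> j < dim_row A \<Longrightarrow> adj A $$ (i, j) = cnj (A $$ (j, i))"
  by (auto simp: adj_def)

lemma adj_adj [simp]: "adj (adj A) = A"
  by (rule eq_matI) auto

lemma adj_mult:
  assumes "A \<in> carrier_mat l m" "B \<in> carrier_mat m n"
  shows "adj (A * B) = adj B * adj A"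
proof (rule eq_matI)
  fix i j assume "i < dim_row (adj B * adj A)" "j < dim_col (adj B * adj A)"
  then show "adj (A * B) $$ (i, j) = (adj B * adj A) $$ (i, j)"
    using assms by (auto simp: scalar_prod_def mult.commute intro!: sum.cong)
qed (use assms in auto)

lemma adj_one_block:
  assumes "a \<in> carrier_mat 1 1" "D \<in> carrier_mat m m"
  shows "adj (four_block_mat a (0\<^sub>m 1 m) (0\<^sub>m m 1) D) = four_block_mat (adj a) (0\<^sub>m 1 m) (0\<^sub>m m 1) (adj D)"
  by (rule eq_matI) (use assms in auto)

text \<open>Gram-Schmidt on a basis that begins with an eigenvector keeps this vector in front, so
  after normalisation column 0 of W is a unit eigenvector. Conjugation by W therefore clears column
  0; row 0 is left to Hermitian symmetry.\<close>

lemma unit_eigenvector_unitary: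
  fixes A :: "complex mat"
  assumes A: "A \<in> carrier_mat n n" and n: "n \<noteq> 0"
  obtains W e where "W \<in> carrier_mat n n" "adj W * W = 1\<^sub>m n" "W * adj W = 1\<^sub>m n"
    "\<And>i. i < n \<Longrightarrow> (adj W * A * W) $$ (i, 0) = (if i = 0 then e else 0)"
proof -
  from char_poly_factorized[OF A] obtain es where
    es: "char_poly A = (\<Prod>a\<leftarrow>es. [:- a, 1:])" "length es = n" by auto
  with n obtain e es' where "es = e # es'" by (cases es) auto
  with es have "poly (char_poly A) e = 0" by simp
  then have "eigenvalue A e" using eigenvalue_root_char_poly[OF A] by simp
  then obtain v where "eigenvector A v e" unfolding eigenvalue_def by auto
  with A have v: "v \<in> carrier_vec n" and v0: "v \<noteq> 0\<^sub>v n" and ev: "A *\<^sub>v v = e \<cdot>\<^sub>v v"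
    unfolding eigenvector_def by auto
  interpret cof_vec_space n "TYPE(complex)" .
  define b where "b = basis_completion v"
  define ws where "ws = gram_schmidt n b"
  from basis_completion[OF v v0, folded b_def]
  have b: "distinct b" "\<not> lin_dep (set b)" "set b \<subseteq> carrier_vec n" "hd b = v" "length b = n" by auto
  with n obtain vs where bv: "b = v # vs" by (cases b) auto
  from gram_schmidt_result[OF b(3) b(1) b(2) refl, folded ws_def]
  have ws: "set ws \<subseteq> carrier_vec n" "corthogonal ws" "length ws = n" by (auto simp: b)
  have hdws: "ws ! 0 = v"
    using gram_schmidt_hd[OF v, of vs, folded bv] ws(3) n unfolding ws_def[symmetric]
    by (metis hd_conv_nth length_0_conv)
  have wsc: "ws ! j \<in> carrier_vec n" if "j < n" for j using ws that by (metis nth_mem subsetD)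
  \<comment> \<open>\<open>gram_schmidt\<close> yields orthogonal vectors that are not normalised;
    \<open>s j\<close> is the squared length of the j-th one.\<close>
  define s where "s j = (\<Sum>i<n. (cmod (ws ! j $ i))\<^sup>2)" for j
  have inner: "(\<Sum>i<n. ws ! j $ i * cnj (ws ! k $ i)) = (if j = k then of_real (s j) else 0)"
    and spos: "s j > 0" if "j < n" "k < n" for j k
  proof -
    have sp: "(\<Sum>i<n. ws ! j $ i * cnj (ws ! k $ i)) = ws ! j \<bullet>c ws ! k" if "k < n" for k
      using wsc[OF that] by (auto simp: scalar_prod_def atLeast0LessThan intro!: sum.cong)
    have sq: "(\<Sum>i<n. ws ! j $ i * cnj (ws ! j $ i)) = of_real (s j)"
      by (simp only: s_def of_real_sum complex_norm_square [symmetric])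
    show "(\<Sum>i<n. ws ! j $ i * cnj (ws ! k $ i)) = (if j = k then of_real (s j) else 0)"
      using sq sp[OF that(2)] corthogonalD[OF ws(2), of j k] that ws(3) by auto
    have "of_real (s j) \<noteq> (0::complex)"
      using sq sp[OF that(1)] corthogonalD[OF ws(2), of j j] that ws(3) by auto
    moreover have "s j \<ge> 0" unfolding s_def by (rule sum_nonneg) auto
    ultimately show "s j > 0" by auto
  qed
  define W where "W = mat n n (\<lambda>(i, j). ws ! j $ i / of_real (sqrt (s j)))"
  have W: "W \<in> carrier_mat n n" by (simp add: W_def)
  have WW: "adj W * W = 1\<^sub>m n"
  proof (rule eq_matI)
    fix i j assume ij: "i < dim_row (1\<^sub>m n :: complex mat)" "j < dim_col (1\<^sub>m n :: complex mat)"
    then have ij: "i < n" "j < n" by auto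
    have "(adj W * W) $$ (i, j) = (\<Sum>k<n. cnj (W $$ (k, i)) * W $$ (k, j))"
      using ij W by (auto simp: scalar_prod_def atLeast0LessThan)
    also have "\<dots> = (\<Sum>k<n. ws ! j $ k * cnj (ws ! i $ k)) / (of_real (sqrt (s i)) * of_real (sqrt (s j)))"
      unfolding sum_divide_distrib using ij by (intro sum.cong) (auto simp: W_def)
    also have "\<dots> = (if i = j then 1 else 0)"
      using spos[OF ij(1) ij(1)] ij by (subst inner) (auto simp flip: of_real_mult)
    finally show "(adj W * W) $$ (i, j) = 1\<^sub>m n $$ (i, j)" using ij by simp
  qed (use W in auto)
  have WW': "W * adj W = 1\<^sub>m n"
    using mat_mult_left_right_inverse[OF _ W WW] W by auto
  have "(adj W * A * W) $$ (i, 0) = (if i = 0 then e else 0)" if i: "i < n" for i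
  proof -
    have cW: "col W 0 = (1 / of_real (sqrt (s 0))) \<cdot>\<^sub>v v"
      using W n v hdws by (intro eq_vecI) (auto simp: W_def)
    have AW: "A *\<^sub>v col W 0 = e \<cdot>\<^sub>v col W 0"
      unfolding cW using A v by (subst mult_mat_vec) (auto simp: ev smult_smult_assoc mult.commute)
    have "(adj W * A * W) $$ (i, 0) = (adj W * (A * W)) $$ (i, 0)"
      using A W by (subst assoc_mult_mat[of _ n n _ n _ n]) auto
    also have "\<dots> = row (adj W) i \<bullet> (A *\<^sub>v col W 0)"
      using A W n i by (auto simp: mult_mat_vec_def)
    also have "\<dots> = e * (row (adj W) i \<bullet> col W 0)"
      unfolding AW using W n i by (subst scalar_prod_smult_right) auto
    also have "row (adj W) i \<bullet> col W 0 = (adj W * W) $$ (i, 0)"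
      using W n i by auto
    also have "\<dots> = (if i = 0 then 1 else 0)" unfolding WW using n i by auto
    finally show ?thesis by simp
  qed
  with W WW WW' show ?thesis by (rule that)
qed

text \<open>Deflation: conjugation with a unitary matrix whose first column is an eigenvector leaves
  a block diagonal matrix with blocks of sizes 1 and m. The lower block is again Hermitian and falls
  to the induction hypothesis.\<close>

lemma hermitian_unitary_diagonalization:
  fixes A :: "complex mat"
  assumes "A \<in> carrier_mat n n" "adj A = A"
  shows "\<exists>U d. U \<in> carrier_mat n n \<and> adj U * U = 1\<^sub>m n \<and>
    A = U * mat n n (\<lambda>(i, j). if i = j then complex_of_real (d i) else 0) * adj U"
  using assms
proof (induction n arbitrary: A)
  case 0
  then show ?case by (intro exI[of _ "1\<^sub>m 0"] exI[of _ "\<lambda>_. 0"]) (auto intro!: eq_matI)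
next
  case (Suc m)
  let ?n = "Suc m"
  note A = Suc.prems(1)
  obtain W e where W: "W \<in> carrier_mat ?n ?n" and WW: "adj W * W = 1\<^sub>m ?n" "W * adj W = 1\<^sub>m ?n"
    and col0: "\<And>i. i < ?n \<Longrightarrow> (adj W * A * W) $$ (i, 0) = (if i = 0 then e else 0)"
    using unit_eigenvector_unitary[OF A] by auto
  define A' where "A' = adj W * A * W"
  have A': "A' \<in> carrier_mat ?n ?n" using A W by (auto simp: A'_def)
  have "adj A' = adj W * adj (adj W * A)"
    unfolding A'_def using A W by (intro adj_mult) auto
  also have "adj (adj W * A) = A * W"
    using A W Suc.prems(2) by (subst adj_mult) auto
  finally have herm: "adj A' = A'"
    unfolding A'_def using A W by (subst assoc_mult_mat[of _ ?n ?n _ ?n _ ?n]) auto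
  then have sym: "A' $$ (i, j) = cnj (A' $$ (j, i))" if "i < ?n" "j < ?n" for i j
    using that A' by (metis adj_index carrier_matD)
  \<comment> \<open>A diagonal entry of a Hermitian matrix is real; this is where the eigenvalues
    become real.\<close>
  have e: "e = complex_of_real (Re e)"
    using sym[of 0 0] col0[of 0] unfolding A'_def by (simp add: complex_eq_iff)
  define A3 where "A3 = mat m m (\<lambda>(i, j). A' $$ (Suc i, Suc j))"
  have A3: "A3 \<in> carrier_mat m m" by (simp add: A3_def)
  have "adj A3 = A3"
  proof (rule eq_matI)
    fix i j assume "i < dim_row A3" "j < dim_col A3"
    then show "adj A3 $$ (i, j) = A3 $$ (i, j)" using sym[of "Suc i" "Suc j"] by (simp add: A3_def)
  qed (simp_all add: A3_def)
  from Suc.IH[OF A3 this] obtain U d where U: "U \<in> carrier_mat m m" "adj U * U = 1\<^sub>m m"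
    and dec: "A3 = U * mat m m (\<lambda>(i, j). if i = j then complex_of_real (d i) else 0) * adj U" by blast
  define D where "D = mat m m (\<lambda>(i, j). if i = j then complex_of_real (d i) else 0)"
  have D: "D \<in> carrier_mat m m" by (simp add: D_def)
  let ?blk = "\<lambda>a M. four_block_mat a (0\<^sub>m 1 m) (0\<^sub>m m 1) M"
  let ?a = "mat 1 1 (\<lambda>_. e)"
  define d' where "d' = case_nat (Re e) d"
  have D': "mat ?n ?n (\<lambda>(i, j). if i = j then complex_of_real (d' i) else 0) = ?blk ?a D"
    using e by (intro eq_matI) (auto simp: D_def d'_def split: nat.split)
  define V where "V = ?blk (1\<^sub>m 1) U"
  have V: "V \<in> carrier_mat ?n ?n" using U by (auto simp: V_def)
  have adjV: "adj V = ?blk (1\<^sub>m 1) (adj U)" unfolding V_def using U by (subst adj_one_block) auto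
  have one: "1\<^sub>m ?n = ?blk (1\<^sub>m 1) (1\<^sub>m m)" by (intro eq_matI) auto
  have VV: "adj V * V = 1\<^sub>m ?n"
    unfolding adjV one unfolding V_def
    by (subst mult_four_block_mat[of _ 1 1 _ m _ m]) (use U in auto)
  have "V * ?blk ?a D = ?blk ?a (U * D)"
    unfolding V_def by (subst mult_four_block_mat[of _ 1 1 _ m _ m]) (use U D in auto)
  then have "V * ?blk ?a D * adj V = ?blk ?a A3"
    unfolding adjV dec D_def[symmetric]
    by (simp, subst mult_four_block_mat[of _ 1 1 _ m _ m]) (use U D in auto)
  \<comment> \<open>The zeros below the corner come from the eigenvector column, those to the right
    of it from Hermitian symmetry.\<close>
  also have "\<dots> = A'"
  proof (rule eq_matI)
    fix i j assume "i < dim_row A'" "j < dim_col A'"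
    then have ij: "i < ?n" "j < ?n" using A' by auto
    show "?blk ?a A3 $$ (i, j) = A' $$ (i, j)"
      using ij col0 sym[of 0 j] by (cases i; cases j) (auto simp: A3_def A'_def[symmetric])
  qed (use A' A3 in auto)
  finally have A'dec: "V * ?blk ?a D * adj V = A'" .
  have blk: "?blk ?a D \<in> carrier_mat ?n ?n" using D by auto
  have "W * A' * adj W = A"
  proof -
    have "W * A' * adj W = (W * adj W) * A * (W * adj W)"
      unfolding A'_def using A W
      by (simp add: assoc_mult_mat[of _ ?n ?n _ ?n _ ?n] mult_carrier_mat[of _ ?n ?n _ ?n])
    then show ?thesis using WW A by simp
  qed
  then have "A = W * (V * ?blk ?a D * adj V) * adj W"
    unfolding A'dec by (rule HOL.sym)
  also have "\<dots> = (W * V) * ?blk ?a D * adj (W * V)"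
    using W V blk by (simp add: adj_mult[of _ ?n ?n _ ?n] assoc_mult_mat[of _ ?n ?n _ ?n _ ?n] mult_carrier_mat[of _ ?n ?n _ ?n])
  finally have Adec: "A = (W * V) * ?blk ?a D * adj (W * V)" .
  have "adj (W * V) * (W * V) = adj V * ((adj W * W) * V)"
    using W V by (simp add: adj_mult[of _ ?n ?n _ ?n] assoc_mult_mat[of _ ?n ?n _ ?n _ ?n] mult_carrier_mat[of _ ?n ?n _ ?n])
  also have "\<dots> = 1\<^sub>m ?n" using V WW VV by simp
  finally show ?case
    using Adec W V unfolding D'[symmetric] by (intro exI[of _ "W * V"] exI[of _ d']) auto
qed


section \<open>Spectral decompositions written as finite sums\<close>

definition eigensystem :: "nat \<Rightarrow> (nat \<Rightarrow> nat \<Rightarrow> complex) \<Rightarrow> (nat \<Rightarrow> nat \<Rightarrow> complex) \<Rightarrow> (nat \<Rightarrow> real) \<Rightarrow> bool" where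
  "eigensystem n M u d \<longleftrightarrow>
     (\<forall>i<n. \<forall>j<n. (\<Sum>k<n. cnj (u k i) * u k j) = (if i = j then 1 else 0)) \<and>
     (\<forall>i<n. \<forall>j<n. (\<Sum>k<n. u i k * cnj (u j k)) = (if i = j then 1 else 0)) \<and>
     (\<forall>i<n. \<forall>j<n. M i j = (\<Sum>k<n. u i k * of_real (d k) * cnj (u j k)))"

lemma proots_linear_factors: "proots (\<Prod>a\<leftarrow>as. [:- a, 1:]) = mset (as :: complex list)"
proof (induction as)
  case (Cons a as)
  have "(\<Prod>a\<leftarrow>as. [:- a, 1:]) \<noteq> 0" by (auto simp: prod_list_zero_iff)
  then have "proots ([:- a, 1:] * (\<Prod>a\<leftarrow>as. [:- a, 1:])) = {#a#} + mset as"
    using Cons by (subst proots_mult) auto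
  then show ?case by simp
qed auto

text \<open>The factor c transfers the diagonalisation to multiples of a Hermitian matrix: a real
  skew-symmetric A is \<open>- \<i>\<close> times the Hermitian matrix \<open>\<i>\<close> A. One
  listing d serves all c and A.\<close>

lemma hermitian_eigensystem:
  fixes M :: "nat \<Rightarrow> nat \<Rightarrow> complex"
  assumes "\<And>i j. i < n \<Longrightarrow> j < n \<Longrightarrow> M i j = cnj (M j i)"
  obtains u d where "eigensystem n M u d"
    "\<And>c A. map_mat complex_of_real A = c \<cdot>\<^sub>m mat n n (\<lambda>(i, j). M i j) \<Longrightarrow>
       spectrum_mset A = mset (map (\<lambda>k. c * of_real (d k)) [0..<n])"
proof -
  define H where "H = mat n n (\<lambda>(i, j). M i j)"
  have H: "H \<in> carrier_mat n n" by (simp add: H_def)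
  have "adj H = H"
  proof (rule eq_matI)
    fix i j assume "i < dim_row H" "j < dim_col H"
    then show "adj H $$ (i, j) = H $$ (i, j)" using assms[of i j] by (simp add: H_def)
  qed (simp_all add: H_def)
  from hermitian_unitary_diagonalization[OF H this] obtain U d where U: "U \<in> carrier_mat n n"
    and UU: "adj U * U = 1\<^sub>m n"
    and dec0: "H = U * mat n n (\<lambda>(i, j). if i = j then complex_of_real (d i) else 0) * adj U" by blast
  define D where "D = mat n n (\<lambda>(i, j). if i = j then complex_of_real (d i) else 0)"
  have D: "D \<in> carrier_mat n n" by (simp add: D_def)
  have dec: "H = U * D * adj U" using dec0 by (simp add: D_def)
  have UU': "U * adj U = 1\<^sub>m n"
    using mat_mult_left_right_inverse[OF _ U UU] U by auto
  have cols: "(\<Sum>k<n. cnj (U $$ (k, i)) * U $$ (k, j)) = (if i = j then 1 else 0)" if "i < n" "j < n" for i j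
  proof -
    have "(adj U * U) $$ (i, j) = (\<Sum>k<n. cnj (U $$ (k, i)) * U $$ (k, j))"
      using that U by (auto simp: scalar_prod_def atLeast0LessThan)
    then show ?thesis unfolding UU using that by simp
  qed
  have rows: "(\<Sum>k<n. U $$ (i, k) * cnj (U $$ (j, k))) = (if i = j then 1 else 0)" if "i < n" "j < n" for i j
  proof -
    have "(U * adj U) $$ (i, j) = (\<Sum>k<n. U $$ (i, k) * cnj (U $$ (j, k)))"
      using that U by (auto simp: scalar_prod_def atLeast0LessThan)
    then show ?thesis unfolding UU' using that by simp
  qed
  have ent: "M i j = (\<Sum>k<n. U $$ (i, k) * of_real (d k) * cnj (U $$ (j, k)))" if "i < n" "j < n" for i j
  proof -
    have UD: "(U * D) $$ (i, k) = U $$ (i, k) * of_real (d k)" if "k < n" for k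
    proof -
      have "(U * D) $$ (i, k) = (\<Sum>l<n. U $$ (i, l) * D $$ (l, k))"
        using that \<open>i < n\<close> U D by (auto simp: scalar_prod_def atLeast0LessThan)
      also have "\<dots> = (\<Sum>l<n. if l = k then U $$ (i, k) * of_real (d k) else 0)"
        using that by (intro sum.cong) (auto simp: D_def)
      finally show ?thesis using that by simp
    qed
    have "M i j = (U * D * adj U) $$ (i, j)" using that unfolding dec[symmetric] H_def by simp
    also have "\<dots> = (\<Sum>k<n. (U * D) $$ (i, k) * cnj (U $$ (j, k)))"
      using that U D by (auto simp: scalar_prod_def atLeast0LessThan intro!: sum.cong)
    finally show ?thesis using UD by simp
  qed
  show ?thesis
  proof (rule that[of "\<lambda>i j. U $$ (i, j)" d])
    show "eigensystem n M (\<lambda>i j. U $$ (i, j)) d"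
      unfolding eigensystem_def using cols rows ent by auto
  next
    fix c A assume A: "map_mat complex_of_real A = c \<cdot>\<^sub>m mat n n (\<lambda>(i, j). M i j)"
    have E: "U * (c \<cdot>\<^sub>m D) * adj U = c \<cdot>\<^sub>m H"
      unfolding dec using U D by (simp add: mult_smult_distrib[of _ n n _ n] mult_smult_assoc_mat[of _ n n _ n])
    have "similar_mat_wit (c \<cdot>\<^sub>m H) (c \<cdot>\<^sub>m D) U (adj U)"
      by (rule similar_mat_witI[of _ _ n]) (use U D H UU UU' E in auto)
    then have "similar_mat (c \<cdot>\<^sub>m H) (c \<cdot>\<^sub>m D)" unfolding similar_mat_def by blast
    then have "char_poly (c \<cdot>\<^sub>m H) = char_poly (c \<cdot>\<^sub>m D)" by (rule char_poly_similar)
    also have "\<dots> = (\<Prod>a\<leftarrow>diag_mat (c \<cdot>\<^sub>m D). [:- a, 1:])"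
      using D by (intro char_poly_upper_triangular[of _ n]) (auto simp: D_def)
    also have "diag_mat (c \<cdot>\<^sub>m D) = map (\<lambda>k. c * of_real (d k)) [0..<n]"
      using D by (auto simp: diag_mat_def D_def)
    finally have "char_poly (map_mat complex_of_real A) = (\<Prod>a\<leftarrow>map (\<lambda>k. c * of_real (d k)) [0..<n]. [:- a, 1:])"
      unfolding A H_def .
    then show "spectrum_mset A = mset (map (\<lambda>k. c * of_real (d k)) [0..<n])"
      unfolding spectrum_mset_def by (simp only: proots_linear_factors)
  qed
qed

lemma parseval_unitary:
  fixes u :: "nat \<Rightarrow> nat \<Rightarrow> complex"
  assumes "\<And>i j. i < n \<Longrightarrow> j < n \<Longrightarrow> (\<Sum>k<n. u i k * cnj (u j k)) = (if i = j then 1 else 0)"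
  shows "(\<Sum>k<n. (cmod (\<Sum>i<n. cnj (u i k) * y i))\<^sup>2) = (\<Sum>i<n. (cmod (y i))\<^sup>2)"
proof -
  have "complex_of_real (\<Sum>k<n. (cmod (\<Sum>i<n. cnj (u i k) * y i))\<^sup>2)
    = (\<Sum>k<n. (\<Sum>i<n. cnj (u i k) * y i) * (\<Sum>j<n. u j k * cnj (y j)))"
    by (simp only: of_real_sum complex_norm_square) simp
  also have "\<dots> = (\<Sum>k<n. \<Sum>i<n. \<Sum>j<n. (y i * cnj (y j)) * (u j k * cnj (u i k)))"
    by (simp add: sum_product mult_ac)
  also have "\<dots> = (\<Sum>i<n. \<Sum>j<n. (y i * cnj (y j)) * (\<Sum>k<n. u j k * cnj (u i k)))"
    by (simp only: sum_distrib_left) (subst sum.swap, rule sum.cong[OF refl], rule sum.swap)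
  also have "\<dots> = (\<Sum>i<n. \<Sum>j<n. if i = j then y i * cnj (y i) else 0)"
    using assms by (intro sum.cong refl) auto
  also have "\<dots> = complex_of_real (\<Sum>i<n. (cmod (y i))\<^sup>2)"
    by (simp only: of_real_sum complex_norm_square) simp
  finally show ?thesis by (simp only: of_real_eq_iff)
qed

text \<open>Instead of pairing the eigenvalues as in the Hoffman--Wielandt inequality, one compares all
  pairs of eigenvalues with the doubly stochastic weights given by the overlaps of the eigenvectors.\<close>

lemma lipschitz_spectral_sum:
  fixes f :: "real \<Rightarrow> complex"
  assumes A: "eigensystem n A u d" and B: "eigensystem n B v e"
    and L: "\<And>x y. cmod (f x - f y) \<le> L * \<bar>x - y\<bar>" and L0: "L \<ge> 0"
  shows "cmod ((\<Sum>k<n. f (d k)) - (\<Sum>k<n. f (e k)))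
    \<le> L * sqrt (real n * (\<Sum>i<n. \<Sum>j<n. (cmod (A i j - B i j))\<^sup>2))"
proof -
  note A' = A[unfolded eigensystem_def, rule_format] and B' = B[unfolded eigensystem_def, rule_format]
  have uc: "(\<Sum>k<n. cnj (u k i) * u k j) = (if i = j then 1 else 0)"
    and ur: "(\<Sum>k<n. u i k * cnj (u j k)) = (if i = j then 1 else 0)"
    and Ae: "A i j = (\<Sum>k<n. u i k * of_real (d k) * cnj (u j k))" if "i < n" "j < n" for i j
    using A' that by auto
  have vc: "(\<Sum>k<n. cnj (v k i) * v k j) = (if i = j then 1 else 0)"
    and vr: "(\<Sum>k<n. v i k * cnj (v j k)) = (if i = j then 1 else 0)"
    and Be: "B i j = (\<Sum>k<n. v i k * of_real (e k) * cnj (v j k))" if "i < n" "j < n" for i j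
    using B' that by auto
  \<comment> \<open>G holds the overlaps of the two eigenbases. As a change of orthonormal basis it
    is unitary, so the squared moduli \<open>w\<close> have row and column sums 1.\<close>
  define G where "G k l = (\<Sum>i<n. cnj (u i k) * v i l)" for k l
  define w where "w k l = (cmod (G k l))\<^sup>2" for k l
  have w0: "w k l \<ge> 0" for k l by (simp add: w_def)
  have unit: "(\<Sum>i<n. (cmod (x i k))\<^sup>2) = 1" if "(\<Sum>i<n. cnj (x i k) * x i k) = (1::complex)" for x :: "nat \<Rightarrow> nat \<Rightarrow> complex" and k
  proof -
    have "complex_of_real (\<Sum>i<n. (cmod (x i k))\<^sup>2) = 1"
      using that by (simp only: of_real_sum complex_norm_square mult.commute)
    then show ?thesis by (simp only: of_real_eq_1_iff)
  qed
  have wk: "(\<Sum>k<n. w k l) = 1" if "l < n" for l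
  proof -
    have "(\<Sum>i<n. cnj (v i l) * v i l) = 1" using vc[OF that that] by simp
    from unit[of v l, OF this] show ?thesis
      using parseval_unitary[of n u "\<lambda>i. v i l", OF ur] by (simp only: w_def G_def)
  qed
  have wl: "(\<Sum>l<n. w k l) = 1" if "k < n" for k
  proof -
    have "G k l = cnj (\<Sum>i<n. cnj (v i l) * u i k)" for l
      unfolding G_def by (simp add: mult.commute)
    then have "w k l = (cmod (\<Sum>i<n. cnj (v i l) * u i k))\<^sup>2" for l
      unfolding w_def by (metis complex_mod_cnj)
    then show ?thesis
      using parseval_unitary[of n v "\<lambda>i. u i k", OF vr] uc[OF that that] by (simp add: unit)
  qed
  \<comment> \<open>With respect to the two eigenbases the difference A - B has the entries
    \<open>(d k - e l) * G k l\<close>: A acts from the left by \<open>d k\<close>, B from the right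
    by \<open>e l\<close>.\<close>
  have key: "(\<Sum>i<n. cnj (u i k) * (\<Sum>j<n. (A i j - B i j) * v j l)) = of_real (d k - e l) * G k l"
    if kl: "k < n" "l < n" for k l
  proof -
    have Bv: "(\<Sum>j<n. B i j * v j l) = of_real (e l) * v i l" if "i < n" for i
    proof -
      have "(\<Sum>j<n. B i j * v j l) = (\<Sum>j<n. \<Sum>m<n. v i m * of_real (e m) * (cnj (v j m) * v j l))"
        using that by (intro sum.cong refl) (simp add: Be sum_distrib_right sum_distrib_left mult_ac)
      also have "\<dots> = (\<Sum>m<n. v i m * of_real (e m) * (\<Sum>j<n. cnj (v j m) * v j l))"
        by (subst sum.swap) (simp only: sum_distrib_left)
      also have "\<dots> = (\<Sum>m<n. if m = l then v i l * of_real (e l) else 0)"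
        using kl by (intro sum.cong refl) (auto simp: vc)
      finally show ?thesis using kl by (simp add: mult.commute)
    qed
    have uA: "(\<Sum>i<n. cnj (u i k) * A i j) = of_real (d k) * cnj (u j k)" if "j < n" for j
    proof -
      have "(\<Sum>i<n. cnj (u i k) * A i j) = (\<Sum>i<n. \<Sum>m<n. of_real (d m) * cnj (u j m) * (cnj (u i k) * u i m))"
        using that by (intro sum.cong refl) (simp add: Ae sum_distrib_left mult_ac)
      also have "\<dots> = (\<Sum>m<n. of_real (d m) * cnj (u j m) * (\<Sum>i<n. cnj (u i k) * u i m))"
        by (subst sum.swap) (simp only: sum_distrib_left)
      also have "\<dots> = (\<Sum>m<n. if m = k then of_real (d k) * cnj (u j k) else 0)"
        using kl by (intro sum.cong refl) (auto simp: uc)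
      finally show ?thesis using kl by simp
    qed
    have "(\<Sum>i<n. cnj (u i k) * (\<Sum>j<n. (A i j - B i j) * v j l))
      = (\<Sum>i<n. \<Sum>j<n. (cnj (u i k) * A i j) * v j l) - (\<Sum>i<n. cnj (u i k) * (\<Sum>j<n. B i j * v j l))"
      by (simp add: sum_subtractf sum_distrib_left algebra_simps)
    also have "(\<Sum>i<n. \<Sum>j<n. (cnj (u i k) * A i j) * v j l) = (\<Sum>j<n. (\<Sum>i<n. cnj (u i k) * A i j) * v j l)"
      by (subst sum.swap) (simp only: sum_distrib_right)
    also have "\<dots> = (\<Sum>j<n. of_real (d k) * cnj (u j k) * v j l)"
      by (intro sum.cong refl) (simp add: uA)
    also have "\<dots> = of_real (d k) * G k l"
      by (simp add: G_def sum_distrib_left mult_ac)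
    also have "(\<Sum>i<n. cnj (u i k) * (\<Sum>j<n. B i j * v j l)) = (\<Sum>i<n. cnj (u i k) * (of_real (e l) * v i l))"
      by (intro sum.cong refl) (simp add: Bv)
    also have "\<dots> = of_real (e l) * G k l"
      by (simp add:  G_def sum_distrib_left mult_ac)
    finally show ?thesis by (simp add: algebra_simps)
  qed
  \<comment> \<open>Unitary invariance of the Hilbert-Schmidt norm: Parseval for u on the left and,
    after conjugation, for v on the right.\<close>
  have "(\<Sum>k<n. \<Sum>l<n. w k l * (d k - e l)\<^sup>2)
      = (\<Sum>l<n. \<Sum>k<n. (cmod (\<Sum>i<n. cnj (u i k) * (\<Sum>j<n. (A i j - B i j) * v j l)))\<^sup>2)"
    by (subst sum.swap, intro sum.cong refl, subst key)
      (simp_all only: lessThan_iff norm_mult power_mult_distrib w_def norm_of_real power2_abs mult.commute)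
  also have "\<dots> = (\<Sum>l<n. \<Sum>i<n. (cmod (\<Sum>j<n. (A i j - B i j) * v j l))\<^sup>2)"
    by (subst parseval_unitary[OF ur]) auto
  also have "\<dots> = (\<Sum>i<n. \<Sum>l<n. (cmod (\<Sum>j<n. cnj (v j l) * cnj (A i j - B i j)))\<^sup>2)"
  proof (subst sum.swap, intro sum.cong refl)
    fix i l
    have "(\<Sum>j<n. cnj (v j l) * cnj (A i j - B i j)) = cnj (\<Sum>j<n. (A i j - B i j) * v j l)"
      by (simp add: mult.commute)
    then show "(cmod (\<Sum>j<n. (A i j - B i j) * v j l))\<^sup>2 = (cmod (\<Sum>j<n. cnj (v j l) * cnj (A i j - B i j)))\<^sup>2"
      by (metis complex_mod_cnj)
  qed
  also have "\<dots> = (\<Sum>i<n. \<Sum>j<n. (cmod (A i j - B i j))\<^sup>2)"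
    by (subst parseval_unitary[OF vr]) (auto simp del: complex_cnj_diff)
  finally have HS: "(\<Sum>k<n. \<Sum>l<n. w k l * (d k - e l)\<^sup>2) = (\<Sum>i<n. \<Sum>j<n. (cmod (A i j - B i j))\<^sup>2)" .
  have "(\<Sum>k<n. f (d k)) = (\<Sum>k<n. \<Sum>l<n. of_real (w k l) * f (d k))"
    by (intro sum.cong refl) (simp add: wl flip: sum_distrib_right of_real_sum)
  moreover have "(\<Sum>l<n. f (e l)) = (\<Sum>k<n. \<Sum>l<n. of_real (w k l) * f (e l))"
    by (subst sum.swap, intro sum.cong refl) (simp add: wk flip: sum_distrib_right of_real_sum)
  ultimately have "(\<Sum>k<n. f (d k)) - (\<Sum>k<n. f (e k)) = (\<Sum>k<n. \<Sum>l<n. of_real (w k l) * (f (d k) - f (e l)))"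
    by (simp add: sum_subtractf right_diff_distrib)
  then have "cmod ((\<Sum>k<n. f (d k)) - (\<Sum>k<n. f (e k))) \<le> (\<Sum>k<n. \<Sum>l<n. w k l * (L * \<bar>d k - e l\<bar>))"
    using w0 by (auto simp: norm_mult intro!: sum_norm_le mult_left_mono L order_trans[OF norm_sum] sum_mono)
  \<comment> \<open>Cauchy-Schwarz with the weight split into two square roots: the first factor
    sums to n, the second to the squared Hilbert-Schmidt norm just computed.\<close>
  also have "\<dots> = L * (\<Sum>(k, l)\<in>{..<n}\<times>{..<n}. sqrt (w k l) * (sqrt (w k l) * \<bar>d k - e l\<bar>))"
    using w0 by (simp add: sum_distrib_left mult_ac flip: sum.cartesian_product mult.assoc)
  also have "\<dots> \<le> L * sqrt (real n * (\<Sum>i<n. \<Sum>j<n. (cmod (A i j - B i j))\<^sup>2))"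
  proof (rule mult_left_mono[OF _ L0], rule real_le_rsqrt)
    have "(\<Sum>(k, l)\<in>{..<n}\<times>{..<n}. sqrt (w k l) * (sqrt (w k l) * \<bar>d k - e l\<bar>))\<^sup>2
      \<le> (\<Sum>(k, l)\<in>{..<n}\<times>{..<n}. (sqrt (w k l))\<^sup>2) * (\<Sum>(k, l)\<in>{..<n}\<times>{..<n}. (sqrt (w k l) * \<bar>d k - e l\<bar>)\<^sup>2)"
      using Cauchy_Schwarz_ineq_sum[of "\<lambda>(k, l). sqrt (w k l)" "\<lambda>(k, l). sqrt (w k l) * \<bar>d k - e l\<bar>" "{..<n}\<times>{..<n}"]
      by (simp add: case_prod_beta)
    also have "(\<Sum>(k, l)\<in>{..<n}\<times>{..<n}. (sqrt (w k l))\<^sup>2) = real n"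
      using w0 wl by (simp flip: sum.cartesian_product)
    also have "(\<Sum>(k, l)\<in>{..<n}\<times>{..<n}. (sqrt (w k l) * \<bar>d k - e l\<bar>)\<^sup>2) = (\<Sum>k<n. \<Sum>l<n. w k l * (d k - e l)\<^sup>2)"
      using w0 by (simp add: power_mult_distrib flip: sum.cartesian_product)
    finally show "(\<Sum>(k, l)\<in>{..<n}\<times>{..<n}. sqrt (w k l) * (sqrt (w k l) * \<bar>d k - e l\<bar>))\<^sup>2
       \<le> real n * (\<Sum>i<n. \<Sum>j<n. (cmod (A i j - B i j))\<^sup>2)" unfolding HS .
  qed
  finally show ?thesis .
qed

primrec fpow :: "nat \<Rightarrow> (nat \<Rightarrow> nat \<Rightarrow> complex) \<Rightarrow> nat \<Rightarrow> nat \<Rightarrow> nat \<Rightarrow> complex" where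
  "fpow n M 0 i j = (if i = j then 1 else 0)"
| "fpow n M (Suc p) i j = (\<Sum>k<n. M i k * fpow n M p k j)"

lemma eigensystem_fpow:
  assumes E: "eigensystem n M u d" and "i < n" "j < n"
  shows "fpow n M p i j = (\<Sum>k<n. u i k * of_real (d k) ^ p * cnj (u j k))"
  using assms(2,3)
proof (induction p arbitrary: i)
  case 0
  then show ?case using E by (auto simp: eigensystem_def)
next
  case (Suc p)
  have "fpow n M (Suc p) i j
    = (\<Sum>k<n. (\<Sum>a<n. u i a * of_real (d a) * cnj (u k a)) * (\<Sum>b<n. u k b * of_real (d b) ^ p * cnj (u j b)))"
    using Suc E by (auto simp: eigensystem_def)
  also have "\<dots> = (\<Sum>k<n. \<Sum>a<n. \<Sum>b<n. u i a * of_real (d a) * of_real (d b) ^ p * cnj (u j b) * (cnj (u k a) * u k b))"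
    by (simp add: sum_product mult_ac)
  also have "\<dots> = (\<Sum>a<n. \<Sum>b<n. u i a * of_real (d a) * of_real (d b) ^ p * cnj (u j b) * (\<Sum>k<n. cnj (u k a) * u k b))"
    by (simp only: sum_distrib_left) (subst sum.swap, rule sum.cong[OF refl], rule sum.swap)
  also have "\<dots> = (\<Sum>a<n. \<Sum>b<n. if b = a then u i a * of_real (d a) * of_real (d a) ^ p * cnj (u j a) else 0)"
    using E by (intro sum.cong refl) (auto simp: eigensystem_def)
  also have "\<dots> = (\<Sum>k<n. u i k * of_real (d k) ^ Suc p * cnj (u j k))"
    by (simp add: mult_ac)
  finally show ?case .
qed

lemma eigensystem_trace:
  assumes E: "eigensystem n M u d"
  shows "(\<Sum>i<n. fpow n M p i i) = of_real (\<Sum>k<n. d k ^ p)"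
proof -
  have "(\<Sum>i<n. fpow n M p i i) = (\<Sum>i<n. \<Sum>k<n. of_real (d k) ^ p * (cnj (u i k) * u i k))"
    using E by (intro sum.cong refl) (simp add: eigensystem_fpow mult_ac)
  also have "\<dots> = (\<Sum>k<n. of_real (d k) ^ p * (\<Sum>i<n. cnj (u i k) * u i k))"
    by (subst sum.swap) (simp only: sum_distrib_left)
  also have "\<dots> = (\<Sum>k<n. of_real (d k) ^ p)"
    using E by (intro sum.cong refl) (simp add: eigensystem_def)
  finally show ?thesis by simp
qed

section \<open>Moments of products of independent variables\<close>

text \<open>The expectation of the product of the variables listed in w, if they are independent
  with moments \<open>m a k\<close>: only the multiplicity of each letter counts.\<close>

definition ew :: "nat \<Rightarrow> (nat \<Rightarrow> nat \<Rightarrow> real) \<Rightarrow> nat list \<Rightarrow> real" where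
  "ew N m w = (\<Prod>a<N. m a (count_list w a))"

text \<open>\<open>centred N m w zs\<close> is the expectation of \<open>X\<^bsub>w\<^esub> \<Prod>\<^bsub>z\<^esub> (X\<^bsub>z\<^esub> - E X\<^bsub>z\<^esub>)\<close>, where \<open>X\<^bsub>w\<^esub>\<close> is the product
  of the variables listed in \<open>w\<close>, expressed through the moments \<open>m a k\<close> of the variables.\<close>

primrec centred :: "nat \<Rightarrow> (nat \<Rightarrow> nat \<Rightarrow> real) \<Rightarrow> nat list \<Rightarrow> nat list list \<Rightarrow> real" where
  "centred N m w [] = ew N m w"
| "centred N m w (z # zs) = centred N m (w @ z) zs - ew N m z * centred N m w zs"

lemma count_list_mset: "count_list w a = count (mset w) a"
  by (induction w) auto

lemma ew_mset: "mset v = mset w \<Longrightarrow> ew N m v = ew N m w"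
  by (simp add: ew_def count_list_mset)

lemma centred_mset: "mset v = mset w \<Longrightarrow> centred N m v zs = centred N m w zs"
proof (induction zs arbitrary: v w)
  case (Cons z zs)
  have "centred N m (v @ z) zs = centred N m (w @ z) zs" "centred N m v zs = centred N m w zs"
    using Cons.prems by (auto intro!: Cons.IH)
  then show ?case by simp
qed (simp, rule ew_mset)

lemma prod_list_eq_prod_count:
  assumes "finite A" "set w \<subseteq> A"
  shows "prod_list (map f w) = (\<Prod>a\<in>A. (f a :: real) ^ count_list w a)"
  using assms
proof (induction w)
  case (Cons x w)
  have "(\<Prod>a\<in>A. f a ^ count_list (x # w) a) = (\<Prod>a\<in>A. (if a = x then f x else 1) * f a ^ count_list w a)"
    by (intro prod.cong) auto
  also have "\<dots> = (\<Prod>a\<in>A. if a = x then f x else 1) * (\<Prod>a\<in>A. f a ^ count_list w a)"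
    by (rule prod.distrib)
  finally show ?case using Cons by simp
qed auto

locale moment_seq =
  fixes N :: nat and m :: "nat \<Rightarrow> nat \<Rightarrow> real"
  assumes m0: "a < N \<Longrightarrow> m a 0 = 1" and m1: "a < N \<Longrightarrow> m a 1 = 0" and m2: "a < N \<Longrightarrow> m a 2 = 1"
begin

lemma ew_single:
  assumes "a < N" "count_list w a = 1"
  shows "ew N m w = 0"
  unfolding ew_def using assms m1[of a] by (intro prod_zero bexI[of _ a]) auto

lemma ew_pairs:
  assumes "\<And>a. a \<in> set w \<Longrightarrow> count_list w a = 2"
  shows "ew N m w = 1"
  unfolding ew_def
proof (rule prod.neutral, intro ballI)
  fix a assume "a \<in> {..<N}"
  then show "m a (count_list w a) = 1"
    using assms[of a] m0 m2 by (cases "a \<in> set w") auto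
qed

lemma ew_append_disjoint:
  assumes "set v \<inter> set w = {}"
  shows "ew N m (v @ w) = ew N m v * ew N m w"
  unfolding ew_def prod.distrib[symmetric]
proof (rule prod.cong)
  fix a assume "a \<in> {..<N}"
  with assms show "m a (count_list (v @ w) a) = m a (count_list v a) * m a (count_list w a)"
    using m0[of a] by (cases "a \<in> set v"; cases "a \<in> set w") (auto simp: disjoint_iff)
qed auto

lemma ew_bound:
  assumes B: "\<And>a k. a < N \<Longrightarrow> k \<le> length w \<Longrightarrow> \<bar>m a k\<bar> \<le> B" and B1: "B \<ge> 1"
  shows "\<bar>ew N m w\<bar> \<le> B ^ length w"
proof -
  have "\<bar>ew N m w\<bar> = (\<Prod>a<N. \<bar>m a (count_list w a)\<bar>)"
    unfolding ew_def by (rule abs_prod)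
  also have "\<dots> = (\<Prod>a\<in>{..<N} \<inter> set w. \<bar>m a (count_list w a)\<bar>)"
    using m0 by (intro prod.mono_neutral_right) auto
  also have "\<dots> \<le> (\<Prod>a\<in>{..<N} \<inter> set w. B)"
    by (intro prod_mono) (auto intro!: B count_le_length)
  also have "\<dots> = B ^ card ({..<N} \<inter> set w)" by simp
  also have "\<dots> \<le> B ^ length w"
    by (intro power_increasing B1 order_trans[OF card_mono[of "set w"] card_length]) auto
  finally show ?thesis .
qed

lemma centred_bound:
  assumes B: "\<And>a k. a < N \<Longrightarrow> k \<le> length (w @ concat zs) \<Longrightarrow> \<bar>m a k\<bar> \<le> B" and B1: "B \<ge> 1"
  shows "\<bar>centred N m w zs\<bar> \<le> 2 ^ length zs * B ^ length (w @ concat zs)"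
  using B
proof (induction zs arbitrary: w)
  case Nil
  then show ?case using ew_bound[of w B] B1 by simp
next
  case (Cons z zs)
  have 1: "\<bar>centred N m (w @ z) zs\<bar> \<le> 2 ^ length zs * B ^ length ((w @ z) @ concat zs)"
    using Cons.prems by (intro Cons.IH) auto
  have "\<bar>ew N m z * centred N m w zs\<bar> \<le> B ^ length z * (2 ^ length zs * B ^ length (w @ concat zs))"
    unfolding abs_mult using Cons.prems B1 by (intro mult_mono ew_bound Cons.IH) auto
  also have "\<dots> = 2 ^ length zs * B ^ length ((w @ z) @ concat zs)" by (simp add: power_add)
  finally show ?case using 1 by auto
qed

text \<open>If z is uncorrelated with all words over S, it factors out of the whole expression: in
  either branch of the recursion it still stands next to a word over S, up to a reordering that
  \<open>centred_mset\<close> permits.\<close>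

lemma centred_eq_0:
  assumes S: "set v \<subseteq> S" "set (concat zs) \<subseteq> S"
    and mult: "\<And>u. set u \<subseteq> S \<Longrightarrow> ew N m (u @ z) = ew N m u * ew N m z"
  shows "centred N m (v @ z) zs = ew N m z * centred N m v zs"
  using S
proof (induction zs arbitrary: v)
  case (Cons y zs)
  have "centred N m ((v @ z) @ y) zs = centred N m ((v @ y) @ z) zs"
    by (rule centred_mset) simp
  then show ?case using Cons.prems Cons.IH[of "v @ y"] Cons.IH[of v] by (simp add: algebra_simps)
qed (use mult in \<open>simp add: mult.commute\<close>)

lemma centred_front_eq_0:
  assumes "\<And>u. set u \<subseteq> set (concat zs) \<Longrightarrow> ew N m (u @ z) = ew N m u * ew N m z"
  shows "centred N m [] (z # zs) = 0"
  using centred_eq_0[of "[]" "set (concat zs)" zs z] assms by simp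

end

definition wprod :: "(nat \<Rightarrow> 'w \<Rightarrow> real) \<Rightarrow> nat list \<Rightarrow> 'w \<Rightarrow> real" where
  "wprod y w \<omega> = prod_list (map (\<lambda>a. y a \<omega>) w)"

lemma wprod_append: "wprod y (v @ w) \<omega> = wprod y v \<omega> * wprod y w \<omega>"
  by (simp add: wprod_def)

locale moment_model = prob_space +
  fixes N :: nat and y :: "nat \<Rightarrow> 'a \<Rightarrow> real"
  assumes indep: "indep_vars (\<lambda>_. borel) y {..<N}"
    and int_pow: "\<And>a k. a < N \<Longrightarrow> integrable M (\<lambda>\<omega>. y a \<omega> ^ k)"
    and mean: "\<And>a. a < N \<Longrightarrow> expectation (y a) = 0"
    and second: "\<And>a. a < N \<Longrightarrow> expectation (\<lambda>\<omega>. y a \<omega> ^ 2) = 1"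
begin

definition mom :: "nat \<Rightarrow> nat \<Rightarrow> real" where
  "mom a k = expectation (\<lambda>\<omega>. y a \<omega> ^ k)"

sublocale moment_seq N mom
proof unfold_locales
  fix a assume a: "a < N"
  show "mom a 0 = 1" unfolding mom_def by (simp add: prob_space)
  show "mom a 1 = 0" unfolding mom_def using mean[OF a] by simp
  show "mom a 2 = 1" unfolding mom_def using second[OF a] by simp
qed

lemma wprod_expectation:
  assumes "set w \<subseteq> {..<N}"
  shows "integrable M (wprod y w)" "expectation (wprod y w) = ew N mom w"
proof -
  have eq: "wprod y w = (\<lambda>\<omega>. \<Prod>a<N. y a \<omega> ^ count_list w a)"
    by (rule ext) (simp add: wprod_def prod_list_eq_prod_count[OF finite_lessThan assms])
  have "indep_vars (\<lambda>_. borel) (\<lambda>a \<omega>. (\<lambda>x. x ^ count_list w a) (y a \<omega>)) {..<N}"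
    by (rule indep_vars_compose2[OF indep]) auto
  then have i: "indep_vars (\<lambda>_. borel) (\<lambda>a \<omega>. y a \<omega> ^ count_list w a) {..<N}" by simp
  show "integrable M (wprod y w)"
    unfolding eq using i int_pow by (intro indep_vars_integrable) simp_all
  show "expectation (wprod y w) = ew N mom w"
    unfolding eq ew_def mom_def using i int_pow by (subst indep_vars_lebesgue_integral) simp_all
qed

lemma centred_expectation:
  assumes "set w \<subseteq> {..<N}" "\<And>z. z \<in> set zs \<Longrightarrow> set z \<subseteq> {..<N}"
  shows "integrable M (\<lambda>\<omega>. wprod y w \<omega> * (\<Prod>z\<leftarrow>zs. wprod y z \<omega> - ew N mom z))"
    "expectation (\<lambda>\<omega>. wprod y w \<omega> * (\<Prod>z\<leftarrow>zs. wprod y z \<omega> - ew N mom z)) = centred N mom w zs"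
  using assms
proof (induction zs arbitrary: w)
  case Nil
  { case 1 then show ?case using wprod_expectation[of w] by simp }
  { case 2 then show ?case using wprod_expectation[of w] by simp }
next
  case (Cons z zs)
  have eq: "wprod y w \<omega> * (\<Prod>z\<leftarrow>z # zs. wprod y z \<omega> - ew N mom z) =
    wprod y (w @ z) \<omega> * (\<Prod>z\<leftarrow>zs. wprod y z \<omega> - ew N mom z)
        - ew N mom z * (wprod y w \<omega> * (\<Prod>z\<leftarrow>zs. wprod y z \<omega> - ew N mom z))" for w \<omega>
    by (simp add: wprod_append algebra_simps)
  { case 1 then show ?case unfolding eq by (intro Bochner_Integration.integrable_diff integrable_mult_right Cons.IH) auto }
  { case 2
    have "integrable M (\<lambda>\<omega>. wprod y (w @ z) \<omega> * (\<Prod>z\<leftarrow>zs. wprod y z \<omega> - ew N mom z))"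
      "integrable M (\<lambda>\<omega>. wprod y w \<omega> * (\<Prod>z\<leftarrow>zs. wprod y z \<omega> - ew N mom z))"
      by (rule Cons.IH(1); use 2 in simp)+
    with 2 show ?case unfolding eq by (simp add: Cons.IH) }
qed

text \<open>The recursion works through the list from the front and does not display this symmetry;
  it appears once both sides are read as expectations of the same product.\<close>

lemma centred_permute:
  assumes "mset zs = mset zs'" "\<And>z. z \<in> set zs \<Longrightarrow> set z \<subseteq> {..<N}"
  shows "centred N mom [] zs = centred N mom [] zs'"
proof -
  have *: "(\<Prod>z\<leftarrow>zs. wprod y z \<omega> - ew N mom z) = (\<Prod>z\<leftarrow>zs'. wprod y z \<omega> - ew N mom z)" for \<omega>
    by (simp only: prod_mset_prod_list[symmetric] mset_map assms(1))
  have "set zs' = set zs" using assms(1) by (metis set_mset_mset)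
  then show ?thesis
    using centred_expectation(2)[of "[]" zs] centred_expectation(2)[of "[]" zs'] assms(2)
    by (auto simp: *)
qed

text \<open>A block uncorrelated with all words in the other blocks contributes the mean of a
  centred variable, which is 0. This happens if the block shares no letter with the others, by
  independence, and if it holds a letter that occurs only once overall, since every letter has mean
  0.\<close>

lemma centred_nonzero:
  assumes nz: "centred N mom [] zs \<noteq> 0" and sub: "\<And>z. z \<in> set zs \<Longrightarrow> set z \<subseteq> {..<N}"
  shows "count_list (concat zs) a \<noteq> 1"
    and "i < length zs \<Longrightarrow> \<exists>j<length zs. j \<noteq> i \<and> set (zs ! i) \<inter> set (zs ! j) \<noteq> {}"
proof -
  \<comment> \<open>By symmetry any block may be moved to the front, where the two terms of the
    recursion cancel.\<close>
  have split: "\<exists>u. set u \<subseteq> set (concat (pre @ post)) \<and> ew N mom (u @ z) \<noteq> ew N mom u * ew N mom z"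
    if zs: "zs = pre @ z # post" for pre z post
  proof (rule ccontr)
    assume "\<not> ?thesis"
    then have "centred N mom [] (z # (pre @ post)) = 0"
      by (intro centred_front_eq_0) auto
    moreover have "centred N mom [] (z # (pre @ post)) = centred N mom [] zs"
      using sub zs by (intro centred_permute) auto
    ultimately show False using nz by simp
  qed
  show "count_list (concat zs) a \<noteq> 1"
  proof
    assume one: "count_list (concat zs) a = 1"
    then have "a \<in> set (concat zs)" by (metis count_list_0_iff zero_neq_one)
    then obtain z where z: "z \<in> set zs" "a \<in> set z" by auto
    then obtain pre post where zs: "zs = pre @ z # post" by (meson split_list)
    have "count_list z a \<noteq> 0" using z(2) by (simp add: count_list_0_iff)
    with one zs have cz: "count_list z a = 1" and "count_list (concat (pre @ post)) a = 0" by auto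
    then have na: "a \<notin> set (concat (pre @ post))" by (metis count_list_0_iff)
    obtain u where u: "set u \<subseteq> set (concat (pre @ post))" "ew N mom (u @ z) \<noteq> ew N mom u * ew N mom z"
      using split[OF zs] by blast
    have a: "a < N" using z sub by auto
    have "a \<notin> set u" using u(1) na by blast
    then have c: "count_list (u @ z) a = 1" using cz by simp
    show False using u(2) ew_single[OF a c] ew_single[OF a cz] by simp
  qed
  assume i: "i < length zs"
  show "\<exists>j<length zs. j \<noteq> i \<and> set (zs ! i) \<inter> set (zs ! j) \<noteq> {}"
  proof (rule ccontr)
    assume no: "\<not> ?thesis"
    let ?pre = "take i zs" and ?post = "drop (Suc i) zs"
    have zs: "zs = ?pre @ (zs ! i) # ?post" using i by (simp add: id_take_nth_drop)
    obtain u where u: "set u \<subseteq> set (concat (?pre @ ?post))" "ew N mom (u @ zs ! i) \<noteq> ew N mom u * ew N mom (zs ! i)"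
      using split[OF zs] by blast
    have "set (zs ! i) \<inter> set x = {}" if "x \<in> set (?pre @ ?post)" for x
    proof -
      from that consider k where "k < i" "x = zs ! k" | k where "i + Suc k < length zs" "x = zs ! (i + Suc k)"
        using i by (auto simp: in_set_conv_nth less_diff_conv add.commute)
      then have "\<exists>j<length zs. j \<noteq> i \<and> x = zs ! j"
      proof cases
        case (1 k) then show ?thesis using i by (intro exI[of _ k]) auto
      next
        case (2 k) then show ?thesis by (intro exI[of _ "i + Suc k"]) auto
      qed
      with no show ?thesis by auto
    qed
    then have "set u \<inter> set (zs ! i) = {}" using u(1) unfolding set_concat by blast
    with u(2) show False by (simp add: ew_append_disjoint)
  qed
qed

end

section \<open>Words and closed walks\<close>

definition words :: "nat \<Rightarrow> nat \<Rightarrow> nat list set" where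
  "words N p = {ls. set ls \<subseteq> {..<N} \<and> length ls = p}"

lemma finite_words [simp]: "finite (words N p)"
  unfolding words_def by (rule finite_lists_length_eq) simp

lemma card_words: "card (words N p) = N ^ p"
  unfolding words_def by (simp add: card_lists_length_eq)

lemma words_0 [simp]: "words N 0 = {[]}"
  by (auto simp: words_def)

lemma words_Suc: "words N (Suc p) = (\<lambda>(l, ls). l # ls) ` ({..<N} \<times> words N p)"
  by (auto simp: words_def length_Suc_conv image_iff)

lemma sum_words_Suc:
  "(\<Sum>w\<in>words N (Suc p). f w) = (\<Sum>l<N. \<Sum>ls\<in>words N p. (f (l # ls) :: 'b :: comm_monoid_add))"
  unfolding words_Suc
  by (subst sum.reindex) (auto simp: inj_on_def sum.cartesian_product case_prod_beta)

text \<open>For \<open>a < N\<close> this is the b below N with a + b congruent to l modulo N: in a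
  matrix whose entries depend on i + j, the next vertex along an edge labelled l. Writing
  \<open>N - a\<close> avoids truncated subtraction.\<close>

definition stp :: "nat \<Rightarrow> nat \<Rightarrow> nat \<Rightarrow> nat" where
  "stp N a l = (l + (N - a)) mod N"

primrec fin :: "nat \<Rightarrow> nat \<Rightarrow> nat list \<Rightarrow> nat" where
  "fin N a [] = a"
| "fin N a (l # ls) = fin N (stp N a l) ls"

primrec wt :: "(real \<Rightarrow> real \<Rightarrow> complex) \<Rightarrow> nat \<Rightarrow> nat \<Rightarrow> nat list \<Rightarrow> complex" where
  "wt \<phi> N a [] = 1"
| "wt \<phi> N a (l # ls) = \<phi> (real a / real N) (real (stp N a l) / real N) * wt \<phi> N (stp N a l) ls"

text \<open>The end point of the walk before reduction modulo N. It is polymorphic because it is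
  used over the integers for divisibility and over the reals for the rescaled walk.\<close>

primrec rpos :: "'a :: ab_group_add \<Rightarrow> 'a list \<Rightarrow> 'a" where
  "rpos a [] = a"
| "rpos a (l # ls) = rpos (l - a) ls"

lemma stp_less [simp]: "a < N \<Longrightarrow> stp N a l < N"
  by (simp add: stp_def)

lemma int_stp: "a < N \<Longrightarrow> int (stp N a l) = (int l - int a) mod int N"
proof -
  assume "a < N"
  then have "int (stp N a l) = ((int l - int a) + int N) mod int N"
    unfolding stp_def by (simp add: zmod_int of_nat_diff algebra_simps)
  then show ?thesis by (simp only: mod_add_self2)
qed

lemma fin_less [simp]: "a < N \<Longrightarrow> fin N a ls < N"
  by (induction ls arbitrary: a) auto

text \<open>Each step is a reflection, which reverses the sign of everything before it.\<close>

lemma rpos_start: "rpos a ls = rpos 0 ls + (-1) ^ length ls * (a :: 'a :: comm_ring_1)"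
proof (induction ls arbitrary: a)
  case (Cons l ls)
  show ?case
    using Cons[of "l - a"] Cons[of l] by (simp add: algebra_simps)
qed auto

lemma rpos_cong: "[a = b] (mod m) \<Longrightarrow> [rpos a ls = rpos b ls] (mod (m :: int))"
proof (induction ls arbitrary: a b)
  case (Cons l ls)
  show ?case using Cons.IH[OF cong_diff[OF cong_refl[of l] Cons.prems]] by simp
qed auto

lemma fin_cong: "a < N \<Longrightarrow> [int (fin N a ls) = rpos (int a) (map int ls)] (mod int N)"
proof (induction ls arbitrary: a)
  case (Cons l ls)
  have "[int (fin N (stp N a l) ls) = rpos (int (stp N a l)) (map int ls)] (mod int N)"
    using Cons.prems by (intro Cons.IH) simp
  also have "[rpos (int (stp N a l)) (map int ls) = rpos (int l - int a) (map int ls)] (mod int N)"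
    using Cons.prems by (intro rpos_cong) (simp add: int_stp)
  finally show ?case by simp
qed auto

lemma fin_eq_iff:
  assumes "a < N"
  shows "fin N a ls = a \<longleftrightarrow> int N dvd rpos (int a) (map int ls) - int a"
proof -
  have "fin N a ls = a \<longleftrightarrow> [int (fin N a ls) = int a] (mod int N)"
    using assms by (auto simp: cong_def)
  also have "\<dots> \<longleftrightarrow> [rpos (int a) (map int ls) = int a] (mod int N)"
    using fin_cong[OF assms, of ls] by (meson cong_sym cong_trans)
  finally show ?thesis by (simp add: cong_iff_dvd_diff)
qed

lemma fin_even_iff:
  assumes "a < N" "even (length ls)"
  shows "fin N a ls = a \<longleftrightarrow> int N dvd rpos 0 (map int ls)"
  using assms rpos_start[of "int a" "map int ls"] by (simp add: fin_eq_iff)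

text \<open>In odd length the start enters the end point with a minus sign, so closing up prescribes
  the residue of \<open>2 * a\<close> modulo N.\<close>

lemma card_fin_odd:
  assumes "odd (length ls)"
  shows "card {a. a < N \<and> fin N a ls = a} \<le> 2"
proof -
  let ?S = "{a. a < N \<and> fin N a ls = a}"
  \<comment> \<open>Two solutions in the same half of \<open>{..<N}\<close> coincide, since their
    doubles differ by less than N.\<close>
  have "inj_on (\<lambda>a. 2 * a < N) ?S"
  proof (rule inj_onI)
    fix a b assume ab: "a \<in> ?S" "b \<in> ?S" "(2 * a < N) = (2 * b < N)"
    have "int N dvd rpos 0 (map int ls) - 2 * int c" if "c \<in> ?S" for c
    proof -
      have "rpos (int c) (map int ls) - int c = rpos 0 (map int ls) - 2 * int c"
        using assms rpos_start[of "int c" "map int ls"] by simp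
      moreover have "int N dvd rpos (int c) (map int ls) - int c"
        using that fin_eq_iff[of c N ls] by auto
      ultimately show ?thesis by (simp only:)
    qed
    from dvd_diff[OF this[OF ab(2)] this[OF ab(1)]] have "int N dvd 2 * int a - 2 * int b"
      by (simp add: algebra_simps)
    then have d: "int N dvd 2 * \<bar>int a - int b\<bar>" by (auto simp: abs_if algebra_simps dest: dvd_minus_iff[THEN iffD2])
    have "a < N" "b < N" "2 * a < N \<longleftrightarrow> 2 * b < N" using ab by auto
    then have "2 * \<bar>int a - int b\<bar> < int N" by arith
    with d have "2 * \<bar>int a - int b\<bar> = 0" 
      using zdvd_imp_le[of "int N" "2 * \<bar>int a - int b\<bar>"] by fastforce
    then show "a = b" by simp
  qed
  then have "card ?S = card ((\<lambda>a. 2 * a < N) ` ?S)" by (simp add: card_image)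
  also have "\<dots> \<le> card (UNIV :: bool set)" by (rule card_mono) auto
  finally show ?thesis by simp
qed

lemma wt_le_1:
  assumes "\<And>x y. cmod (\<phi> x y) \<le> 1"
  shows "cmod (wt \<phi> N a ls) \<le> 1"
  using assms by (induction ls arbitrary: a) (auto simp: norm_mult intro!: mult_le_one)

text \<open>The letter enters the end point once, with a sign given by the parity of the number of
  letters after it; the start and all other letters cancel in the difference.\<close>

lemma rpos_single:
  assumes "count_list ks i = 1" "\<And>j. j \<in> set ks \<Longrightarrow> j \<noteq> i \<Longrightarrow> v j = v' j"
  shows "\<exists>s\<in>{1, -1}. rpos a (map v ks) - rpos a (map v' ks) = s * (v i - v' i :: int)"
  using assms
proof (induction ks arbitrary: a)
  case (Cons k ks)
  show ?case
  proof (cases "k = i")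
    case True
    with Cons.prems have "i \<notin> set ks" by (auto simp: count_list_0_iff)
    with Cons.prems True have eq: "map v' ks = map v ks"
      by (intro map_cong refl) (metis list.set_intros(2))
    have "rpos (v i - a) (map v ks) - rpos (v' i - a) (map v ks) = (-1) ^ length ks * (v i - v' i)"
      using rpos_start[of "v i - a" "map v ks"] rpos_start[of "v' i - a" "map v ks"] by (simp add: algebra_simps)
    moreover have "(-1) ^ length ks \<in> {1, -1 :: int}" by (cases "even (length ks)") auto
    ultimately show ?thesis unfolding list.map rpos.simps eq True by blast
  next
    case False
    then have "v k = v' k" using Cons.prems by auto
    with Cons.IH[of "v k - a"] Cons.prems False show ?thesis by auto
  qed
qed auto

text \<open>The closure condition is a congruence in which such a letter has coefficient 1 or -1, so
  it is determined by the remaining letters.\<close>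

lemma solve_single:
  assumes "count_list ks i = 1" "\<And>j. j \<in> set ks \<Longrightarrow> j \<noteq> i \<Longrightarrow> v j = v' j"
    and "int N dvd rpos 0 (map int (map v ks))" "int N dvd rpos 0 (map int (map v' ks))"
    and "v i < N" "v' i < N"
  shows "v i = v' i"
proof -
  have "\<exists>s\<in>{1, -1}. rpos 0 (map (int \<circ> v) ks) - rpos 0 (map (int \<circ> v') ks)
      = s * ((int \<circ> v) i - (int \<circ> v') i)"
    using assms(1,2) by (intro rpos_single) auto
  then obtain s :: int where s: "s \<in> {1, -1}"
    "rpos 0 (map (int \<circ> v) ks) - rpos 0 (map (int \<circ> v') ks) = s * (int (v i) - int (v' i))"
    unfolding comp_def by blast
  have "int N dvd s * (int (v i) - int (v' i))"
    unfolding s(2)[symmetric] using assms(3,4) by (intro dvd_diff) auto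
  then have "[int (v i) = int (v' i)] (mod int N)"
    using s(1) by (auto simp: cong_iff_dvd_diff dvd_diff_commute)
  then show ?thesis using assms(5,6) by (simp add: cong_def)
qed

section \<open>Counting words by their number of distinct letters\<close>

lemma map_enum:
  assumes "card (set w) \<le> b" "set w \<subseteq> {..<N}" "N > 0"
  obtains v ks where "v \<in> {..<b} \<rightarrow>\<^sub>E {..<N}" "set ks \<subseteq> {..<b}" "length ks = length w" "w = map v ks"
proof -
  obtain h where h: "bij_betw h {0..<card (set w)} (set w)"
    using ex_bij_betw_nat_finite[of "set w"] by auto
  have hN: "h x < N" if "x < card (set w)" for x
    using that h assms(2) by (auto simp: bij_betw_def)
  \<comment> \<open>Symbols beyond the number of letters get the dummy letter 0, which lies below N
    because N is positive.\<close>
  define v where "v = (\<lambda>i\<in>{..<b}. if i < card (set w) then h i else 0)"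
  define ks where "ks = map (inv_into {0..<card (set w)} h) w"
  have inv: "inv_into {0..<card (set w)} h x \<in> {0..<card (set w)}" "h (inv_into {0..<card (set w)} h x) = x" if "x \<in> set w" for x
    using that h inv_into_into[of x h "{0..<card (set w)}"] f_inv_into_f[of x h "{0..<card (set w)}"]
    by (simp_all add: bij_betw_def)
  show ?thesis
  proof (rule that[of v ks])
    show "v \<in> {..<b} \<rightarrow>\<^sub>E {..<N}"
      using hN assms(3) by (auto simp: v_def)
    show "set ks \<subseteq> {..<b}" using inv assms(1) by (fastforce simp: ks_def)
    show "length ks = length w" by (simp add: ks_def)
    show "w = map v ks"
      unfolding ks_def map_map by (rule map_idI[symmetric]) (use inv assms(1) in \<open>force simp: v_def\<close>)
  qed
qed

text \<open>A word is one of \<open>b ^ p\<close> patterns over b symbols together with an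
  assignment of letters to the symbols; only the number of assignments grows with N.\<close>

lemma card_few_letters:
  assumes "N > 0"
  shows "card {w \<in> words N p. card (set w) \<le> b} \<le> b ^ p * N ^ b"
proof -
  let ?P = "({..<b} \<rightarrow>\<^sub>E {..<N}) \<times> words b p"
  have "{w \<in> words N p. card (set w) \<le> b} \<subseteq> (\<lambda>(v, ks). map v ks) ` ?P"
  proof
    fix w assume "w \<in> {w \<in> words N p. card (set w) \<le> b}"
    then have w: "card (set w) \<le> b" "set w \<subseteq> {..<N}" "length w = p" by (auto simp: words_def)
    obtain v ks where "v \<in> {..<b} \<rightarrow>\<^sub>E {..<N}" "set ks \<subseteq> {..<b}" "length ks = length w" "w = map v ks"
      using map_enum[OF w(1,2) assms] by blast
    then show "w \<in> (\<lambda>(v, ks). map v ks) ` ?P"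
      using w(3) by (intro image_eqI[of _ _ "(v, ks)"]) (auto simp: words_def)
  qed
  then have "card {w \<in> words N p. card (set w) \<le> b} \<le> card ((\<lambda>(v, ks). map v ks) ` ?P)"
    by (intro card_mono) (auto simp: finite_PiE)
  also have "\<dots> \<le> card ?P" by (intro card_image_le) (auto simp: finite_PiE)
  also have "\<dots> = b ^ p * N ^ b" by (simp add: card_cartesian_product card_words card_PiE)
  finally show ?thesis .
qed

lemma length_eq_sum_count: "set w \<subseteq> A \<Longrightarrow> finite A \<Longrightarrow> length w = (\<Sum>a\<in>A. count_list w a)"
proof (induction w)
  case (Cons x w)
  have "(\<Sum>a\<in>A. count_list (x # w) a) = (\<Sum>a\<in>A. (if a = x then 1 else 0) + count_list w a)"
    by (intro sum.cong) auto
  also have "\<dots> = Suc (\<Sum>a\<in>A. count_list w a)"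
    using Cons.prems by (simp add: sum.distrib)
  finally show ?case using Cons by simp
qed auto

lemma card_set_le_half:
  assumes "\<And>a. count_list w a \<noteq> 1"
  shows "2 * card (set w) \<le> length w"
proof -
  have "2 * card (set w) = (\<Sum>a\<in>set w. 2)" by simp
  also have "\<dots> \<le> (\<Sum>a\<in>set w. count_list w a)"
  proof (rule sum_mono)
    fix a assume "a \<in> set w"
    then have "count_list w a \<noteq> 0" by (simp add: count_list_0_iff)
    with assms[of a] show "2 \<le> count_list w a" by linarith
  qed
  finally show ?thesis using length_eq_sum_count[of w "set w"] by simp
qed


text \<open>For four words of length \<open>p\<close> in \<open>b\<close> letters, each letter occurring at least twice and each word
  sharing a letter with another one, either \<open>b \<le> 2p - 2\<close> or the closure conditions of the words
  determine enough letters: a letter occurring exactly once in a word is determined by the others.\<close>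

definition good_quad :: "nat \<Rightarrow> nat list list \<Rightarrow> bool" where
  "good_quad p zs \<longleftrightarrow> length zs = 4 \<and> (\<forall>z\<in>set zs. length z = p) \<and> (\<forall>a. count_list (concat zs) a \<noteq> 1) \<and>
     (\<forall>i<4. \<exists>j<4. j \<noteq> i \<and> set (zs ! i) \<inter> set (zs ! j) \<noteq> {})"

text \<open>In the last case the letters are recovered one after the other: \<open>i'\<close> from
  the word c', which does not contain i, and then i from the word c.\<close>

definition determined :: "nat list list \<Rightarrow> nat set \<Rightarrow> bool" where
  "determined zs D \<longleftrightarrow> D = {} \<or>
     (\<exists>c<4. \<exists>i. D = {i} \<and> count_list (zs ! c) i = 1) \<or>
     (\<exists>c<4. \<exists>c'<4. \<exists>i i'. i \<noteq> i' \<and> D = {i, i'} \<and> count_list (zs ! c) i = 1 \<and>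
        count_list (zs ! c') i' = 1 \<and> i \<notin> set (zs ! c'))"

lemma ex_third_index: "\<exists>k<4. k \<noteq> i \<and> k \<noteq> (j :: nat)"
proof -
  have "\<exists>k\<in>{0, 1, 2 :: nat}. k \<noteq> i \<and> k \<noteq> j" by auto
  then obtain k where "k \<in> {0, 1, 2 :: nat}" "k \<noteq> i" "k \<noteq> j" by blast
  then show ?thesis by (intro exI[of _ k]) auto
qed

text \<open>Every letter occurs at least twice among \<open>4 * p\<close> positions, so
  \<open>b \<le> 2 * p\<close>. Only b = 2p and b = 2p - 1 exceed the target, and they leave so few
  surplus occurrences that two letters, respectively one letter, must be determined.\<close>

lemma good_quad_determined:
  assumes g: "good_quad p zs" and b: "card (set (concat zs)) = b"
  shows "\<exists>D. D \<subseteq> set (concat zs) \<and> determined zs D \<and> b - card D \<le> 2 * p - 2"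
proof -
  define S where "S = set (concat zs)"
  define n where "n = count_list (concat zs)"
  define m where "m c i = count_list (zs ! c) i" for c i
  have [simp]: "finite S" by (simp add: S_def)
  have len: "length zs = 4" using g by (simp add: good_quad_def)
  then obtain z0 z1 z2 z3 where zs: "zs = [z0, z1, z2, z3]"
    by (auto simp: numeral_eq_Suc length_Suc_conv)
  have n: "n i = m 0 i + m 1 i + m 2 i + m 3 i" for i
    by (simp add: n_def m_def zs numeral_eq_Suc)
  have two: "n i \<ge> m c i + m c' i" if "c < 4" "c' < 4" "c \<noteq> c'" for i c c'
    using that unfolding n by (auto simp: numeral_eq_Suc less_Suc_eq)
  have three: "n i \<ge> m c i + m c' i + m c'' i"
    if "c < 4" "c' < 4" "c'' < 4" "c \<noteq> c'" "c'' \<noteq> c" "c'' \<noteq> c'" for i c c' c''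
    using that unfolding n by (auto simp: numeral_eq_Suc less_Suc_eq)
  have n2: "n i \<ge> 2" if "i \<in> S" for i
  proof -
    have "n i \<noteq> 0" using that by (simp add: n_def S_def count_list_0_iff)
    moreover have "n i \<noteq> 1" using g by (simp add: n_def good_quad_def)
    ultimately show ?thesis by linarith
  qed
  have lens: "length (concat zs) = 4 * p" using g by (simp add: good_quad_def zs)
  then have sumn: "(\<Sum>i\<in>S. n i) = 4 * p"
    using length_eq_sum_count[of "concat zs" S] by (simp add: n_def S_def)
  have cardS: "card S = b" using b by (simp add: S_def)
  \<comment> \<open>\<open>n i - 2\<close> is the surplus of a letter beyond its two obligatory
    occurrences; the total surplus is \<open>4 * p - 2 * b\<close>.\<close>
  have "(\<Sum>i\<in>S. n i) = (\<Sum>i\<in>S. (n i - 2) + 2)" by (rule sum.cong[OF refl], drule n2) simp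
  also have "\<dots> = (\<Sum>i\<in>S. n i - 2) + card S * 2" by (simp only: sum.distrib sum_constant of_nat_id)
  finally have exc: "(\<Sum>i\<in>S. n i - 2) + 2 * b = 4 * p" using sumn cardS by linarith
  have cross: "\<exists>j<4. j \<noteq> c \<and> (\<exists>i\<in>S. m c i \<ge> 1 \<and> m j i \<ge> 1)" if c: "c < 4" for c
  proof -
    obtain j i where j: "j < 4" "j \<noteq> c" "i \<in> set (zs ! c)" "i \<in> set (zs ! j)"
      using g c unfolding good_quad_def by blast
    then have "m c i \<noteq> 0" "m j i \<noteq> 0" by (simp_all add: m_def count_list_0_iff)
    moreover have "i \<in> S" unfolding S_def using j c len by (auto intro!: bexI[of _ "zs ! c"])
    ultimately show ?thesis using j by (intro exI[of _ j]) (auto intro!: bexI[of _ i])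
  qed
  consider "b \<le> 2 * p - 2" | "b = 2 * p" "p > 0" | "b = 2 * p - 1" "p > 0" using exc by linarith
  then show ?thesis
  proof cases
    case 1
    then show ?thesis by (intro exI[of _ "{}"]) (auto simp: determined_def)
  next
    case 2
    then have "(\<Sum>i\<in>S. n i - 2) = 0" using exc by simp
    then have n_eq: "n i = 2" if "i \<in> S" for i using that n2[OF that] by (simp add: sum_eq_0_iff, intro antisym) auto
    obtain j i where j: "j < 4" "j \<noteq> 0" "i \<in> S" "m 0 i \<ge> 1" "m j i \<ge> 1"
      using cross[of 0] by auto
    \<comment> \<open>Both occurrences of i are used up by the words 0 and j, so a third word k
      avoids i. The letter \<open>i'\<close> that k shares with another word then differs from i and
      occurs once in k.\<close>
    obtain k where k: "k < 4" "k \<noteq> 0" "k \<noteq> j" using ex_third_index by blast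
    obtain j' i' where j': "j' < 4" "j' \<noteq> k" "i' \<in> S" "m k i' \<ge> 1" "m j' i' \<ge> 1"
      using cross[OF k(1)] by auto
    have "m 0 i = 1" "m k i = 0" using three[of 0 j k i] n_eq[OF j(3)] j k by auto
    moreover have "m k i' = 1" using two[of k j' i'] n_eq[OF j'(3)] j' k by auto
    ultimately have c: "count_list (zs ! 0) i = 1" "count_list (zs ! k) i' = 1" "i \<notin> set (zs ! k)"
      by (simp_all add: m_def count_list_0_iff)
    then have ne: "i \<noteq> i'" by (metis count_list_0_iff zero_neq_one)
    have "(0::nat) < 4" by simp
    then have "determined zs {i, i'}" unfolding determined_def using k(1) c ne by blast
    moreover have "card {i, i'} = 2" using ne by simp
    ultimately show ?thesis using j(3) j'(3) 2 by (intro exI[of _ "{i, i'}"]) (auto simp: S_def)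
  next
    case 3
    \<comment> \<open>Otherwise a shared letter occurs at least twice in each of two words and has
      surplus at least 2. A word k outside the first such pair forces a second letter of this kind
      or six occurrences of the first one; either exceeds the total surplus 2.\<close>
    have "\<exists>c<4. \<exists>i\<in>S. m c i = 1"
    proof (rule ccontr)
      assume "\<not> ?thesis"
      then have no: "m c i \<noteq> 1" if "c < 4" "i \<in> S" for c i using that by auto
      have cross2: "\<exists>j<4. j \<noteq> c \<and> (\<exists>i\<in>S. m c i \<ge> 2 \<and> m j i \<ge> 2)" if c: "c < 4" for c
      proof -
        obtain j i where "j < 4" "j \<noteq> c" "i \<in> S" "m c i \<ge> 1" "m j i \<ge> 1" using cross[OF c] by auto
        with no[of c i] no[of j i] c show ?thesis by (intro exI[of _ j]) (auto intro!: bexI[of _ i])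
      qed
      have sum2: "(\<Sum>i\<in>S. n i - 2) = 2" using exc 3 by linarith
      have le2: "n i - 2 \<le> 2" if "i \<in> S" for i
        using member_le_sum[of i S "\<lambda>i. n i - 2"] that sum2 by simp
      obtain j i where j: "j < 4" "j \<noteq> 0" "i \<in> S" "m 0 i \<ge> 2" "m j i \<ge> 2"
        using cross2[of 0] by auto
      obtain k where k: "k < 4" "k \<noteq> 0" "k \<noteq> j" using ex_third_index by blast
      obtain j' i' where j': "j' < 4" "j' \<noteq> k" "i' \<in> S" "m k i' \<ge> 2" "m j' i' \<ge> 2"
        using cross2[OF k(1)] by auto
      have ni: "n i \<ge> 4" using two[of 0 j i] j by auto
      have ni': "n i' \<ge> 4" using two[of k j' i'] j' k by auto
      show False
      proof (cases "i = i'")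
        case True
        then have "n i \<ge> 6" using three[of 0 j k i] j j' k by auto
        with le2[OF j(3)] show False by linarith
      next
        case False
        have "(\<Sum>x\<in>{i, i'}. n x - 2) \<le> (\<Sum>i\<in>S. n i - 2)"
          using j j' by (intro sum_mono2) auto
        with False ni ni' sum2 show False by simp
      qed
    qed
    then obtain c i where "c < 4" "i \<in> S" "m c i = 1" by auto
    then show ?thesis using 3
      by (intro exI[of _ "{i}"]) (auto simp: determined_def S_def m_def)
  qed
qed

lemma count_list_map_inj: "inj_on v A \<Longrightarrow> set ks \<subseteq> A \<Longrightarrow> i \<in> A \<Longrightarrow> count_list (map v ks) (v i) = count_list ks i"
  by (induction ks) (auto simp: inj_on_def)

text \<open>Restricting a solution to the letters outside D loses nothing, as the letters in D are
  recovered from the closure conditions.\<close>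

lemma card_determined_le:
  assumes N: "N > 0" and len: "length kss = 4" and sub: "set (concat kss) \<subseteq> {..<b}"
    and D: "D \<subseteq> {..<b}" "determined kss D"
  shows "card {v \<in> {..<b} \<rightarrow>\<^sub>E {..<N}. \<forall>ks\<in>set kss. int N dvd rpos 0 (map int (map v ks))} \<le> N ^ (b - card D)"
    (is "card ?V \<le> _")
proof -
  let ?R = "({..<b} - D) \<rightarrow>\<^sub>E {..<N}"
  have solve: "v i = v' i"
    if v: "v \<in> ?V" "v' \<in> ?V" and c: "c < 4" "count_list (kss ! c) i = 1"
      and eq: "\<And>j. j \<in> set (kss ! c) \<Longrightarrow> j \<noteq> i \<Longrightarrow> v j = v' j" for v v' c i
  proof (rule solve_single[OF c(2) eq])
    have "i \<in> set (kss ! c)" using c by (metis count_list_0_iff zero_neq_one)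
    then have "i < b" using sub c len by fastforce
    then show "v i < N" "v' i < N" using v by (auto simp: PiE_iff)
    show "int N dvd rpos 0 (map int (map v (kss ! c)))" "int N dvd rpos 0 (map int (map v' (kss ! c)))"
      using v c len by auto
  qed
  have in_b: "j < b" if "c < 4" "j \<in> set (kss ! c)" for c j
    using that sub len by fastforce
  have "inj_on (\<lambda>v. restrict v ({..<b} - D)) ?V"
  proof (rule inj_onI)
    fix v v' assume v: "v \<in> ?V" "v' \<in> ?V" and r: "restrict v ({..<b} - D) = restrict v' ({..<b} - D)"
    have off: "v j = v' j" if "j < b" "j \<notin> D" for j
      using fun_cong[OF r, of j] that by auto
    have onD: "v j = v' j" if "j \<in> D" for j
    proof -
      from D(2) consider "D = {}"
        | c i where "c < 4" "D = {i}" "count_list (kss ! c) i = 1"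
        | c c' i i' where "c < 4" "c' < 4" "i \<noteq> i'" "D = {i, i'}" "count_list (kss ! c) i = 1"
            "count_list (kss ! c') i' = 1" "i \<notin> set (kss ! c')"
        unfolding determined_def by blast
      then show ?thesis
      proof cases
        case 2
        have "v i = v' i" by (rule solve[OF v 2(1,3)]) (use off in_b 2 in auto)
        then show ?thesis using that 2 by simp
      next
        case 3
        have i': "v i' = v' i'" by (rule solve[OF v 3(2,6)]) (use off in_b 3 in auto)
        have "v i = v' i" by (rule solve[OF v 3(1,5)]) (use off in_b 3 i' in auto)
        then show ?thesis using that i' 3 by auto
      qed (use that in auto)
    qed
    show "v = v'"
    proof
      fix j show "v j = v' j"
        using off[of j] onD[of j] v by (cases "j < b") (auto simp: PiE_iff extensional_def)
    qed
  qed
  then have "card ?V = card ((\<lambda>v. restrict v ({..<b} - D)) ` ?V)" by (simp add: card_image)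
  also have "\<dots> \<le> card ?R" 
    by (intro card_mono image_subsetI) (auto simp: finite_PiE)
  also have "\<dots> = N ^ (b - card D)" using D by (simp add: card_PiE card_Diff_subset finite_subset)
  finally show ?thesis .
qed

text \<open>A quadruple is a pattern together with an injective assignment of letters. The number of
  patterns does not depend on N, and in each of them the closure conditions leave at most
  \<open>2 * p - 2\<close> letters free.\<close>

lemma card_good_quads:
  assumes N: "N > 0"
  shows "card {zs. good_quad p zs \<and> (\<forall>z\<in>set zs. z \<in> words N p \<and> int N dvd rpos 0 (map int z))}
    \<le> (\<Sum>b\<le>2*p. (b ^ p) ^ 4) * N ^ (2 * p - 2)"
    (is "card ?Q \<le> _")
proof -
  define KS where "KS b = {kss. set kss \<subseteq> words b p \<and> length kss = 4}" for b
  define V where "V b kss = {v \<in> {..<b} \<rightarrow>\<^sub>E {..<N}. \<forall>ks\<in>set kss. int N dvd rpos 0 (map int (map v ks))}" for b :: nat and kss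
  define KG where "KG b = {kss \<in> KS b. \<exists>D. D \<subseteq> {..<b} \<and> determined kss D \<and> b - card D \<le> 2 * p - 2}" for b
  have finKS: "finite (KS b)" for b unfolding KS_def by (rule finite_lists_length_eq) simp
  have cardKS: "card (KS b) = (b ^ p) ^ 4" for b
    unfolding KS_def by (simp add: card_lists_length_eq card_words)
  have finKG: "finite (KG b)" for b using finKS[of b] by (simp add: KG_def)
  have finV: "finite (V b kss)" for b kss
    unfolding V_def by (rule finite_subset[of _ "{..<b} \<rightarrow>\<^sub>E {..<N}"]) (auto simp: finite_PiE)
  have "?Q \<subseteq> (\<Union>b\<le>2*p. \<Union>kss\<in>KG b. (\<lambda>v. map (map v) kss) ` V b kss)"
  proof
    fix zs assume "zs \<in> ?Q"
    then have g: "good_quad p zs" and w: "\<And>z. z \<in> set zs \<Longrightarrow> z \<in> words N p"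
      and d: "\<And>z. z \<in> set zs \<Longrightarrow> int N dvd rpos 0 (map int z)" by auto
    define S where "S = set (concat zs)"
    define b where "b = card S"
    have [simp]: "finite S" by (simp add: S_def)
    have SN: "S \<subseteq> {..<N}" using w by (fastforce simp: S_def words_def)
    have len: "length (concat zs) = 4 * p"
      using g by (auto simp: good_quad_def numeral_eq_Suc length_Suc_conv)
    have b2: "b \<le> 2 * p"
      using card_set_le_half[of "concat zs"] g len by (simp add: b_def S_def good_quad_def)
    obtain h where h: "bij_betw h {..<b} S"
      using ex_bij_betw_nat_finite[of S] by (auto simp: b_def atLeast0LessThan)
    define g' where "g' = inv_into {..<b} h"
    have g'1: "g' x < b" "h (g' x) = x" if "x \<in> S" for x
      using that h inv_into_into[of x h "{..<b}"] f_inv_into_f[of x h "{..<b}"]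
      by (simp_all add: g'_def bij_betw_def)
    define v where "v = restrict h {..<b}"
    define kss where "kss = map (map g') zs"
    have kss_v: "zs = map (map v) kss"
    proof -
      have "map v (map g' z) = z" if "z \<in> set zs" for z
        unfolding map_map by (rule map_idI) (use g'1 that in \<open>auto simp: v_def S_def\<close>)
      then show ?thesis unfolding kss_def map_map comp_def by (intro map_idI[symmetric]) auto
    qed
    have setkss: "set (concat kss) = {..<b}"
    proof -
      have "set (concat kss) = g' ` S" by (auto simp: kss_def S_def)
      also have "\<dots> = {..<b}" using h unfolding g'_def bij_betw_def
        by (metis bij_betw_def bij_betw_inv_into h)
      finally show ?thesis .
    qed
    have vinj: "inj_on v {..<b}" using h by (simp add: v_def bij_betw_def inj_on_def)
    have sub: "set ks \<subseteq> {..<b}" if "ks \<in> set kss" for ks using that setkss by auto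
    have KS: "kss \<in> KS b"
      using sub w g unfolding KS_def by (auto simp: kss_def words_def good_quad_def)
    have "good_quad p kss"
      unfolding good_quad_def
    proof (intro conjI allI impI ballI)
      show l4: "length kss = 4" using g by (simp add: kss_def good_quad_def)
      show "length z = p" if "z \<in> set kss" for z using KS that by (auto simp: KS_def words_def)
      show "count_list (concat kss) a \<noteq> 1" for a
      proof (cases "a < b")
        case True
        have "count_list (map v (concat kss)) (v a) = count_list (concat kss) a"
          using vinj setkss True by (intro count_list_map_inj) auto
        moreover have "concat zs = map v (concat kss)" unfolding kss_v map_concat ..
        ultimately show ?thesis using g unfolding good_quad_def by metis
      next
        case False
        then have "a \<notin> set (concat kss)" using setkss by auto
        then have "count_list (concat kss) a = 0" by (simp only: count_list_0_iff not_False_eq_True)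
        then show ?thesis by simp
      qed
      fix i :: nat assume i: "i < 4"
      then obtain j where j: "j < 4" "j \<noteq> i" "set (zs ! i) \<inter> set (zs ! j) \<noteq> {}"
        using g unfolding good_quad_def by blast
      have "set (kss ! i) \<inter> set (kss ! j) \<noteq> {}"
        using j i g by (auto simp: kss_def good_quad_def)
      then show "\<exists>j<4. j \<noteq> i \<and> set (kss ! i) \<inter> set (kss ! j) \<noteq> {}" using j by blast
    qed
    then have "\<exists>D. D \<subseteq> set (concat kss) \<and> determined kss D \<and> b - card D \<le> 2 * p - 2"
      by (rule good_quad_determined) (simp only: setkss card_lessThan)
    then have "kss \<in> KG b" unfolding KG_def setkss using KS by blast
    moreover have "v \<in> V b kss"
    proof -
      have "int N dvd rpos 0 (map int (map v ks))" if "ks \<in> set kss" for ks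
        using that by (intro d) (simp add: kss_v)
      moreover have "v \<in> {..<b} \<rightarrow>\<^sub>E {..<N}" using SN h by (auto simp: v_def bij_betw_def)
      ultimately show ?thesis unfolding V_def by blast
    qed
    ultimately show "zs \<in> (\<Union>b\<le>2*p. \<Union>kss\<in>KG b. (\<lambda>v. map (map v) kss) ` V b kss)"
      using b2 kss_v by blast
  qed
  then have "card ?Q \<le> card (\<Union>b\<le>2*p. \<Union>kss\<in>KG b. (\<lambda>v. map (map v) kss) ` V b kss)"
    using finKG finV by (intro card_mono) auto
  also have "\<dots> \<le> (\<Sum>b\<le>2*p. card (\<Union>kss\<in>KG b. (\<lambda>v. map (map v) kss) ` V b kss))"
    by (rule card_UN_le) simp
  also have "\<dots> \<le> (\<Sum>b\<le>2*p. \<Sum>kss\<in>KG b. card ((\<lambda>v. map (map v) kss) ` V b kss))"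
    using finKG by (intro sum_mono card_UN_le) auto
  also have "\<dots> \<le> (\<Sum>b\<le>2*p. \<Sum>kss\<in>KG b. N ^ (2 * p - 2))"
  proof (intro sum_mono)
    fix b kss assume "kss \<in> KG b"
    then obtain D where D: "D \<subseteq> {..<b}" "determined kss D" "b - card D \<le> 2 * p - 2" and KS: "kss \<in> KS b"
      unfolding KG_def by auto
    have "card ((\<lambda>v. map (map v) kss) ` V b kss) \<le> card (V b kss)" using finV by (rule card_image_le)
    also have "\<dots> \<le> N ^ (b - card D)"
      unfolding V_def using N KS D by (intro card_determined_le) (auto simp: KS_def words_def)
    also have "\<dots> \<le> N ^ (2 * p - 2)" using D N by (intro power_increasing) auto
    finally show "card ((\<lambda>v. map (map v) kss) ` V b kss) \<le> N ^ (2 * p - 2)" .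
  qed
  also have "\<dots> \<le> (\<Sum>b\<le>2*p. (b ^ p) ^ 4 * N ^ (2 * p - 2))"
  proof (intro sum_mono)
    fix b
    have "card (KG b) \<le> card (KS b)" unfolding KG_def using finKS by (intro card_mono) auto
    then show "(\<Sum>kss\<in>KG b. N ^ (2 * p - 2)) \<le> (b ^ p) ^ 4 * N ^ (2 * p - 2)"
      unfolding sum_constant cardKS of_nat_id by (rule mult_right_mono) simp
  qed
  finally show ?thesis by (simp add: sum_distrib_right)
qed

section \<open>Words in which every letter occurs twice\<close>

definition pair_words :: "nat \<Rightarrow> nat \<Rightarrow> nat list set" where
  "pair_words k N = {w \<in> words N (2 * k). \<forall>a\<in>set w. count_list w a = 2}"

lemma finite_pair_words [simp]: "finite (pair_words k N)"
  by (simp add: pair_words_def)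

lemma card_set_pair_word: "w \<in> pair_words k N \<Longrightarrow> card (set w) = k"
  using length_eq_sum_count[of w "set w"] by (auto simp: pair_words_def words_def)

lemma set_pair_word: "ks \<in> pair_words k k \<Longrightarrow> set ks = {..<k}"
  using card_set_pair_word[of ks k k] by (intro card_subset_eq) (auto simp: pair_words_def words_def)

text \<open>This crude count is enough: division by the \<open>k!\<close> relabellings turns it into
  a moment bound of size (2k)!/k!, and the exponential series divides by (2k)! once more, leaving
  1/k!.\<close>

lemma card_pair_words_le: "card (pair_words k k) \<le> fact (2 * k)"
proof -
  let ?A = "mset [0..<k] + mset [0..<k]"
  have "pair_words k k \<subseteq> permutations_of_multiset ?A"
  proof
    fix w assume w: "w \<in> pair_words k k"
    have "mset w = ?A"
    proof (rule multiset_eqI)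
      fix a show "count (mset w) a = count ?A a"
      proof (cases "a < k")
        case True
        then have "a \<in> set w" using set_pair_word[OF w] by simp
        then have "count (mset w) a = 2" using w by (simp add: pair_words_def count_list_0_iff flip: count_mset)
        moreover have "count (mset [0..<k]) a = 1" using True by (simp add: count_mset_set atLeast0LessThan flip: mset_set_upto_eq_mset_upto)
        ultimately show ?thesis by simp
      next
        case False
        then have "a \<notin> set w" using set_pair_word[OF w] by simp
        with False show ?thesis by (simp add: count_eq_zero_iff[THEN iffD2])
      qed
    qed
    then show "w \<in> permutations_of_multiset ?A" by (rule permutations_of_multisetI)
  qed
  then have "card (pair_words k k) \<le> card (permutations_of_multiset ?A)"
    by (intro card_mono) auto
  also have "\<dots> \<le> fact (size ?A)" unfolding card_permutations_of_multiset by (rule div_le_dividend)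
  finally show ?thesis by (simp add: mult_2)
qed

lemma map_pair_word:
  assumes ks: "ks \<in> pair_words k k" and v: "v \<in> {..<k} \<rightarrow>\<^sub>E {..<N}" "inj_on v {..<k}"
  shows "map v ks \<in> pair_words k N"
proof -
  have "count_list (map v ks) a = 2" if "a \<in> set (map v ks)" for a
  proof -
    from that obtain i where i: "a = v i" "i \<in> set ks" by auto
    then show ?thesis
      using count_list_map_inj[OF v(2), of ks i] ks set_pair_word[OF ks] by (simp add: pair_words_def)
  qed
  then show ?thesis
    using ks v set_pair_word[OF ks] unfolding pair_words_def by (auto simp: words_def PiE_iff)
qed

lemma card_inj_funcset:
  assumes "finite S" "card S = k"
  shows "card {v \<in> {..<k} \<rightarrow>\<^sub>E S. inj_on v {..<k}} = fact k"
  using assms card_inj_on_subset_funcset[of "{..<k}" S "{..<k}"]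
  by (simp add: fact_prod_rev)

text \<open>Every word in which each letter occurs exactly twice is a relabelling of \<open>k!\<close> such words
  over the alphabet \<open>{0, \<dots>, k - 1}\<close>.\<close>

lemma sum_pair_words:
  fixes G :: "nat list \<Rightarrow> 'b :: {comm_semiring_1}"
  shows "(\<Sum>ks\<in>pair_words k k. \<Sum>v\<in>{v \<in> {..<k} \<rightarrow>\<^sub>E {..<N}. inj_on v {..<k}}. G (map v ks))
    = of_nat (fact k) * (\<Sum>w\<in>pair_words k N. G w)"
proof -
  define V where "V = {v \<in> {..<k} \<rightarrow>\<^sub>E {..<N}. inj_on v {..<k}}"
  define f :: "nat list \<times> (nat \<Rightarrow> nat) \<Rightarrow> nat list" where "f = (\<lambda>(ks, v). map v ks)"
  have finV: "finite V" unfolding V_def by (rule finite_subset[of _ "{..<k} \<rightarrow>\<^sub>E {..<N}"]) (auto simp: finite_PiE)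
  have "(\<Sum>ks\<in>pair_words k k. \<Sum>v\<in>V. G (map v ks)) = (\<Sum>x\<in>pair_words k k \<times> V. G (f x))"
    by (simp add: sum.cartesian_product f_def case_prod_beta)
  \<comment> \<open>Group the pairs of pattern and assignment by the word they produce. The
    assignment determines the pattern, so the fibre over w corresponds to the injections of
    \<open>{..<k}\<close> into the k letters of w.\<close>
  also have "\<dots> = (\<Sum>w\<in>pair_words k N. \<Sum>x\<in>{x \<in> pair_words k k \<times> V. f x = w}. G (f x))"
  proof (rule sum.group[symmetric])
    show "f ` (pair_words k k \<times> V) \<subseteq> pair_words k N"
      using map_pair_word by (auto simp: f_def V_def)
  qed (simp_all add: finV)
  also have "\<dots> = (\<Sum>w\<in>pair_words k N. of_nat (fact k) * G w)"
  proof (rule sum.cong[OF refl])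
    fix w assume w: "w \<in> pair_words k N"
    let ?F = "{x \<in> pair_words k k \<times> V. f x = w}"
    have cw: "card (set w) = k" by (rule card_set_pair_word[OF w])
    have "bij_betw snd ?F {v \<in> {..<k} \<rightarrow>\<^sub>E set w. inj_on v {..<k}}"
    proof (rule bij_betwI')
      fix x y assume x: "x \<in> ?F" and y: "y \<in> ?F"
      obtain ks v where xx: "x = (ks, v)" by (cases x)
      obtain ks' v' where yy: "y = (ks', v')" by (cases y)
      have "ks = ks'" if "v = v'"
      proof (rule map_inj_on[of v])
        have "set ks = {..<k}" "set ks' = {..<k}"
          using x y set_pair_word[of ks k] set_pair_word[of ks' k] unfolding xx yy by auto
        then show "inj_on v (set ks \<union> set ks')" using x unfolding xx by (simp add: V_def)
        show "map v ks = map v ks'" using x y that unfolding xx yy by (simp add: f_def)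
      qed
      then show "(snd x = snd y) = (x = y)" unfolding xx yy by auto
    next
      fix x assume x: "x \<in> ?F"
      obtain ks v where xx: "x = (ks, v)" by (cases x)
      have v: "v \<in> {..<k} \<rightarrow>\<^sub>E {..<N}" "inj_on v {..<k}" "map v ks = w" "set ks = {..<k}"
        using x set_pair_word[of ks k] unfolding xx by (auto simp: f_def V_def)
      have "v i \<in> set w" if "i < k" for i
        unfolding v(3)[symmetric] set_map using v(4) that by auto
      then show "snd x \<in> {v \<in> {..<k} \<rightarrow>\<^sub>E set w. inj_on v {..<k}}"
        using v xx by (auto simp: PiE_iff)
    next
      fix v assume "v \<in> {v \<in> {..<k} \<rightarrow>\<^sub>E set w. inj_on v {..<k}}"
      then have v: "v \<in> {..<k} \<rightarrow>\<^sub>E set w" "inj_on v {..<k}" by auto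
      have im: "v ` {..<k} = set w"
        using v cw by (intro card_subset_eq) (auto simp: card_image)
      define g where "g = inv_into {..<k} v"
      have g: "g x < k" "v (g x) = x" if "x \<in> set w" for x
        using that im inv_into_into[of x v "{..<k}"] f_inv_into_f[of x v "{..<k}"] by (simp_all add: g_def)
      define ks where "ks = map g w"
      have m: "map v ks = w" unfolding ks_def map_map by (rule map_idI) (use g in auto)
      have sub: "set ks \<subseteq> {..<k}" using g by (auto simp: ks_def)
      have "count_list ks i = 2" if "i \<in> set ks" for i
      proof -
        have "count_list (map v ks) (v i) = count_list ks i"
          by (rule count_list_map_inj[OF v(2) sub]) (use sub that in auto)
        moreover have "v i \<in> set w" using that m by (metis image_eqI set_map)
        ultimately show ?thesis using m w by (simp add: pair_words_def)
      qed
      then have "ks \<in> pair_words k k" using sub w by (auto simp: pair_words_def words_def ks_def)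
      moreover have "v \<in> V" using v w by (auto simp: V_def pair_words_def words_def PiE_iff)
      ultimately have "(ks, v) \<in> ?F" using m by (simp add: f_def)
      then show "\<exists>x\<in>?F. v = snd x" by force
    qed
    then have "card ?F = fact k" using card_inj_funcset[of "set w" k] cw by (simp add: bij_betw_same_card)
    then show "(\<Sum>x\<in>?F. G (f x)) = of_nat (fact k) * G w" by (simp add: sum_constant)
  qed
  finally show ?thesis by (simp add: V_def sum_distrib_left)
qed

lemma card_pair_words_bound: "fact k * card (pair_words k N) \<le> fact (2 * k) * N ^ k"
proof -
  have "fact k * card (pair_words k N) = (\<Sum>ks\<in>pair_words k k. \<Sum>v\<in>{v \<in> {..<k} \<rightarrow>\<^sub>E {..<N}. inj_on v {..<k}}. 1)"
    using sum_pair_words[of "\<lambda>_. 1 :: nat" k N] by simp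
  also have "\<dots> \<le> (\<Sum>ks\<in>pair_words k k. card ({..<k} \<rightarrow>\<^sub>E {..<N}))"
    by (intro sum_mono) (auto intro!: card_mono simp: finite_PiE)
  also have "\<dots> = card (pair_words k k) * N ^ k" by (simp add: card_PiE)
  also have "\<dots> \<le> fact (2 * k) * N ^ k" by (intro mult_right_mono card_pair_words_le) auto
  finally show ?thesis .
qed

section \<open>The rescaled walk on the unit circle\<close>

definition stpr :: "real \<Rightarrow> real \<Rightarrow> real" where
  "stpr a l = frac (l - a)"

primrec wtr :: "(real \<Rightarrow> real \<Rightarrow> complex) \<Rightarrow> real \<Rightarrow> real list \<Rightarrow> complex" where
  "wtr \<phi> a [] = 1"
| "wtr \<phi> a (l # ls) = \<phi> a (stpr a l) * wtr \<phi> (stpr a l) ls"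

text \<open>General position: the walk avoids 0 and 1/2 modulo 1 and no step stays in place, so at
  every pair of consecutive points a \<open>weight\<close> is continuous.\<close>

primrec gen :: "real \<Rightarrow> real list \<Rightarrow> bool" where
  "gen a [] \<longleftrightarrow> True"
| "gen a (l # ls) \<longleftrightarrow> 2 * a \<notin> \<int> \<and> 2 * stpr a l \<notin> \<int> \<and> a \<noteq> stpr a l \<and> gen (stpr a l) ls"

lemma frac_nat_div: "N > 0 \<Longrightarrow> frac (real m / real N) = real (m mod N) / real N"
proof -
  assume "N > 0"
  moreover have "real m = real N * real (m div N) + real (m mod N)"
    by (metis mult_div_mod_eq of_nat_add of_nat_mult)
  moreover have "frac (real m / real N) = real m / real N - real (m div N)"
    by (simp add: frac_def floor_divide_of_nat_eq)
  ultimately show ?thesis by (simp add: field_simps)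
qed

lemma stp_stpr: "a < N \<Longrightarrow> real (stp N a l) / real N = stpr (real a / real N) (real l / real N)"
proof -
  assume a: "a < N"
  then have "real (stp N a l) / real N = frac (real (l + (N - a)) / real N)"
    using frac_nat_div[of N "l + (N - a)"] by (simp add: stp_def)
  also have "real (l + (N - a)) / real N = (real l / real N - real a / real N) + 1"
    using a by (simp add: of_nat_diff field_simps)
  also have "frac \<dots> = frac (real l / real N - real a / real N)" by (rule frac_1_eq)
  finally show ?thesis by (simp add: stpr_def)
qed

lemma wt_wtr: "a < N \<Longrightarrow> wt \<phi> N a ls = wtr \<phi> (real a / real N) (map (\<lambda>l. real l / real N) ls)"
  by (induction ls arbitrary: a) (auto simp: stp_stpr)

lemma tendsto_frac:
  fixes l :: real
  assumes "(f \<longlongrightarrow> l) F" "l \<notin> \<int>"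
  shows "((\<lambda>x. frac (f x)) \<longlongrightarrow> frac l) F"
proof -
  have "\<forall>\<^sub>F x in F. \<lfloor>f x\<rfloor> = \<lfloor>l\<rfloor>" using assms by (rule eventually_floor_eq)
  then have "\<forall>\<^sub>F x in F. frac (f x) = f x - of_int \<lfloor>l\<rfloor>"
    by eventually_elim (simp add: frac_def)
  moreover have "((\<lambda>x. f x - of_int \<lfloor>l\<rfloor>) \<longlongrightarrow> frac l) F"
    unfolding frac_def by (intro tendsto_intros assms)
  ultimately show ?thesis by (simp add: filterlim_cong)
qed

locale weight =
  fixes \<phi> :: "real \<Rightarrow> real \<Rightarrow> complex"
  assumes bound: "cmod (\<phi> x y) \<le> 1"
    and cont: "2 * x \<notin> \<int> \<Longrightarrow> 2 * y \<notin> \<int> \<Longrightarrow> x \<noteq> y \<Longrightarrow> isCont (\<lambda>z. \<phi> (fst z) (snd z)) (x, y)"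
begin

lemma wtr_tendsto:
  assumes "(f \<longlongrightarrow> a) F" "\<And>i. i \<in> set ks \<Longrightarrow> ((\<lambda>n. g n i) \<longlongrightarrow> u i) F" "gen a (map u ks)"
  shows "((\<lambda>n. wtr \<phi> (f n) (map (g n) ks)) \<longlongrightarrow> wtr \<phi> a (map u ks)) F"
  using assms
proof (induction ks arbitrary: f a)
  case (Cons k ks)
  \<comment> \<open>Avoiding the point 0 also keeps \<open>u k - a\<close> off the integers, where
    \<open>frac\<close> jumps.\<close>
  have ni: "u k - a \<notin> \<int>"
  proof
    assume "u k - a \<in> \<int>"
    then have "stpr a (u k) = 0" by (simp add: stpr_def frac_eq_0_iff)
    with Cons.prems(3) show False by simp
  qed
  have s: "((\<lambda>n. stpr (f n) (g n k)) \<longlongrightarrow> stpr a (u k)) F"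
    unfolding stpr_def by (intro tendsto_frac tendsto_diff Cons.prems ni) simp
  have "((\<lambda>n. (f n, stpr (f n) (g n k))) \<longlongrightarrow> (a, stpr a (u k))) F"
    by (intro tendsto_Pair Cons.prems s)
  moreover have "isCont (\<lambda>z. \<phi> (fst z) (snd z)) (a, stpr a (u k))"
    using Cons.prems(3) by (intro cont) auto
  ultimately have "((\<lambda>n. \<phi> (f n) (stpr (f n) (g n k))) \<longlongrightarrow> \<phi> a (stpr a (u k))) F"
    using isCont_tendsto_compose by fastforce
  moreover have "((\<lambda>n. wtr \<phi> (stpr (f n) (g n k)) (map (g n) ks)) \<longlongrightarrow> wtr \<phi> (stpr a (u k)) (map u ks)) F"
    using Cons.prems by (intro Cons.IH s) auto
  ultimately show ?case by (auto intro: tendsto_mult)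
qed auto

end

lemma frac_diff_Ints: "frac x - x \<in> \<int>" for x :: real
  by (simp add: frac_def)

text \<open>The conditions only concern positions modulo 1, so they can be tested on the unreduced
  walk, where they are affine in the start.\<close>

lemma genI:
  assumes "\<And>t. t \<le> length ls \<Longrightarrow> 2 * rpos a (take t ls) \<notin> \<int>"
    and "\<And>t. t < length ls \<Longrightarrow> rpos a (take t ls) - rpos a (take (Suc t) ls) \<notin> \<int>"
  shows "gen (frac a) ls"
  using assms
proof (induction ls arbitrary: a)
  case (Cons l ls)
  have s: "stpr (frac a) l = frac (l - a)"
  proof -
    have "l - frac a = l - a + of_int \<lfloor>a\<rfloor>" by (simp add: frac_def)
    then have "frac (l - frac a) = frac (l - a)" by (simp only: frac_add_of_int_right)
    then show ?thesis by (simp add: stpr_def)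
  qed
  have nh: "2 * frac x \<notin> \<int>" if "2 * x \<notin> \<int>" for x :: real
  proof
    assume "2 * frac x \<in> \<int>"
    moreover have "2 * (frac x - x) \<in> \<int>" by (rule Ints_mult[OF _ frac_diff_Ints]) simp
    ultimately have "2 * frac x - 2 * (frac x - x) \<in> \<int>" by (rule Ints_diff)
    with that show False by (simp add: algebra_simps)
  qed
  have "2 * frac a \<notin> \<int>" using Cons.prems(1)[of 0] by (intro nh) simp
  moreover have "2 * frac (l - a) \<notin> \<int>" using Cons.prems(1)[of 1] by (intro nh) simp
  moreover have "frac a \<noteq> frac (l - a)"
  proof
    assume eq: "frac a = frac (l - a)"
    have "(frac (l - a) - (l - a)) - (frac a - a) \<in> \<int>" by (intro Ints_diff frac_diff_Ints)
    then have "a - (l - a) \<in> \<int>" using eq by (simp add: algebra_simps)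
    with Cons.prems(2)[of 0] show False by simp
  qed
  moreover have "gen (frac (l - a)) ls"
    using Cons.prems(1)[of "Suc _"] Cons.prems(2)[of "Suc _"] by (intro Cons.IH) auto
  ultimately show ?case by (simp add: s)
qed auto

lemma rpos_lincomb:
  fixes u :: "'i \<Rightarrow> real"
  assumes "finite A" "set ks \<subseteq> A"
  shows "rpos 0 (map u ks) = (\<Sum>i\<in>A. u i * rpos 0 (map (\<lambda>j. if j = i then 1 else 0) ks))"
  using assms(2)
proof (induction ks)
  case (Cons k ks)
  have r: "rpos (x :: real) ls = rpos 0 ls + (-1) ^ length ls * x" for x ls by (rule rpos_start)
  have "(\<Sum>i\<in>A. u i * rpos 0 (map (\<lambda>j. if j = i then 1 else 0) (k # ks)))
    = (\<Sum>i\<in>A. u i * rpos 0 (map (\<lambda>j. if j = i then 1 else 0) ks) + (if i = k then (-1) ^ length ks * u k else 0))"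
    by (intro sum.cong refl) (subst list.map, subst rpos.simps, subst r, auto simp: algebra_simps)
  also have "\<dots> = rpos 0 (map u ks) + (-1) ^ length ks * u k"
    using Cons assms(1) by (simp add: sum.distrib)
  also have "\<dots> = rpos 0 (map u (k # ks))" using r[of "u k" "map u ks"] by simp
  finally show ?case ..
qed auto

lemma of_int_rpos: "real_of_int (rpos a ls) = rpos (of_int a) (map of_int ls)"
  by (induction ls arbitrary: a) auto

lemma rpos_scale: "rpos (c * a) (map (\<lambda>x. c * x) ls) = c * rpos a ls" for c :: real
proof (induction ls arbitrary: a)
  case (Cons l ls)
  show ?case using Cons[of "l - a"] by (simp add: algebra_simps)
qed auto

lemma closed_iff_Ints:
  assumes "N > 0"
  shows "int N dvd rpos 0 (map int ls) \<longleftrightarrow> rpos 0 (map (\<lambda>l. real l / real N) ls) \<in> \<int>"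
proof -
  have "real_of_int (rpos 0 (map int ls)) = rpos 0 (map real ls)"
    by (simp add: of_int_rpos comp_def)
  also have "\<dots> = rpos (real N * 0) (map (\<lambda>x. real N * x) (map (\<lambda>l. real l / real N) ls))"
    using assms by (simp add: comp_def)
  also have "\<dots> = real N * rpos 0 (map (\<lambda>l. real l / real N) ls)" by (rule rpos_scale)
  finally have eq: "real_of_int (rpos 0 (map int ls)) = real N * rpos 0 (map (\<lambda>l. real l / real N) ls)" .
  show ?thesis
  proof
    assume "int N dvd rpos 0 (map int ls)"
    then obtain q where "rpos 0 (map int ls) = int N * q" ..
    with eq assms have "rpos 0 (map (\<lambda>l. real l / real N) ls) = of_int q" by simp
    then show "rpos 0 (map (\<lambda>l. real l / real N) ls) \<in> \<int>" by simp
  next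
    assume "rpos 0 (map (\<lambda>l. real l / real N) ls) \<in> \<int>"
    then obtain q where "rpos 0 (map (\<lambda>l. real l / real N) ls) = of_int q" by (elim Ints_cases)
    with eq have "real_of_int (rpos 0 (map int ls)) = real_of_int (int N * q)" by simp
    then have "rpos 0 (map int ls) = int N * q" by (simp only: of_int_eq_iff)
    then show "int N dvd rpos 0 (map int ls)" by simp
  qed
qed

section \<open>Grid sums over the unit cube\<close>

text \<open>Half-open, so that the cells of length 1/N tile the space exactly for every N.\<close>

definition U01 :: "real measure" where
  "U01 = restrict_space lborel {0..<1}"

lemma space_U01 [simp]: "space U01 = {0..<1}"
  by (simp add: U01_def space_restrict_space)

lemma measurable_U01 [measurable]: "(\<lambda>x. x) \<in> borel_measurable U01"
  unfolding U01_def by (rule measurable_restrict_space1) simp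

lemma sets_U01_iff: "A \<in> sets U01 \<longleftrightarrow> A \<subseteq> {0..<1} \<and> A \<in> sets borel"
  unfolding U01_def by (subst sets_restrict_space_iff) auto

lemma emeasure_U01: "A \<in> sets U01 \<Longrightarrow> emeasure U01 A = emeasure lborel A"
  using sets_U01_iff[of A] unfolding U01_def by (intro emeasure_restrict_space) auto

lemma prob_space_U01: "prob_space U01"
proof (rule prob_spaceI)
  have "emeasure U01 (space U01) = emeasure lborel {0..<1::real}"
    by (subst emeasure_U01) (auto simp: sets_U01_iff)
  then show "emeasure U01 (space U01) = 1" by simp
qed

interpretation PU: product_prob_space "\<lambda>_. U01" UNIV
  using prob_space_U01 by (simp add: product_prob_space_def product_prob_space_axioms_def product_sigma_finite_def prob_space_imp_sigma_finite)

text \<open>There are k + 1 coordinates: those below k carry the letters of a word, coordinate k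
  carries the start of the walk.\<close>

abbreviation cube :: "nat \<Rightarrow> (nat \<Rightarrow> real) measure" where
  "cube k \<equiv> Pi\<^sub>M {..k} (\<lambda>_. U01)"

lemma prob_space_cube: "prob_space (cube k)"
  by (rule prob_space_PiM) (rule prob_space_U01)

lemma space_cube: "space (cube k) = {..k} \<rightarrow>\<^sub>E {0..<1}"
  by (simp add: space_PiM)

lemma measurable_cube_component [measurable]: "i \<le> k \<Longrightarrow> (\<lambda>u. u i) \<in> borel_measurable (cube k)"
  using measurable_compose[OF measurable_component_singleton[of i "{..k}" "\<lambda>_. U01"] measurable_U01] by simp

text \<open>Fubini with coordinate i integrated first: countable sections are null. All genericity
  statements below reduce to this.\<close>

lemma AE_cube_countable_section:
  assumes i: "i \<le> k" and Q: "{u \<in> space (cube k). Q u} \<in> sets (cube k)"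
    and cnt: "\<And>u. countable {y. Q (u(i := y))}"
  shows "AE u in cube k. \<not> Q u"
proof -
  define J where "J = {..k} - {i}"
  have J: "finite J" "i \<notin> J" "insert i J = {..k}" using i by (auto simp: J_def)
  let ?S = "{u \<in> space (cube k). Q u}"
  have "emeasure (cube k) ?S = (\<integral>\<^sup>+u. indicator ?S u \<partial>Pi\<^sub>M (insert i J) (\<lambda>_. U01))"
    using Q J by simp
  also have "\<dots> = (\<integral>\<^sup>+x. (\<integral>\<^sup>+y. indicator ?S (x(i := y)) \<partial>U01) \<partial>Pi\<^sub>M J (\<lambda>_. U01))"
    using J Q by (intro PU.product_nn_integral_insert) (auto intro: borel_measurable_indicator)
  also have "\<dots> = (\<integral>\<^sup>+x. 0 \<partial>Pi\<^sub>M J (\<lambda>_. U01))"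
  proof (intro nn_integral_cong)
    fix x
    define Y where "Y = {y. Q (x(i := y))} \<inter> {0..<1}"
    have Y: "countable Y" unfolding Y_def by (rule countable_Int1) (rule cnt)
    have "Y \<in> sets borel" by (rule sets.countable[OF _ Y]) simp
    then have Ys: "Y \<in> sets U01" unfolding sets_U01_iff by (auto simp: Y_def)
    have "emeasure U01 Y = 0" using emeasure_U01[OF Ys] emeasure_lborel_countable[OF Y] by simp
    then have "AE y in U01. y \<notin> Y" using Ys by (intro AE_not_in) (simp add: null_sets_def)
    then have "AE y in U01. indicator ?S (x(i := y)) = (0 :: ennreal)"
    proof (rule AE_mp, intro AE_I2 impI)
      fix y assume "y \<in> space U01" "y \<notin> Y"
      then have "\<not> Q (x(i := y))" by (simp add: Y_def)
      then show "indicator ?S (x(i := y)) = (0 :: ennreal)" by (simp add: indicator_def)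
    qed
    then show "(\<integral>\<^sup>+y. indicator ?S (x(i := y)) \<partial>U01) = 0"
      using nn_integral_cong_AE[where M = U01 and u = "\<lambda>y. indicator ?S (x(i := y))" and v = "\<lambda>_. 0"] by simp
  qed
  finally have "emeasure (cube k) ?S = 0" by simp
  with Q show ?thesis by (intro AE_I[where N = ?S]) auto
qed

lemma countable_affine_Ints: "c \<noteq> 0 \<Longrightarrow> countable {y :: real. b + c * y \<in> \<int>}"
proof -
  assume c: "c \<noteq> 0"
  have "{y. b + c * y \<in> \<int>} \<subseteq> (\<lambda>z. (z - b) / c) ` \<int>"
  proof
    fix y assume "y \<in> {y. b + c * y \<in> \<int>}"
    then show "y \<in> (\<lambda>z. (z - b) / c) ` \<int>" using c by (intro image_eqI[of _ _ "b + c * y"]) auto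
  qed
  then show ?thesis using countable_int countable_image countable_subset by blast
qed

definition grid :: "nat \<Rightarrow> nat \<Rightarrow> (nat \<Rightarrow> real) \<Rightarrow> nat \<Rightarrow> nat" where
  "grid N k u = (\<lambda>i\<in>{..k}. nat \<lfloor>real N * u i\<rfloor>)"

lemma grid_in:
  assumes "u \<in> space (cube k)" "N > 0"
  shows "grid N k u \<in> {..k} \<rightarrow>\<^sub>E {..<N}"
proof (rule PiE_I)
  fix i assume "i \<in> {..k}"
  then have "0 \<le> u i" "u i < 1" "i \<le> k" using assms by (auto simp: space_cube)
  moreover from this have "real N * u i < real N" "0 \<le> real N * u i" using assms(2) by auto
  then have "\<lfloor>real N * u i\<rfloor> < int N" "0 \<le> \<lfloor>real N * u i\<rfloor>" by linarith+
  ultimately show "grid N k u i \<in> {..<N}" by (simp add: grid_def nat_less_iff)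
qed (simp add: grid_def)

lemma grid_tendsto:
  assumes "u \<in> space (cube k)" "i \<le> k"
  shows "(\<lambda>n. real (grid (Suc n) k u i) / real (Suc n)) \<longlonglongrightarrow> u i"
proof (rule tendsto_sandwich)
  have u: "0 \<le> u i" using assms by (auto simp: space_cube)
  have g: "real (grid N k u i) = of_int \<lfloor>real N * u i\<rfloor>" for N
    using assms(2) u by (simp add: grid_def)
  show "\<forall>\<^sub>F n in sequentially. u i - 1 / real (Suc n) \<le> real (grid (Suc n) k u i) / real (Suc n)"
  proof (rule always_eventually, rule allI)
    fix n
    have "real (Suc n) * u i - 1 \<le> real (grid (Suc n) k u i)" unfolding g by linarith
    then have "(real (Suc n) * u i - 1) / real (Suc n) \<le> real (grid (Suc n) k u i) / real (Suc n)"
      by (rule divide_right_mono) simp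
    then show "u i - 1 / real (Suc n) \<le> real (grid (Suc n) k u i) / real (Suc n)"
      by (simp add: diff_divide_distrib del: of_nat_Suc)
  qed
  show "\<forall>\<^sub>F n in sequentially. real (grid (Suc n) k u i) / real (Suc n) \<le> u i"
    unfolding g by (rule always_eventually) (simp add: divide_le_eq mult.commute del: of_nat_Suc)
  have "(\<lambda>n. u i - 1 / real (Suc n)) \<longlonglongrightarrow> u i - 0"
    by (intro tendsto_diff tendsto_const) (use LIMSEQ_inverse_real_of_nat in \<open>simp add: inverse_eq_divide\<close>)
  then show "(\<lambda>n. u i - 1 / real (Suc n)) \<longlonglongrightarrow> u i" by simp
qed simp

lemma grid_eq_iff:
  assumes u: "u \<in> space (cube k)" and N: "N > 0" and v: "v \<in> {..k} \<rightarrow>\<^sub>E {..<N}"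
  shows "grid N k u = v \<longleftrightarrow> u \<in> (\<Pi>\<^sub>E i\<in>{..k}. {real (v i) / real N ..< (real (v i) + 1) / real N})"
proof -
  have "grid N k u i = v i \<longleftrightarrow> u i \<in> {real (v i) / real N ..< (real (v i) + 1) / real N}" if "i \<le> k" for i
  proof -
    have "0 \<le> u i" using u that by (auto simp: space_cube)
    then have "0 \<le> \<lfloor>real N * u i\<rfloor>" by simp
    then have "grid N k u i = v i \<longleftrightarrow> \<lfloor>real N * u i\<rfloor> = int (v i)"
      using that by (simp add: grid_def) linarith
    also have "\<dots> \<longleftrightarrow> real (v i) \<le> real N * u i \<and> real N * u i < real (v i) + 1"
      by (simp add: floor_eq_iff)
    also have "\<dots> \<longleftrightarrow> u i \<in> {real (v i) / real N ..< (real (v i) + 1) / real N}"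
      using N by (simp add: field_simps)
    finally show ?thesis .
  qed
  moreover have "grid N k u = v \<longleftrightarrow> (\<forall>i\<le>k. grid N k u i = v i)"
    using v by (auto simp: fun_eq_iff grid_def PiE_iff extensional_def)
  ultimately show ?thesis using u by (auto simp: PiE_iff space_cube)
qed

lemma cell_sets:
  assumes N: "N > 0" and v: "v \<in> {..k} \<rightarrow>\<^sub>E {..<N}" and i: "i \<le> k"
  shows "{real (v i) / real N ..< (real (v i) + 1) / real N} \<in> sets U01"
    "emeasure U01 {real (v i) / real N ..< (real (v i) + 1) / real N} = ennreal (1 / real N)"
proof -
  have "v i + 1 \<le> N" using v i by (auto simp: PiE_iff Suc_le_eq)
  then have "real (v i) + 1 \<le> real N" by linarith
  then have "(real (v i) + 1) / real N \<le> 1" using N by simp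
  then show *: "{real (v i) / real N ..< (real (v i) + 1) / real N} \<in> sets U01"
    unfolding sets_U01_iff by (auto intro: order_trans[of 0 "real (v i) / real N"])
  have "(real (v i) + 1) / real N - real (v i) / real N = 1 / real N" by (simp add: add_divide_distrib)
  then show "emeasure U01 {real (v i) / real N ..< (real (v i) + 1) / real N} = ennreal (1 / real N)"
    using N by (subst emeasure_U01[OF *]) (simp add: divide_right_mono)
qed

text \<open>\<open>grid N k\<close> is constant on cells of volume 1/N^(k+1), so a normalised
  lattice sum is exactly an integral over the cube, without an error term.\<close>

lemma integral_grid:
  fixes G :: "(nat \<Rightarrow> nat) \<Rightarrow> complex"
  assumes N: "N > 0"
  shows "(\<lambda>u. G (grid N k u)) \<in> borel_measurable (cube k)"
    and "(\<integral>u. G (grid N k u) \<partial>cube k) = (\<Sum>v\<in>{..k} \<rightarrow>\<^sub>E {..<N}. G v) / of_nat N ^ Suc k"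
proof -
  interpret C: prob_space "cube k" by (rule prob_space_cube)
  define B where "B v = (\<Pi>\<^sub>E i\<in>{..k}. {real (v i) / real N ..< (real (v i) + 1) / real N})" for v :: "nat \<Rightarrow> nat"
  let ?V = "{..k} \<rightarrow>\<^sub>E {..<N}"
  have finV: "finite ?V" by (simp add: finite_PiE)
  have Bs: "B v \<in> sets (cube k)" if "v \<in> ?V" for v
    unfolding B_def using cell_sets[OF N that] by (intro sets_PiM_I_finite) auto
  have Bm: "measure (cube k) (B v) = 1 / real N ^ Suc k" if "v \<in> ?V" for v
  proof -
    have "emeasure (cube k) (B v) = (\<Prod>i\<in>{..k}. ennreal (1 / real N))"
      unfolding B_def using cell_sets[OF N that] by (subst PU.emeasure_PiM) auto
    also have "\<dots> = ennreal ((1 / real N) ^ Suc k)" unfolding prod_constant card_atMost by (rule ennreal_power) simp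
    finally show ?thesis by (simp add: measure_def power_one_over del: power_Suc)
  qed
  have eq: "G (grid N k u) = (\<Sum>v\<in>?V. of_real (indicator (B v) u) * G v)" if u: "u \<in> space (cube k)" for u
  proof -
    have "(\<Sum>v\<in>?V. of_real (indicator (B v) u) * G v) = (\<Sum>v\<in>?V. if v = grid N k u then G v else 0)"
      using grid_eq_iff[OF u N] by (intro sum.cong refl) (auto simp: B_def indicator_def)
    also have "\<dots> = G (grid N k u)" using grid_in[OF u N] finV by simp
    finally show ?thesis ..
  qed
  have meas: "(\<lambda>u. \<Sum>v\<in>?V. of_real (indicator (B v) u) * G v) \<in> borel_measurable (cube k)"
    using Bs by (intro borel_measurable_sum borel_measurable_times borel_measurable_of_real borel_measurable_indicator) auto
  have "(\<lambda>u. G (grid N k u)) \<in> borel_measurable (cube k) \<longleftrightarrow>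
    (\<lambda>u. \<Sum>v\<in>?V. of_real (indicator (B v) u) * G v) \<in> borel_measurable (cube k)"
    by (rule measurable_cong) (rule eq)
  with meas show "(\<lambda>u. G (grid N k u)) \<in> borel_measurable (cube k)" by blast
  have "(\<integral>u. G (grid N k u) \<partial>cube k) = (\<integral>u. (\<Sum>v\<in>?V. of_real (indicator (B v) u) * G v) \<partial>cube k)"
    using eq by (intro Bochner_Integration.integral_cong) auto
  also have "\<dots> = (\<Sum>v\<in>?V. (\<integral>u. of_real (indicator (B v) u) * G v \<partial>cube k))"
    using Bs by (intro Bochner_Integration.integral_sum integrable_mult_left integrable_of_real integrable_real_indicator)
      (auto simp: C.emeasure_eq_measure)
  also have "\<dots> = (\<Sum>v\<in>?V. of_real (1 / real N ^ Suc k) * G v)"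
    using Bs Bm by (intro sum.cong refl) (simp add: sets.sets_into_space Int_absorb2 del: power_Suc)
  also have "\<dots> = (\<Sum>v\<in>?V. G v) / of_nat N ^ Suc k"
    by (simp add: sum_divide_distrib del: power_Suc)
  finally show "(\<integral>u. G (grid N k u) \<partial>cube k) = (\<Sum>v\<in>?V. G v) / of_nat N ^ Suc k" .
qed

text \<open>Once the sums are integrals of step functions, dominated convergence with the constant
  majorant 1 applies. The value of the limit is left as an integral that is never evaluated.\<close>

lemma riemann_sums_converge:
  fixes G :: "nat \<Rightarrow> (nat \<Rightarrow> nat) \<Rightarrow> complex"
  assumes b: "\<And>N v. cmod (G N v) \<le> 1"
    and c: "AE u in cube k. convergent (\<lambda>n. G (Suc n) (grid (Suc n) k u))"
  shows "convergent (\<lambda>N. (\<Sum>v\<in>{..k} \<rightarrow>\<^sub>E {..<N}. G N v) / of_nat N ^ Suc k)"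
proof -
  interpret C: prob_space "cube k" by (rule prob_space_cube)
  let ?s = "\<lambda>n u. G (Suc n) (grid (Suc n) k u)"
  have m: "?s n \<in> borel_measurable (cube k)" for n by (rule integral_grid) simp
  have "(\<lambda>n. integral\<^sup>L (cube k) (?s n)) \<longlonglongrightarrow> integral\<^sup>L (cube k) (\<lambda>u. lim (\<lambda>n. ?s n u))"
  proof (rule integral_dominated_convergence[where w = "\<lambda>_. 1"])
    show "AE u in cube k. (\<lambda>n. ?s n u) \<longlonglongrightarrow> lim (\<lambda>n. ?s n u)"
      using c by eventually_elim (simp only: convergent_LIMSEQ_iff)
    show "(\<lambda>u. lim (\<lambda>n. ?s n u)) \<in> borel_measurable (cube k)"
      using m by (rule borel_measurable_lim_metric)
  qed (use m b in auto)
  then have "convergent (\<lambda>n. integral\<^sup>L (cube k) (?s n))" by (rule convergentI)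
  moreover have "integral\<^sup>L (cube k) (?s n) = (\<Sum>v\<in>{..k} \<rightarrow>\<^sub>E {..<Suc n}. G (Suc n) v) / of_nat (Suc n) ^ Suc k" for n
    by (rule integral_grid) simp
  ultimately have "convergent (\<lambda>n. (\<Sum>v\<in>{..k} \<rightarrow>\<^sub>E {..<Suc n}. G (Suc n) v) / of_nat (Suc n) ^ Suc k)" by simp
  then show ?thesis by (subst (asm) convergent_Suc_iff)
qed

lemma rpos_measurable:
  assumes "set ks \<subseteq> {..k}" "f \<in> borel_measurable (cube k)"
  shows "(\<lambda>u. rpos (f u) (map u ks)) \<in> borel_measurable (cube k)"
  using assms
proof (induction ks arbitrary: f)
  case (Cons i ks)
  have "(\<lambda>u. u i - f u) \<in> borel_measurable (cube k)"
    using Cons.prems measurable_cube_component[of i k] by (intro borel_measurable_diff) auto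
  with Cons show ?case by simp
qed auto

lemma Ints_sets:
  fixes f :: "_ \<Rightarrow> real"
  assumes "f \<in> borel_measurable M"
  shows "{u \<in> space M. f u \<in> \<int>} \<in> sets M"
proof -
  have "f -` \<int> \<inter> space M \<in> sets M" by (rule measurable_sets[OF assms]) (simp add: borel_closed)
  also have "f -` \<int> \<inter> space M = {u \<in> space M. f u \<in> \<int>}" by auto
  finally show ?thesis .
qed

text \<open>Each condition is affine in the start, with slope 2 or -2, and so fails for at most
  countably many starts once the letters are fixed.\<close>

lemma AE_gen:
  assumes ks: "set ks \<subseteq> {..<k}"
  shows "AE u in cube k. gen (u k) (map u ks)"
proof -
  define R where "R t u = rpos (u k) (map u (take t ks))" for t and u :: "nat \<Rightarrow> real"
  have sub: "set (take t ks) \<subseteq> {..k}" for t using ks set_take_subset[of t ks] by fastforce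
  have Rm: "R t \<in> borel_measurable (cube k)" for t
    unfolding R_def by (intro rpos_measurable sub measurable_cube_component) simp
  have upd: "map (u(k := y)) (take t ks) = map u (take t ks)" for u y t
  proof (rule map_cong[OF refl])
    fix i assume "i \<in> set (take t ks)"
    then have "i < k" using ks set_take_subset[of t ks] by blast
    then show "(u(k := y)) i = u i" by simp
  qed
  have Ry: "R t (u(k := y)) = rpos 0 (map u (take t ks)) + (-1) ^ min (length ks) t * y" for t u y
    unfolding R_def upd using rpos_start[of y "map u (take t ks)"] by simp
  have 1: "AE u in cube k. 2 * R t u \<notin> \<int>" for t
  proof (rule AE_cube_countable_section[of k])
    show "{u \<in> space (cube k). 2 * R t u \<in> \<int>} \<in> sets (cube k)"
      using Rm by (intro Ints_sets borel_measurable_times) auto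
    fix u :: "nat \<Rightarrow> real"
    have "{y. 2 * R t (u(k := y)) \<in> \<int>} = {y. 2 * rpos 0 (map u (take t ks)) + (2 * (-1) ^ min (length ks) t) * y \<in> \<int>}"
      unfolding Ry by (simp add: algebra_simps)
    then show "countable {y. 2 * R t (u(k := y)) \<in> \<int>}" by (simp only: countable_affine_Ints) (rule countable_affine_Ints, simp)
  qed simp
  have 2: "AE u in cube k. R t u - R (Suc t) u \<notin> \<int>" if t: "t < length ks" for t
  proof (rule AE_cube_countable_section[of k])
    show "{u \<in> space (cube k). R t u - R (Suc t) u \<in> \<int>} \<in> sets (cube k)"
      using Rm by (intro Ints_sets borel_measurable_diff) auto
    fix u :: "nat \<Rightarrow> real"
    have "{y. R t (u(k := y)) - R (Suc t) (u(k := y)) \<in> \<int>} =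
      {y. (rpos 0 (map u (take t ks)) - rpos 0 (map u (take (Suc t) ks))) + (2 * (-1) ^ t) * y \<in> \<int>}"
      unfolding Ry using t by (simp add: algebra_simps)
    then show "countable {y. R t (u(k := y)) - R (Suc t) (u(k := y)) \<in> \<int>}"
      by (simp only: countable_affine_Ints) (rule countable_affine_Ints, simp)
  qed simp
  have "AE u in cube k. (\<forall>t\<le>length ks. 2 * R t u \<notin> \<int>) \<and> (\<forall>t<length ks. R t u - R (Suc t) u \<notin> \<int>)"
  proof -
    have "AE u in cube k. \<forall>t\<in>{..length ks}. 2 * R t u \<notin> \<int>"
      by (rule AE_finite_allI) (simp_all add: 1)
    moreover have "AE u in cube k. \<forall>t\<in>{..<length ks}. R t u - R (Suc t) u \<notin> \<int>"
      by (rule AE_finite_allI) (simp_all add: 2)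
    ultimately show ?thesis by eventually_elim auto
  qed
  then show ?thesis
  proof (rule AE_mp, intro AE_I2 impI)
    fix u assume u: "u \<in> space (cube k)"
      and h: "(\<forall>t\<le>length ks. 2 * R t u \<notin> \<int>) \<and> (\<forall>t<length ks. R t u - R (Suc t) u \<notin> \<int>)"
    have "gen (frac (u k)) (map u ks)"
      using h by (intro genI) (auto simp: R_def take_map)
    moreover have "frac (u k) = u k" using u by (auto simp: space_cube frac_eq)
    ultimately show "gen (u k) (map u ks)" by simp
  qed
qed

lemma AE_distinct: "AE u in cube k. \<forall>i<k. \<forall>j<k. i \<noteq> j \<longrightarrow> u i \<noteq> u j"
proof -
  have "AE u in cube k. u i \<noteq> u j" if "i < k" "j < k" "i \<noteq> j" for i j
  proof (rule AE_cube_countable_section[of i])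
    show "{u \<in> space (cube k). u i = u j} \<in> sets (cube k)"
    proof -
      have [measurable]: "(\<lambda>u. u i) \<in> borel_measurable (cube k)" "(\<lambda>u. u j) \<in> borel_measurable (cube k)"
        using that by (auto intro: measurable_cube_component)
      show ?thesis by measurable
    qed
    show "countable {y. (u(i := y)) i = (u(i := y)) j}" for u
      using that by (auto intro: countable_finite)
  qed (use that in auto)
  then have "AE u in cube k. i \<noteq> j \<longrightarrow> u i \<noteq> u j" if "i < k" "j < k" for i j
    using that by (cases "i = j") auto
  then have "AE u in cube k. \<forall>i\<in>{..<k}. \<forall>j\<in>{..<k}. i \<noteq> j \<longrightarrow> u i \<noteq> u j"
    by (intro AE_finite_allI) auto
  then show ?thesis by (simp add: Ball_def)
qed

text \<open>The end point from start 0 is a linear form in the letters. If some letter has a nonzero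
  coefficient, then for fixed other letters only countably many values of it give an integer. This
  dichotomy decides whether a pattern contributes in the limit.\<close>

lemma closure_generic:
  assumes ks: "set ks \<subseteq> {..<k}"
  shows "(\<forall>u. rpos 0 (map u ks) = (0 :: real)) \<or> (AE u in cube k. rpos 0 (map u ks) \<notin> (\<int> :: real set))"
proof -
  define c :: "nat \<Rightarrow> real" where "c i = rpos 0 (map (\<lambda>j. if j = i then 1 else 0) ks)" for i
  have lin: "rpos 0 (map u ks) = (\<Sum>i<k. u i * c i)" for u :: "nat \<Rightarrow> real"
    using rpos_lincomb[of "{..<k}" ks u] ks by (simp add: c_def)
  show ?thesis
  proof (cases "\<forall>i<k. c i = 0")
    case True
    then show ?thesis by (simp add: lin)
  next
    case False
    then obtain i where i: "i < k" "c i \<noteq> 0" by auto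
    have "AE u in cube k. rpos 0 (map u ks) \<notin> (\<int> :: real set)"
    proof (rule AE_cube_countable_section[of i])
      show "{u \<in> space (cube k). rpos 0 (map u ks) \<in> (\<int> :: real set)} \<in> sets (cube k)"
        using ks by (intro Ints_sets rpos_measurable) auto
      fix u :: "nat \<Rightarrow> real"
      have "rpos 0 (map (u(i := y)) ks) = (\<Sum>j\<in>{..<k} - {i}. u j * c j) + c i * y" for y
        unfolding lin using i by (subst sum.remove[of _ i]) (auto intro!: sum.cong)
      then have "{y. rpos 0 (map (u(i := y)) ks) \<in> \<int>} = {y. (\<Sum>j\<in>{..<k} - {i}. u j * c j) + c i * y \<in> \<int>}" by simp
      then show "countable {y. rpos 0 (map (u(i := y)) ks) \<in> \<int>}" using i countable_affine_Ints[of "c i"] by simp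
    qed (use i in auto)
    then show ?thesis ..
  qed
qed

section \<open>Limits of the contributions of pair words\<close>

context weight
begin

text \<open>The part of the expected trace of the 2k-th power that comes from pair words. Each pair
  of equal letters has expectation 1, so no trace of the input law remains.\<close>

definition trace_main :: "nat \<Rightarrow> nat \<Rightarrow> complex" where
  "trace_main k N = (\<Sum>w\<in>pair_words k N. \<Sum>a<N. if fin N a w = a then wt \<phi> N a w else 0)"

text \<open>At a generic point of the cube the summands converge along the grids: distinct
  coordinates are eventually rounded to distinct letters, the closure condition is eventually
  constant by the dichotomy, and the weight is continuous along a walk in general position.\<close>

lemma pattern_sum_converges:
  assumes ks: "ks \<in> pair_words k k"
  shows "convergent (\<lambda>N. (\<Sum>v\<in>{..k} \<rightarrow>\<^sub>E {..<N}.
    if inj_on v {..<k} \<and> fin N (v k) (map v ks) = v k then wt \<phi> N (v k) (map v ks) else 0) / of_nat N ^ Suc k)"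
proof -
  have sub: "set ks \<subseteq> {..<k}" using set_pair_word[OF ks] by simp
  have len: "even (length ks)" using ks by (simp add: pair_words_def words_def)
  define G where "G N v = (if v \<in> {..k} \<rightarrow>\<^sub>E {..<N} \<and> inj_on v {..<k} \<and> fin N (v k) (map v ks) = v k
    then wt \<phi> N (v k) (map v ks) else 0)" for N and v :: "nat \<Rightarrow> nat"
  have "AE u in cube k. gen (u k) (map u ks)" by (rule AE_gen[OF sub])
  moreover have "AE u in cube k. \<forall>i<k. \<forall>j<k. i \<noteq> j \<longrightarrow> u i \<noteq> u j" by (rule AE_distinct)
  moreover have "AE u in cube k. (\<forall>u. rpos 0 (map u ks) = (0 :: real)) \<or> rpos 0 (map u ks) \<notin> (\<int> :: real set)"
    using closure_generic[OF sub] by auto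
  ultimately have conv: "AE u in cube k. convergent (\<lambda>n. G (Suc n) (grid (Suc n) k u))"
    using AE_space
  proof eventually_elim
    case (elim u)
    define g where "g n i = real (grid (Suc n) k u i) / real (Suc n)" for n i
    have g_eq: "g n = (\<lambda>i. real (grid (Suc n) k u i) / real (Suc n))" for n
      by (simp add: g_def fun_eq_iff)
    have gt: "(\<lambda>n. g n i) \<longlonglongrightarrow> u i" if "i \<le> k" for i
      unfolding g_def using grid_tendsto[OF elim(4) that] .
    have gin: "grid (Suc n) k u \<in> {..k} \<rightarrow>\<^sub>E {..<Suc n}" for n
      by (rule grid_in[OF elim(4)]) simp
    have lt: "grid (Suc n) k u k < Suc n" for n using gin[of n] by (auto simp: PiE_iff)
    have inj: "\<forall>\<^sub>F n in sequentially. inj_on (grid (Suc n) k u) {..<k}"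
    proof -
      have "\<forall>\<^sub>F n in sequentially. \<forall>i\<in>{..<k}. \<forall>j\<in>{..<k}. i \<noteq> j \<longrightarrow> g n i \<noteq> g n j"
      proof (intro eventually_ball_finite ballI finite_lessThan)
        fix i j assume ij: "i \<in> {..<k}" "j \<in> {..<k}"
        show "\<forall>\<^sub>F n in sequentially. i \<noteq> j \<longrightarrow> g n i \<noteq> g n j"
        proof (cases "i = j")
          case False
          then have "u i - u j \<noteq> 0" using elim(2) ij by auto
          moreover have "(\<lambda>n. g n i - g n j) \<longlonglongrightarrow> u i - u j" using gt ij by (intro tendsto_diff) auto
          ultimately have "\<forall>\<^sub>F n in sequentially. g n i - g n j \<noteq> 0" by (rule tendsto_imp_eventually_ne[rotated])
          then show ?thesis by eventually_elim auto
        qed simp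
      qed
      then show ?thesis
        by eventually_elim (auto simp: inj_on_def g_def)
    qed
    have closed: "(fin (Suc n) (grid (Suc n) k u k) (map (grid (Suc n) k u) ks) = grid (Suc n) k u k)
        \<longleftrightarrow> rpos 0 (map (g n) ks) \<in> \<int>" for n
    proof -
      have "(fin (Suc n) (grid (Suc n) k u k) (map (grid (Suc n) k u) ks) = grid (Suc n) k u k)
        \<longleftrightarrow> int (Suc n) dvd rpos 0 (map int (map (grid (Suc n) k u) ks))"
        using lt len by (intro fin_even_iff) auto
      also have "\<dots> \<longleftrightarrow> rpos 0 (map (g n) ks) \<in> \<int>"
        by (subst closed_iff_Ints) (simp_all add: comp_def g_eq del: of_nat_Suc)
      finally show ?thesis .
    qed
    have wtr: "wt \<phi> (Suc n) (grid (Suc n) k u k) (map (grid (Suc n) k u) ks) = wtr \<phi> (g n k) (map (g n) ks)" for n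
      using lt by (subst wt_wtr) (simp_all add: comp_def g_eq del: of_nat_Suc)
    have Geq: "\<forall>\<^sub>F n in sequentially. G (Suc n) (grid (Suc n) k u) =
        (if rpos 0 (map (g n) ks) \<in> \<int> then wtr \<phi> (g n k) (map (g n) ks) else 0)"
      using inj by eventually_elim (simp add: G_def gin closed wtr del: of_nat_Suc)
    from elim(3) show "convergent (\<lambda>n. G (Suc n) (grid (Suc n) k u))"
    proof
      assume z: "\<forall>u. rpos 0 (map u ks) = (0 :: real)"
      have "(\<lambda>n. wtr \<phi> (g n k) (map (g n) ks)) \<longlonglongrightarrow> wtr \<phi> (u k) (map u ks)"
        using gt sub elim(1) by (intro wtr_tendsto) auto
      moreover have "\<forall>\<^sub>F n in sequentially. G (Suc n) (grid (Suc n) k u) = wtr \<phi> (g n k) (map (g n) ks)"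
        using Geq by eventually_elim (simp add: z)
      ultimately show ?thesis by (intro convergentI) (rule Lim_transform_eventually, auto elim: eventually_mono)
    next
      \<comment> \<open>The complement of the integers is open, so on fine grids the walk does not
        close and the summands vanish.\<close>
      assume nz: "rpos 0 (map u ks) \<notin> (\<int> :: real set)"
      define c :: "nat \<Rightarrow> real" where "c i = rpos 0 (map (\<lambda>j. if j = i then 1 else 0) ks)" for i
      have r: "rpos 0 (map w ks) = (\<Sum>i<k. w i * c i)" for w :: "nat \<Rightarrow> real"
        using rpos_lincomb[of "{..<k}" ks w] sub by (simp add: c_def)
      have "(\<lambda>n. rpos 0 (map (g n) ks)) \<longlonglongrightarrow> rpos 0 (map u ks)"
        unfolding r using gt by (intro tendsto_sum tendsto_mult tendsto_const) auto
      moreover have "open (- (\<int> :: real set))" by (simp add: closed_Ints open_Compl)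
      ultimately have "\<forall>\<^sub>F n in sequentially. rpos 0 (map (g n) ks) \<in> - \<int>"
        using nz by (intro topological_tendstoD) auto
      with Geq have "\<forall>\<^sub>F n in sequentially. G (Suc n) (grid (Suc n) k u) = 0"
        by eventually_elim simp
      then show ?thesis by (intro convergentI tendsto_eventually)
    qed
  qed
  have "cmod (G N v) \<le> 1" for N v using wt_le_1[of \<phi>] bound by (simp add: G_def)
  then have "convergent (\<lambda>N. (\<Sum>v\<in>{..k} \<rightarrow>\<^sub>E {..<N}. G N v) / of_nat N ^ Suc k)"
    using conv by (rule riemann_sums_converge)
  also have "(\<lambda>N. (\<Sum>v\<in>{..k} \<rightarrow>\<^sub>E {..<N}. G N v) / of_nat N ^ Suc k) = (\<lambda>N. (\<Sum>v\<in>{..k} \<rightarrow>\<^sub>E {..<N}.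
    if inj_on v {..<k} \<and> fin N (v k) (map v ks) = v k then wt \<phi> N (v k) (map v ks) else 0) / of_nat N ^ Suc k)"
    by (intro ext arg_cong2[where f = "(/)"] sum.cong refl) (auto simp: G_def)
  finally show ?thesis .
qed

lemma trace_main_patterns:
  "of_nat (fact k) * trace_main k N = (\<Sum>ks\<in>pair_words k k. \<Sum>v\<in>{..k} \<rightarrow>\<^sub>E {..<N}.
    if inj_on v {..<k} \<and> fin N (v k) (map v ks) = v k then wt \<phi> N (v k) (map v ks) else 0)"
proof -
  define g where "g a w = (if fin N a w = a then wt \<phi> N a w else 0)" for a w
  have inner: "(\<Sum>v\<in>{..k} \<rightarrow>\<^sub>E {..<N}. if inj_on v {..<k} \<and> fin N (v k) (map v ks) = v k then wt \<phi> N (v k) (map v ks) else 0)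
    = (\<Sum>v\<in>{v \<in> {..<k} \<rightarrow>\<^sub>E {..<N}. inj_on v {..<k}}. \<Sum>a<N. g a (map v ks))"
    if ks: "ks \<in> pair_words k k" for ks
  proof -
    have sub: "set ks = {..<k}" by (rule set_pair_word[OF ks])
    have ins: "{..k} = insert k {..<k}" by auto
    \<comment> \<open>Coordinate k holds the start and splits off from the assignment of the
      letters.\<close>
    have bij: "({..k} \<rightarrow>\<^sub>E {..<N}) = (\<lambda>(a, v). v(k := a)) ` ({..<N} \<times> ({..<k} \<rightarrow>\<^sub>E {..<N}))"
      unfolding ins PiE_insert_eq ..
    have injc: "inj_on (\<lambda>(a, v). v(k := a)) ({..<N} \<times> ({..<k} \<rightarrow>\<^sub>E {..<N}))"
      by (rule inj_combinator) simp
    have upd: "map (v(k := a)) ks = map v ks" "inj_on (v(k := a)) {..<k} \<longleftrightarrow> inj_on v {..<k}" for v :: "nat \<Rightarrow> nat" and a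
      using sub by (auto simp: inj_on_def)
    have "(\<Sum>v\<in>{..k} \<rightarrow>\<^sub>E {..<N}. if inj_on v {..<k} \<and> fin N (v k) (map v ks) = v k then wt \<phi> N (v k) (map v ks) else 0)
      = (\<Sum>(a, v)\<in>{..<N} \<times> ({..<k} \<rightarrow>\<^sub>E {..<N}). if inj_on v {..<k} then g a (map v ks) else 0)"
      unfolding bij sum.reindex[OF injc] comp_def case_prod_beta upd
      by (rule sum.cong[OF refl]) (simp add: g_def)
    also have "\<dots> = (\<Sum>v\<in>{..<k} \<rightarrow>\<^sub>E {..<N}. if inj_on v {..<k} then (\<Sum>a<N. g a (map v ks)) else 0)"
      by (subst sum.cartesian_product[symmetric], subst sum.swap, rule sum.cong[OF refl]) simp
    also have "\<dots> = (\<Sum>v\<in>{v \<in> {..<k} \<rightarrow>\<^sub>E {..<N}. inj_on v {..<k}}. \<Sum>a<N. g a (map v ks))"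
      by (rule sum.inter_filter[symmetric]) (simp add: finite_PiE)
    finally show ?thesis .
  qed
  have "(\<Sum>ks\<in>pair_words k k. \<Sum>v\<in>{..k} \<rightarrow>\<^sub>E {..<N}.
    if inj_on v {..<k} \<and> fin N (v k) (map v ks) = v k then wt \<phi> N (v k) (map v ks) else 0)
    = (\<Sum>ks\<in>pair_words k k. \<Sum>v\<in>{v \<in> {..<k} \<rightarrow>\<^sub>E {..<N}. inj_on v {..<k}}. \<Sum>a<N. g a (map v ks))"
    by (rule sum.cong[OF refl], rule inner)
  also have "\<dots> = of_nat (fact k) * (\<Sum>w\<in>pair_words k N. \<Sum>a<N. g a w)" by (rule sum_pair_words)
  finally show ?thesis by (simp add: trace_main_def g_def)
qed

definition limit_moment :: "nat \<Rightarrow> complex" where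
  "limit_moment k = lim (\<lambda>N. trace_main k N / of_nat N ^ Suc k)"

lemma trace_main_tendsto: "(\<lambda>N. trace_main k N / of_nat N ^ Suc k) \<longlonglongrightarrow> limit_moment k"
proof -
  have "convergent (\<lambda>N. (\<Sum>ks\<in>pair_words k k. (\<Sum>v\<in>{..k} \<rightarrow>\<^sub>E {..<N}.
    if inj_on v {..<k} \<and> fin N (v k) (map v ks) = v k then wt \<phi> N (v k) (map v ks) else 0) / of_nat N ^ Suc k))"
    by (intro convergent_sum pattern_sum_converges)
  then have "convergent (\<lambda>N. inverse (of_nat (fact k)) * (of_nat (fact k) * trace_main k N / of_nat N ^ Suc k))"
    unfolding trace_main_patterns sum_divide_distrib by (rule convergent_mult[OF convergent_const])
  then have "convergent (\<lambda>N. trace_main k N / of_nat N ^ Suc k)" by (simp add: field_simps)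
  then show ?thesis unfolding limit_moment_def by (simp only: convergent_LIMSEQ_iff)
qed

lemma trace_main_bound: "cmod (trace_main k N / of_nat N ^ Suc k) \<le> fact (2 * k) / fact k"
proof (cases "N = 0")
  case False
  have "cmod (trace_main k N) \<le> (\<Sum>w\<in>pair_words k N. \<Sum>a<N. 1)"
    unfolding trace_main_def using wt_le_1[of \<phi>] bound by (intro sum_norm_le) auto
  also have "\<dots> = real (card (pair_words k N)) * real N" by simp
  finally have 1: "cmod (trace_main k N) \<le> real (card (pair_words k N)) * real N" .
  have "real (fact k * card (pair_words k N)) \<le> real (fact (2 * k) * N ^ k)"
    by (rule of_nat_mono[OF card_pair_words_bound])
  then have "real (card (pair_words k N)) \<le> fact (2 * k) / fact k * real N ^ k"
    by (simp add: field_simps)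
  from mult_right_mono[OF this, of "real N"]
  have "real (card (pair_words k N)) * real N \<le> fact (2 * k) / fact k * real N ^ Suc k"
    by (simp add: mult_ac)
  with 1 have "cmod (trace_main k N) \<le> fact (2 * k) / fact k * real N ^ Suc k" by linarith
  then show ?thesis using False by (simp add: norm_divide norm_mult norm_power pos_divide_le_eq)
qed simp

lemma limit_moment_bound: "cmod (limit_moment k) \<le> fact (2 * k) / fact k"
  by (rule LIMSEQ_le_const2[OF tendsto_norm[OF trace_main_tendsto]]) (use trace_main_bound in auto)

end

section \<open>Trace moments of random torus matrices\<close>

definition tmat :: "(real \<Rightarrow> real \<Rightarrow> complex) \<Rightarrow> nat \<Rightarrow> (nat \<Rightarrow> real) \<Rightarrow> nat \<Rightarrow> nat \<Rightarrow> complex" where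
  "tmat \<phi> N y i j = \<phi> (real i / real N) (real j / real N) * of_real (y ((i + j) mod N))"

text \<open>From a fixed vertex, the label of an edge and its far end determine each other modulo N.
  Thus the sum over intermediate vertices in a matrix power becomes a sum over label words.\<close>

lemma fpow_tmat:
  assumes "a < N"
  shows "fpow N (tmat \<phi> N y) p a b =
    (\<Sum>w\<in>words N p. if fin N a w = b then wt \<phi> N a w * of_real (prod_list (map y w)) else 0)"
  using assms
proof (induction p arbitrary: a)
  case (Suc p)
  let ?g = "\<lambda>a w. if fin N a w = b then wt \<phi> N a w * of_real (prod_list (map y w)) else 0"
  have fwd: "(a + stp N a l) mod N = l" if "l < N" for l
  proof -
    have "(a + stp N a l) mod N = (a + (l + (N - a))) mod N" by (simp add: stp_def mod_add_right_eq)
    also have "a + (l + (N - a)) = l + N" using Suc.prems by simp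
    finally show ?thesis using that by simp
  qed
  have forth: "stp N a ((a + k) mod N) = k" if "k < N" for k
  proof -
    have "stp N a ((a + k) mod N) = (a + k + (N - a)) mod N" by (simp add: stp_def mod_add_left_eq)
    also have "a + k + (N - a) = k + N" using Suc.prems by simp
    finally show ?thesis using that by simp
  qed
  have "fpow N (tmat \<phi> N y) (Suc p) a b = (\<Sum>k<N. tmat \<phi> N y a k * (\<Sum>w\<in>words N p. ?g k w))"
    using Suc.IH by simp
  also have "\<dots> = (\<Sum>l<N. tmat \<phi> N y a (stp N a l) * (\<Sum>w\<in>words N p. ?g (stp N a l) w))"
    using Suc.prems
    by (rule_tac sum.reindex_bij_witness[of _ "stp N a" "\<lambda>k. (a + k) mod N"]) (simp_all add: fwd forth cong: if_cong)
  also have "\<dots> = (\<Sum>l<N. \<Sum>w\<in>words N p. ?g a (l # w))"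
    by (rule sum.cong[OF refl]) (simp add: tmat_def fwd sum_distrib_left if_distrib mult_ac cong: if_cong)
  also have "\<dots> = (\<Sum>w\<in>words N (Suc p). ?g a w)" by (rule sum_words_Suc[symmetric])
  finally show ?case .
qed simp

text \<open>The total weight of the closed walks with label word w, that is, the coefficient of the
  monomial of w in the trace.\<close>

definition cw :: "(real \<Rightarrow> real \<Rightarrow> complex) \<Rightarrow> nat \<Rightarrow> nat list \<Rightarrow> complex" where
  "cw \<phi> N w = (\<Sum>a<N. if fin N a w = a then wt \<phi> N a w else 0)"

lemma trace_tmat:
  "(\<Sum>a<N. fpow N (tmat \<phi> N y) p a a) = (\<Sum>w\<in>words N p. cw \<phi> N w * of_real (prod_list (map y w)))"
proof -
  have "(\<Sum>a<N. fpow N (tmat \<phi> N y) p a a) = (\<Sum>a<N. \<Sum>w\<in>words N p.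
     (if fin N a w = a then wt \<phi> N a w else 0) * of_real (prod_list (map y w)))"
    by (rule sum.cong[OF refl], simp only: lessThan_iff fpow_tmat, rule sum.cong[OF refl]) simp
  also have "\<dots> = (\<Sum>w\<in>words N p. cw \<phi> N w * of_real (prod_list (map y w)))"
    unfolding cw_def sum_distrib_right by (rule sum.swap)
  finally show ?thesis .
qed

definition lists_over :: "'z set \<Rightarrow> nat \<Rightarrow> 'z list set" where
  "lists_over Z n = {zs. set zs \<subseteq> Z \<and> length zs = n}"

lemma finite_lists_over: "finite Z \<Longrightarrow> finite (lists_over Z n)"
  unfolding lists_over_def by (rule finite_lists_length_eq)

lemma sum_power_lists:
  fixes f :: "'z \<Rightarrow> 'b :: comm_semiring_1"
  assumes "finite Z"
  shows "(\<Sum>z\<in>Z. f z) ^ n = (\<Sum>zs\<in>lists_over Z n. \<Prod>z\<leftarrow>zs. f z)"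
proof (induction n)
  case 0
  have "lists_over Z 0 = {[]}" by (auto simp: lists_over_def)
  then show ?case by simp
next
  case (Suc n)
  have L: "lists_over Z (Suc n) = (\<lambda>(z, zs). z # zs) ` (Z \<times> lists_over Z n)"
    by (auto simp: lists_over_def length_Suc_conv image_iff)
  have "(\<Sum>zs\<in>lists_over Z (Suc n). \<Prod>z\<leftarrow>zs. f z) = (\<Sum>(z, zs)\<in>Z \<times> lists_over Z n. f z * (\<Prod>z\<leftarrow>zs. f z))"
    unfolding L by (subst sum.reindex) (auto simp: inj_on_def case_prod_beta)
  also have "\<dots> = (\<Sum>z\<in>Z. f z) * (\<Sum>zs\<in>lists_over Z n. \<Prod>z\<leftarrow>zs. f z)"
    by (simp add: sum_product sum.cartesian_product)
  finally show ?case using Suc by simp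
qed

lemma of_real_prod_list: "of_real (prod_list xs) = (prod_list (map of_real xs) :: complex)"
  by (induction xs) auto

lemma prod_list_mult: "(\<Prod>z\<leftarrow>zs. f z * g z) = (\<Prod>z\<leftarrow>zs. f z) * (\<Prod>z\<leftarrow>zs. g z :: 'b :: comm_monoid_mult)"
  by (induction zs) (auto simp: mult_ac)

lemma norm_prod_list_le:
  assumes "\<And>z. z \<in> set zs \<Longrightarrow> cmod (f z) \<le> c" "c \<ge> 0"
  shows "cmod (\<Prod>z\<leftarrow>zs. f z) \<le> c ^ length zs"
  using assms by (induction zs) (auto simp: norm_mult intro!: mult_mono)

locale hermitian_weight = weight +
  assumes herm: "\<phi> y x = cnj (\<phi> x y)"
begin

lemma tmat_herm: "tmat \<phi> N y i j = cnj (tmat \<phi> N y j i)"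
  unfolding tmat_def by (subst herm) (simp add: add.commute)

lemma cw_bound_even:
  assumes "even (length w)"
  shows "cmod (cw \<phi> N w) \<le> real N" "\<not> int N dvd rpos 0 (map int w) \<Longrightarrow> cw \<phi> N w = 0"
proof -
  have "cmod (cw \<phi> N w) \<le> (\<Sum>a<N. 1)"
    unfolding cw_def using wt_le_1[of \<phi>] bound by (intro sum_norm_le) auto
  then show "cmod (cw \<phi> N w) \<le> real N" by simp
  assume "\<not> int N dvd rpos 0 (map int w)"
  then show "cw \<phi> N w = 0"
    unfolding cw_def using fin_even_iff[OF _ assms] by (intro sum.neutral) auto
qed

lemma cw_bound_odd:
  assumes "odd (length w)"
  shows "cmod (cw \<phi> N w) \<le> 2"
proof -
  have "cw \<phi> N w = (\<Sum>a\<in>{a\<in>{..<N}. fin N a w = a}. wt \<phi> N a w)"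
    unfolding cw_def by (rule sum.inter_filter[symmetric]) simp
  also have "cmod \<dots> \<le> (\<Sum>a\<in>{a\<in>{..<N}. fin N a w = a}. 1)"
    using wt_le_1[of \<phi>] bound by (intro sum_norm_le) auto
  also have "\<dots> \<le> 2" using card_fin_odd[OF assms, of N] by simp
  finally show ?thesis .
qed

end

locale torus_model = moment_model + hermitian_weight +
  assumes Npos: "N > 0"
begin

text \<open>Powers of a Hermitian matrix have real trace; \<open>Re\<close> only changes the
  type.\<close>

definition tr :: "nat \<Rightarrow> 'a \<Rightarrow> real" where
  "tr p \<omega> = Re (\<Sum>a<N. fpow N (tmat \<phi> N (\<lambda>c. y c \<omega>)) p a a)"

lemma of_real_tr: "of_real (tr p \<omega>) = (\<Sum>w\<in>words N p. cw \<phi> N w * of_real (wprod y w \<omega>))"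
proof -
  define T where "T = tmat \<phi> N (\<lambda>c. y c \<omega>)"
  have "T i j = cnj (T j i)" for i j unfolding T_def by (rule tmat_herm)
  then have "\<exists>u d. eigensystem N T u d" by (rule hermitian_eigensystem[where M = T and n = N]) blast
  then obtain u d where "eigensystem N (tmat \<phi> N (\<lambda>c. y c \<omega>)) u d" unfolding T_def by blast
  from eigensystem_trace[OF this, of p]
  have "of_real (tr p \<omega>) = (\<Sum>a<N. fpow N (tmat \<phi> N (\<lambda>c. y c \<omega>)) p a a)" by (simp add: tr_def)
  then show ?thesis by (simp add: trace_tmat wprod_def)
qed

lemma words_sub: "w \<in> words N p \<Longrightarrow> set w \<subseteq> {..<N}"
  by (simp add: words_def)

definition trE :: "nat \<Rightarrow> real" where
  "trE p = expectation (tr p)"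

lemma integrable_tr: "integrable M (tr p)" and of_real_trE: "of_real (trE p) = (\<Sum>w\<in>words N p. cw \<phi> N w * of_real (ew N mom w))"
proof -
  have i: "integrable M (\<lambda>\<omega>. \<Sum>w\<in>words N p. cw \<phi> N w * complex_of_real (wprod y w \<omega>))"
    using wprod_expectation(1) words_sub
    by (intro Bochner_Integration.integrable_sum integrable_mult_right integrable_of_real) auto
  then have "integrable M (\<lambda>\<omega>. Re (complex_of_real (tr p \<omega>)))"
    unfolding of_real_tr by (rule integrable_Re)
  then show it: "integrable M (tr p)" by simp
  have "complex_of_real (trE p) = (\<integral>\<omega>. complex_of_real (tr p \<omega>) \<partial>M)" by (simp add: trE_def)
  also have "\<dots> = (\<Sum>w\<in>words N p. cw \<phi> N w * of_real (ew N mom w))"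
    unfolding of_real_tr using wprod_expectation words_sub
    by (subst Bochner_Integration.integral_sum)
       (auto intro!: sum.cong integrable_mult_right integrable_of_real)
  finally show "of_real (trE p) = (\<Sum>w\<in>words N p. cw \<phi> N w * of_real (ew N mom w))" .
qed

text \<open>The fourth power expands into quadruples of words, of which only closed good quadruples
  survive; each carries at most \<open>N ^ 4\<close> choices of starts. After division by the fourth
  power of \<open>n ^ (p / 2 + 1)\<close> the bound is of order n^-2.\<close>

lemma fourth_moment:
  assumes p: "even p" and B: "\<And>a k. a < N \<Longrightarrow> k \<le> 4 * p \<Longrightarrow> \<bar>mom a k\<bar> \<le> B" and B1: "B \<ge> 1"
  shows "integrable M (\<lambda>\<omega>. (tr p \<omega> - trE p) ^ 4)"
    "expectation (\<lambda>\<omega>. (tr p \<omega> - trE p) ^ 4)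
      \<le> real (\<Sum>b\<le>2*p. (b ^ p) ^ 4) * (16 * B ^ (4 * p)) * real N ^ 4 * real N ^ (2 * p - 2)"
proof -
  let ?L = "lists_over (words N p) 4"
  define X where "X zs \<omega> = (\<Prod>z\<leftarrow>zs. wprod y z \<omega> - ew N mom z)" for zs \<omega>
  have finL: "finite ?L" by (rule finite_lists_over) simp
  have L: "set z \<subseteq> {..<N}" "length z = p" if "zs \<in> ?L" "z \<in> set zs" for zs z
    using that by (auto simp: lists_over_def words_def)
  have len: "length zs = 4" if "zs \<in> ?L" for zs using that by (simp add: lists_over_def)
  have Xi: "integrable M (X zs)" and XE: "expectation (X zs) = centred N mom [] zs" if "zs \<in> ?L" for zs
    using centred_expectation[of "[]" zs] L(1)[OF that] unfolding X_def by (auto simp: wprod_def)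
  have eq: "of_real ((tr p \<omega> - trE p) ^ 4) = (\<Sum>zs\<in>?L. (\<Prod>z\<leftarrow>zs. cw \<phi> N z) * complex_of_real (X zs \<omega>))" for \<omega>
  proof -
    have "of_real (tr p \<omega> - trE p) = (\<Sum>w\<in>words N p. cw \<phi> N w * of_real (wprod y w \<omega> - ew N mom w))"
      by (simp only: of_real_diff of_real_tr of_real_trE right_diff_distrib sum_subtractf)
    then have "of_real ((tr p \<omega> - trE p) ^ 4) = (\<Sum>w\<in>words N p. cw \<phi> N w * complex_of_real (wprod y w \<omega> - ew N mom w)) ^ 4"
      by (simp only: of_real_power)
    also have "\<dots> = (\<Sum>zs\<in>?L. \<Prod>z\<leftarrow>zs. cw \<phi> N z * of_real (wprod y z \<omega> - ew N mom z))"
      by (rule sum_power_lists) simp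
    also have "\<dots> = (\<Sum>zs\<in>?L. (\<Prod>z\<leftarrow>zs. cw \<phi> N z) * of_real (X zs \<omega>))"
      by (simp add: X_def prod_list_mult of_real_prod_list comp_def)
    finally show ?thesis .
  qed
  have int: "integrable M (\<lambda>\<omega>. \<Sum>zs\<in>?L. (\<Prod>z\<leftarrow>zs. cw \<phi> N z) * complex_of_real (X zs \<omega>))"
    using Xi by (intro Bochner_Integration.integrable_sum integrable_mult_right integrable_of_real) auto
  then have "integrable M (\<lambda>\<omega>. Re (complex_of_real ((tr p \<omega> - trE p) ^ 4)))"
    unfolding eq by (rule integrable_Re)
  then show "integrable M (\<lambda>\<omega>. (tr p \<omega> - trE p) ^ 4)" by simp
  define Q where "Q = {zs. good_quad p zs \<and> (\<forall>z\<in>set zs. z \<in> words N p \<and> int N dvd rpos 0 (map int z))}"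
  have QL: "Q \<subseteq> ?L" by (auto simp: Q_def good_quad_def lists_over_def)
  \<comment> \<open>A word that closes from no start has \<open>cw\<close> equal to 0, and a
    quadruple that is not good has centred expectation 0.\<close>
  have zero: "(\<Prod>z\<leftarrow>zs. cw \<phi> N z) * complex_of_real (centred N mom [] zs) = 0" if zs: "zs \<in> ?L" "zs \<notin> Q" for zs
  proof (rule ccontr)
    assume nz: "\<not> ?thesis"
    then have c: "centred N mom [] zs \<noteq> 0" and w: "(\<Prod>z\<leftarrow>zs. cw \<phi> N z) \<noteq> 0" by auto
    have "int N dvd rpos 0 (map int z)" if z: "z \<in> set zs" for z
    proof (rule ccontr)
      assume "\<not> ?thesis"
      then have "cw \<phi> N z = 0" using cw_bound_even(2)[of z N] L(2)[OF zs(1) z] p by simp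
      with w z show False by (auto simp: prod_list_zero_iff)
    qed
    moreover have "good_quad p zs"
      using centred_nonzero[OF c] L[OF zs(1)] len[OF zs(1)] unfolding good_quad_def by auto
    moreover have "z \<in> words N p" if "z \<in> set zs" for z using zs that by (auto simp: lists_over_def)
    ultimately have "zs \<in> Q" by (simp add: Q_def)
    with zs show False by simp
  qed
  have "complex_of_real (expectation (\<lambda>\<omega>. (tr p \<omega> - trE p) ^ 4)) = (\<integral>\<omega>. complex_of_real ((tr p \<omega> - trE p) ^ 4) \<partial>M)"
    by (rule integral_complex_of_real[symmetric])
  also have "\<dots> = (\<Sum>zs\<in>?L. (\<Prod>z\<leftarrow>zs. cw \<phi> N z) * complex_of_real (centred N mom [] zs))"
    unfolding eq using Xi XE
    by (subst Bochner_Integration.integral_sum)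
       (auto intro!: sum.cong integrable_mult_right integrable_of_real)
  also have "\<dots> = (\<Sum>zs\<in>Q. (\<Prod>z\<leftarrow>zs. cw \<phi> N z) * complex_of_real (centred N mom [] zs))"
    using zero finL QL by (intro sum.mono_neutral_right) auto
  finally have E: "complex_of_real (expectation (\<lambda>\<omega>. (tr p \<omega> - trE p) ^ 4))
    = (\<Sum>zs\<in>Q. (\<Prod>z\<leftarrow>zs. cw \<phi> N z) * complex_of_real (centred N mom [] zs))" .
  have "expectation (\<lambda>\<omega>. (tr p \<omega> - trE p) ^ 4) \<le> cmod (complex_of_real (expectation (\<lambda>\<omega>. (tr p \<omega> - trE p) ^ 4)))"
    by (simp only: norm_of_real abs_ge_self)
  also have "\<dots> \<le> (\<Sum>zs\<in>Q. real N ^ 4 * (16 * B ^ (4 * p)))"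
    unfolding E
  proof (rule sum_norm_le)
    fix zs assume "zs \<in> Q"
    then have zs: "zs \<in> ?L" using QL by auto
    have "cmod (\<Prod>z\<leftarrow>zs. cw \<phi> N z) \<le> real N ^ length zs"
      using L[OF zs] p by (intro norm_prod_list_le cw_bound_even) auto
    then have 1: "cmod (\<Prod>z\<leftarrow>zs. cw \<phi> N z) \<le> real N ^ 4" using len[OF zs] by simp
    have lc: "length (concat zs) = 4 * p"
    proof -
      have "length (concat zs) = (\<Sum>z\<leftarrow>zs. p)"
        unfolding length_concat by (rule arg_cong[where f = sum_list], rule map_cong) (use L[OF zs] in auto)
      then show ?thesis using len[OF zs] by (simp add: sum_list_triv)
    qed
    have "\<bar>centred N mom [] zs\<bar> \<le> 2 ^ length zs * B ^ length ([] @ concat zs)"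
      using B B1 lc by (intro centred_bound) auto
    then have 2: "\<bar>centred N mom [] zs\<bar> \<le> 16 * B ^ (4 * p)" using len[OF zs] lc by simp
    show "cmod ((\<Prod>z\<leftarrow>zs. cw \<phi> N z) * complex_of_real (centred N mom [] zs)) \<le> real N ^ 4 * (16 * B ^ (4 * p))"
      unfolding norm_mult norm_of_real by (intro mult_mono 1 2) auto
  qed
  also have "\<dots> = real (card Q) * (real N ^ 4 * (16 * B ^ (4 * p)))" by simp
  also have "\<dots> \<le> real ((\<Sum>b\<le>2*p. (b ^ p) ^ 4) * N ^ (2 * p - 2)) * (real N ^ 4 * (16 * B ^ (4 * p)))"
    using card_good_quads[OF Npos, of p] B1 unfolding Q_def
    by (intro mult_right_mono of_nat_mono) auto
  finally show "expectation (\<lambda>\<omega>. (tr p \<omega> - trE p) ^ 4)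
      \<le> real (\<Sum>b\<le>2*p. (b ^ p) ^ 4) * (16 * B ^ (4 * p)) * real N ^ 4 * real N ^ (2 * p - 2)"
    by (simp add: mult_ac)
qed

text \<open>An odd word closes from at most two starts, so the two traces lose a factor
  \<open>N ^ 2\<close> against the trivial bound. Without any centring the normalised second moment
  is thus of order n^-2.\<close>

lemma second_moment_odd:
  assumes p: "odd p" and B: "\<And>a k. a < N \<Longrightarrow> k \<le> 2 * p \<Longrightarrow> \<bar>mom a k\<bar> \<le> B" and B1: "B \<ge> 1"
  shows "integrable M (\<lambda>\<omega>. (tr p \<omega>) ^ 2)"
    "expectation (\<lambda>\<omega>. (tr p \<omega>) ^ 2) \<le> real (p ^ (2 * p)) * (4 * B ^ (2 * p)) * real N ^ p"
proof -
  let ?L = "words N p \<times> words N p"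
  have eq: "of_real ((tr p \<omega>) ^ 2) = (\<Sum>(v, w)\<in>?L. (cw \<phi> N v * cw \<phi> N w) * complex_of_real (wprod y (v @ w) \<omega>))" for \<omega>
    by (simp add: of_real_tr power2_eq_square sum_product sum.cartesian_product wprod_append mult_ac)
  have i: "integrable M (wprod y (v @ w))" "expectation (wprod y (v @ w)) = ew N mom (v @ w)"
    if "v \<in> words N p" "w \<in> words N p" for v w
    using that by (auto intro!: wprod_expectation simp: words_def)
  have int: "integrable M (\<lambda>\<omega>. \<Sum>(v, w)\<in>?L. (cw \<phi> N v * cw \<phi> N w) * complex_of_real (wprod y (v @ w) \<omega>))"
    unfolding case_prod_beta using i
    by (intro Bochner_Integration.integrable_sum integrable_mult_right integrable_of_real) auto
  then have "integrable M (\<lambda>\<omega>. Re (complex_of_real ((tr p \<omega>) ^ 2)))"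
    unfolding eq by (rule integrable_Re)
  then show "integrable M (\<lambda>\<omega>. (tr p \<omega>) ^ 2)" by simp
  define Q where "Q = {vw \<in> ?L. \<forall>a. count_list (fst vw @ snd vw) a \<noteq> 1}"
  have finQ: "finite Q" unfolding Q_def by (rule finite_subset[of _ ?L]) auto
  have "complex_of_real (expectation (\<lambda>\<omega>. (tr p \<omega>) ^ 2)) = (\<integral>\<omega>. complex_of_real ((tr p \<omega>) ^ 2) \<partial>M)"
    by (rule integral_complex_of_real[symmetric])
  also have "\<dots> = (\<Sum>(v, w)\<in>?L. (cw \<phi> N v * cw \<phi> N w) * complex_of_real (ew N mom (v @ w)))"
    unfolding eq case_prod_beta using i
    by (subst Bochner_Integration.integral_sum)
       (auto intro!: sum.cong integrable_mult_right integrable_of_real)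
  also have "\<dots> = (\<Sum>(v, w)\<in>Q. (cw \<phi> N v * cw \<phi> N w) * complex_of_real (ew N mom (v @ w)))"
  proof (rule sum.mono_neutral_right)
    show "\<forall>vw\<in>?L - Q. (case vw of (v, w) \<Rightarrow> (cw \<phi> N v * cw \<phi> N w) * complex_of_real (ew N mom (v @ w))) = 0"
    proof
      fix vw assume vw: "vw \<in> ?L - Q"
      then obtain a where a: "count_list (fst vw @ snd vw) a = 1" by (auto simp: Q_def)
      then have "a \<in> set (fst vw @ snd vw)" by (metis count_list_0_iff zero_neq_one)
      then have "a < N" using vw by (auto simp: words_def)
      then have "ew N mom (fst vw @ snd vw) = 0" using a by (rule ew_single)
      then show "(case vw of (v, w) \<Rightarrow> (cw \<phi> N v * cw \<phi> N w) * complex_of_real (ew N mom (v @ w))) = 0"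
        by (simp add: case_prod_beta)
    qed
  qed (auto simp: Q_def)
  finally have E: "complex_of_real (expectation (\<lambda>\<omega>. (tr p \<omega>) ^ 2))
    = (\<Sum>(v, w)\<in>Q. (cw \<phi> N v * cw \<phi> N w) * complex_of_real (ew N mom (v @ w)))" .
  \<comment> \<open>Concatenated, v and w form a word of length \<open>2 * p\<close> in which no
    letter occurs exactly once, hence with at most p letters.\<close>
  have cardQ: "card Q \<le> p ^ (2 * p) * N ^ p"
  proof -
    have "inj_on (\<lambda>(v, w). v @ w) Q" by (auto simp: inj_on_def Q_def words_def)
    then have "card Q = card ((\<lambda>(v, w). v @ w) ` Q)" by (simp add: card_image)
    also have "\<dots> \<le> card {w \<in> words N (2 * p). card (set w) \<le> p}"
    proof (intro card_mono image_subsetI)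
      fix vw assume vw: "vw \<in> Q"
      then have "2 * card (set (fst vw @ snd vw)) \<le> length (fst vw @ snd vw)"
        by (intro card_set_le_half) (auto simp: Q_def)
      moreover have "fst vw @ snd vw \<in> words N (2 * p)" using vw by (auto simp: Q_def words_def)
      ultimately show "(case vw of (v, w) \<Rightarrow> v @ w) \<in> {w \<in> words N (2 * p). card (set w) \<le> p}"
        by (simp add: words_def case_prod_beta)
    qed simp
    also have "\<dots> \<le> p ^ (2 * p) * N ^ p" by (rule card_few_letters[OF Npos])
    finally show ?thesis .
  qed
  have "expectation (\<lambda>\<omega>. (tr p \<omega>) ^ 2) \<le> cmod (complex_of_real (expectation (\<lambda>\<omega>. (tr p \<omega>) ^ 2)))"
    by (simp only: norm_of_real abs_ge_self)
  also have "\<dots> \<le> (\<Sum>vw\<in>Q. (2 * 2) * B ^ (2 * p))"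
    unfolding E
  proof (rule sum_norm_le)
    fix vw assume vw: "vw \<in> Q"
    obtain v w where vw': "vw = (v, w)" by (cases vw)
    have l: "length v = p" "length w = p" using vw vw' by (auto simp: Q_def words_def)
    have "\<bar>ew N mom (v @ w)\<bar> \<le> B ^ length (v @ w)" using B B1 l by (intro ew_bound) auto
    then have 1: "\<bar>ew N mom (v @ w)\<bar> \<le> B ^ (2 * p)" using l by (simp add: mult_2)
    show "cmod (case vw of (v, w) \<Rightarrow> (cw \<phi> N v * cw \<phi> N w) * complex_of_real (ew N mom (v @ w))) \<le> (2 * 2) * B ^ (2 * p)"
      unfolding vw' prod.case norm_mult norm_of_real using l p by (intro mult_mono 1 cw_bound_odd) auto
  qed
  also have "\<dots> = real (card Q) * (4 * B ^ (2 * p))" by simp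
  also have "\<dots> \<le> real (p ^ (2 * p) * N ^ p) * (4 * B ^ (2 * p))"
    using cardQ B1 by (intro mult_right_mono of_nat_mono) auto
  finally show "expectation (\<lambda>\<omega>. (tr p \<omega>) ^ 2) \<le> real (p ^ (2 * p)) * (4 * B ^ (2 * p)) * real N ^ p"
    by (simp add: mult_ac)
qed

text \<open>Apart from pair words, a word with nonzero expectation has a letter occurring at least
  three times, hence at most k - 1 letters. Together with the start this gives order
  \<open>N ^ k\<close>, one power below the main term.\<close>

lemma mean_even:
  assumes k: "k \<ge> 1" and B: "\<And>a j. a < N \<Longrightarrow> j \<le> 2 * k \<Longrightarrow> \<bar>mom a j\<bar> \<le> B" and B1: "B \<ge> 1"
  shows "cmod (of_real (trE (2 * k)) - trace_main k N) \<le> real (k ^ (2 * k)) * B ^ (2 * k) * real N ^ k"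
proof -
  define Q where "Q = {w \<in> words N (2 * k). (\<forall>a. count_list w a \<noteq> 1)}"
  have PQ: "pair_words k N \<subseteq> Q"
  proof
    fix w assume w: "w \<in> pair_words k N"
    have "count_list w a \<noteq> 1" for a
      using w by (cases "a \<in> set w") (auto simp: pair_words_def count_list_0_iff)
    then show "w \<in> Q" using w by (auto simp: Q_def pair_words_def)
  qed
  have "complex_of_real (trE (2 * k)) = (\<Sum>w\<in>Q. cw \<phi> N w * of_real (ew N mom w))"
    unfolding of_real_trE
  proof (rule sum.mono_neutral_right)
    show "\<forall>w\<in>words N (2 * k) - Q. cw \<phi> N w * complex_of_real (ew N mom w) = 0"
    proof
      fix w assume w: "w \<in> words N (2 * k) - Q"
      then obtain a where a: "count_list w a = 1" by (auto simp: Q_def)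
      then have "a \<in> set w" by (metis count_list_0_iff zero_neq_one)
      then have "a < N" using w by (auto simp: words_def)
      then have "ew N mom w = 0" using a by (rule ew_single)
      then show "cw \<phi> N w * complex_of_real (ew N mom w) = 0" by simp
    qed
  qed (auto simp: Q_def)
  also have "\<dots> = (\<Sum>w\<in>Q - pair_words k N. cw \<phi> N w * of_real (ew N mom w))
      + (\<Sum>w\<in>pair_words k N. cw \<phi> N w * of_real (ew N mom w))"
    by (rule sum.subset_diff[OF PQ]) (simp add: Q_def)
  also have "(\<Sum>w\<in>pair_words k N. cw \<phi> N w * of_real (ew N mom w)) = trace_main k N"
    unfolding trace_main_def by (rule sum.cong[OF refl]) (simp add: cw_def ew_pairs pair_words_def)
  finally have "cmod (of_real (trE (2 * k)) - trace_main k N)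
      = cmod (\<Sum>w\<in>Q - pair_words k N. cw \<phi> N w * of_real (ew N mom w))" by simp
  also have "\<dots> \<le> (\<Sum>w\<in>Q - pair_words k N. real N * B ^ (2 * k))"
  proof (rule sum_norm_le)
    fix w assume "w \<in> Q - pair_words k N"
    then have l: "length w = 2 * k" by (simp add: Q_def words_def)
    then have "\<bar>ew N mom w\<bar> \<le> B ^ (2 * k)" using ew_bound[of w B] B B1 by simp
    then show "cmod (cw \<phi> N w * complex_of_real (ew N mom w)) \<le> real N * B ^ (2 * k)"
      unfolding norm_mult norm_of_real using l by (intro mult_mono cw_bound_even) auto
  qed
  also have "\<dots> = real (card (Q - pair_words k N)) * (real N * B ^ (2 * k))" by simp
  also have "\<dots> \<le> real (k ^ (2 * k) * N ^ (k - 1)) * (real N * B ^ (2 * k))"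
  proof (intro mult_right_mono of_nat_mono)
    have "Q - pair_words k N \<subseteq> {w \<in> words N (2 * k). card (set w) \<le> k - 1}"
    proof
      fix w assume w: "w \<in> Q - pair_words k N"
      then have len: "length w = 2 * k" and c1: "\<And>a. count_list w a \<noteq> 1" by (auto simp: Q_def words_def)
      have c2: "count_list w a \<ge> 2" if "a \<in> set w" for a
        using c1[of a] that count_list_0_iff[of w a] by linarith
      obtain a where a: "a \<in> set w" "count_list w a \<noteq> 2" using w by (auto simp: Q_def pair_words_def)
      have "(\<Sum>b\<in>set w. 2) < (\<Sum>b\<in>set w. count_list w b)"
        using a c2 by (intro sum_strict_mono_ex1) (auto simp: le_less)
      then have "2 * card (set w) < 2 * k" using length_eq_sum_count[of w "set w"] len by simp
      then show "w \<in> {w \<in> words N (2 * k). card (set w) \<le> k - 1}" using w by (auto simp: Q_def)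
    qed
    then have "card (Q - pair_words k N) \<le> card {w \<in> words N (2 * k). card (set w) \<le> k - 1}"
      by (intro card_mono) auto
    also have "\<dots> \<le> (k - 1) ^ (2 * k) * N ^ (k - 1)" by (rule card_few_letters[OF Npos])
    also have "\<dots> \<le> k ^ (2 * k) * N ^ (k - 1)" by (intro mult_right_mono power_mono) auto
    finally show "card (Q - pair_words k N) \<le> k ^ (2 * k) * N ^ (k - 1)" .
  qed (use B1 in auto)
  also have "\<dots> = real (k ^ (2 * k)) * B ^ (2 * k) * (real N ^ (k - 1) * real N)" by simp
  also have "real N ^ (k - 1) * real N = real N ^ k" using k by (metis One_nat_def Suc_pred less_eq_Suc_le mult.commute power_Suc)
  finally show ?thesis .
qed

end

section \<open>Convergence of moments and characteristic functions\<close>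

text \<open>The sum of the variables has finite expectation, so it is almost surely finite and its
  terms tend to 0.\<close>

lemma AE_tendsto_0_if_summable_expectation:
  fixes X :: "nat \<Rightarrow> 'a \<Rightarrow> real"
  assumes int: "\<And>n. integrable M (X n)" and nn: "\<And>n \<omega>. X n \<omega> \<ge> 0"
    and le: "\<And>n. (\<integral>\<omega>. X n \<omega> \<partial>M) \<le> c n" and c: "summable c"
  shows "AE \<omega> in M. (\<lambda>n. X n \<omega>) \<longlonglongrightarrow> 0"
proof -
  have c0: "c n \<ge> 0" for n
    using le[of n] Bochner_Integration.integral_nonneg[of M "X n"] nn by (meson order_trans)
  have "(\<integral>\<^sup>+\<omega>. (\<Sum>n. ennreal (X n \<omega>)) \<partial>M) = (\<Sum>n. \<integral>\<^sup>+\<omega>. ennreal (X n \<omega>) \<partial>M)"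
    using int by (intro nn_integral_suminf) auto
  also have "\<dots> = (\<Sum>n. ennreal (\<integral>\<omega>. X n \<omega> \<partial>M))"
    using int nn by (intro suminf_cong nn_integral_eq_integral) auto
  also have "\<dots> \<le> (\<Sum>n. ennreal (c n))"
    using le by (intro suminf_le ennreal_leI) auto
  also have "\<dots> = ennreal (suminf c)" by (rule suminf_ennreal2[OF c0 c])
  finally have "(\<integral>\<^sup>+\<omega>. (\<Sum>n. ennreal (X n \<omega>)) \<partial>M) \<noteq> \<infinity>" by (auto simp: top_unique)
  then have "AE \<omega> in M. (\<Sum>n. ennreal (X n \<omega>)) \<noteq> \<infinity>"
    using int by (intro nn_integral_PInf_AE) auto
  then show ?thesis
  proof eventually_elim
    case (elim \<omega>)
    then have "summable (\<lambda>n. X n \<omega>)" using nn by (intro summable_suminf_not_top) auto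
    then show ?case by (rule summable_LIMSEQ_zero)
  qed
qed

section \<open>Empirical measures and their characteristic functions\<close>

definition emp :: "nat \<Rightarrow> (nat \<Rightarrow> real) \<Rightarrow> real measure" where
  "emp n e = distr (measure_pmf (pmf_of_set {..<n})) borel e"

lemma real_distribution_emp: "real_distribution (emp n e)"
  unfolding emp_def by (rule prob_space.real_distribution_distr[OF measure_pmf.prob_space_axioms]) simp

text \<open>For n = 0 the uniform distribution on the empty set is unspecified; this is the reason
  for \<open>n > 0\<close> here and for the shift to \<open>Suc n\<close> in the limits
  below.\<close>

lemma cdf_emp: "n > 0 \<Longrightarrow> cdf (emp n e) t = real (card {k. k < n \<and> e k \<le> t}) / real n"
proof -
  assume n: "n > 0"
  have "cdf (emp n e) t = measure (measure_pmf (pmf_of_set {..<n})) {k. e k \<le> t}"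
    unfolding cdf_def emp_def by (subst measure_distr) (auto simp: vimage_def)
  also have "\<dots> = real (card ({..<n} \<inter> {k. e k \<le> t})) / real n"
    using n by (subst measure_pmf_of_set) auto
  also have "{..<n} \<inter> {k. e k \<le> t} = {k. k < n \<and> e k \<le> t}" by auto
  finally show ?thesis .
qed

lemma integral_emp:
  fixes f :: "real \<Rightarrow> 'b :: {banach, second_countable_topology}"
  assumes n: "n > 0" and f: "f \<in> borel_measurable borel"
  shows "(\<integral>x. f x \<partial>emp n e) = (1 / real n) *\<^sub>R (\<Sum>k<n. f (e k))"
proof -
  have "(\<integral>x. f x \<partial>emp n e) = measure_pmf.expectation (pmf_of_set {..<n}) (\<lambda>k. f (e k))"
    unfolding emp_def using f by (subst integral_distr) auto
  also have "\<dots> = (\<Sum>k<n. pmf (pmf_of_set {..<n}) k *\<^sub>R f (e k))"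
    using n set_pmf_of_set[of "{..<n}"] by (intro integral_measure_pmf) (auto simp: lessThan_empty_iff)
  also have "\<dots> = (1 / real n) *\<^sub>R (\<Sum>k<n. f (e k))"
    using n pmf_of_set[of "{..<n}"] unfolding scaleR_sum_right
    by (intro sum.cong refl) (auto simp: lessThan_empty_iff)
  finally show ?thesis .
qed

definition emp_char :: "nat \<Rightarrow> (nat \<Rightarrow> real) \<Rightarrow> real \<Rightarrow> complex" where
  "emp_char n e t = (\<Sum>k<n. iexp (t * e k)) / of_nat n"

lemma char_emp: "n > 0 \<Longrightarrow> char (emp n e) t = emp_char n e t"
  unfolding char_def emp_char_def by (subst integral_emp) (auto simp: scaleR_conv_of_real)

lemma iexp_lipschitz: "cmod (iexp (t * x) - iexp (t * y)) \<le> \<bar>t\<bar> * \<bar>x - y\<bar>"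
proof -
  have "iexp (t * x) = iexp (t * y) * iexp (t * (x - y))"
    unfolding exp_add[symmetric] by (rule arg_cong[where f = exp]) (simp add: algebra_simps)
  then have "iexp (t * x) - iexp (t * y) = iexp (t * y) * (iexp (t * (x - y)) - 1)"
    by (simp only: right_diff_distrib mult_1_right)
  then have "cmod (iexp (t * x) - iexp (t * y)) = cmod (iexp (t * (x - y)) - 1)"
    by (simp add: norm_mult)
  also have "\<dots> \<le> \<bar>t * (x - y)\<bar>" using iexp_approx1[of "t * (x - y)" 0] by simp
  finally show ?thesis by (simp add: abs_mult)
qed

text \<open>Stopping at the odd degree \<open>2 * J + 1\<close> makes the Taylor remainder an even
  power, which even moments control without absolute values.\<close>

definition char_poly_sum :: "(nat \<Rightarrow> real) \<Rightarrow> real \<Rightarrow> nat \<Rightarrow> complex" where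
  "char_poly_sum m t J = (\<Sum>p\<le>2 * J + 1. (\<i> * of_real t) ^ p * of_real (m p) / fact p)"

definition char_of_moments :: "(nat \<Rightarrow> real) \<Rightarrow> real \<Rightarrow> complex" where
  "char_of_moments m t = lim (char_poly_sum m t)"

text \<open>Any two approximants are close to a common late term of c, so S is Cauchy, and c follows
  its limit. The scheme is used for Taylor polynomials and, with constant S, for truncation.\<close>

lemma approx_scheme:
  fixes c S :: "nat \<Rightarrow> complex"
  assumes ev: "\<And>J. \<forall>\<^sub>F n in sequentially. cmod (c n - S J) \<le> e J" and e: "e \<longlonglongrightarrow> 0"
  shows "convergent S" "c \<longlonglongrightarrow> lim S"
proof -
  have SJ: "cmod (S J - S K) \<le> e J + e K" for J K
  proof -
    have "\<forall>\<^sub>F n in sequentially. cmod (c n - S J) \<le> e J \<and> cmod (c n - S K) \<le> e K"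
      using ev[of J] ev[of K] by eventually_elim auto
    then obtain n where "cmod (c n - S J) \<le> e J" "cmod (c n - S K) \<le> e K"
      by (auto simp: eventually_sequentially)
    then show ?thesis using norm_triangle_ineq4[of "c n - S K" "c n - S J"] by (simp add: algebra_simps)
  qed
  have "Cauchy S"
  proof (rule metric_CauchyI)
    fix r :: real assume "r > 0"
    then have "\<forall>\<^sub>F J in sequentially. e J < r / 2" using e by (intro order_tendstoD) auto
    then obtain J0 where J0: "\<And>J. J \<ge> J0 \<Longrightarrow> e J < r / 2" by (auto simp: eventually_sequentially)
    have "dist (S J) (S K) < r" if "J \<ge> J0" "K \<ge> J0" for J K
      using SJ[of J K] J0[OF that(1)] J0[OF that(2)] by (simp add: dist_norm)
    then show "\<exists>J0. \<forall>J\<ge>J0. \<forall>K\<ge>J0. dist (S J) (S K) < r" by blast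
  qed
  then show conv: "convergent S" by (simp add: Cauchy_convergent_iff)
  show "c \<longlonglongrightarrow> lim S"
  proof (rule metric_LIMSEQ_I)
    fix r :: real assume r: "r > 0"
    have "\<forall>\<^sub>F J in sequentially. e J < r / 2" using e r by (intro order_tendstoD) auto
    moreover have "\<forall>\<^sub>F J in sequentially. dist (S J) (lim S) < r / 2"
      using conv r by (intro tendstoD) (auto simp: convergent_LIMSEQ_iff)
    ultimately have "\<forall>\<^sub>F J in sequentially. e J < r / 2 \<and> dist (S J) (lim S) < r / 2"
      by eventually_elim auto
    then obtain J where J: "e J < r / 2" "dist (S J) (lim S) < r / 2" by (auto simp: eventually_sequentially)
    have "\<forall>\<^sub>F n in sequentially. dist (c n) (lim S) < r"
      using ev[of J]
    proof eventually_elim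
      case (elim n)
      then have "dist (c n) (S J) < r / 2" using J by (simp add: dist_norm)
      then show ?case using J(2) dist_triangle_half_r[of "S J" "c n" r "lim S"] by (simp add: dist_commute)
    qed
    then show "\<exists>no. \<forall>n\<ge>no. dist (c n) (lim S) < r" by (simp add: eventually_sequentially)
  qed
qed

text \<open>Averaging the Taylor remainder of \<open>iexp\<close> bounds the error by an even moment
  of the empirical measure. That moment converges, and the growth condition makes its limit
  negligible for large J.\<close>

lemma moments_to_char:
  assumes mom: "\<And>p. (\<lambda>n. (\<Sum>k<n. e n k ^ p) / real n) \<longlonglongrightarrow> m p"
    and growth: "(\<lambda>J. \<bar>t\<bar> ^ (2 * J + 2) * m (2 * J + 2) / fact (2 * J + 2)) \<longlonglongrightarrow> 0"
  shows "convergent (char_poly_sum m t)" "(\<lambda>n. emp_char n (e n) t) \<longlonglongrightarrow> char_of_moments m t"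
proof -
  \<comment> \<open>The extra \<open>1 / (J + 1)\<close> absorbs two errors of half this size: that
    of the Taylor polynomial and that of the remainder moment, when both are replaced by their
    limits.\<close>
  define eps where "eps J = \<bar>t\<bar> ^ (2 * J + 2) * m (2 * J + 2) / fact (2 * J + 2) + 1 / real (Suc J)" for J
  have eps: "eps \<longlonglongrightarrow> 0"
    unfolding eps_def using tendsto_add[OF growth LIMSEQ_Suc[OF lim_1_over_n]] by simp
  define mn where "mn n p = (\<Sum>k<n. e n k ^ p) / real n" for n p
  have close: "\<forall>\<^sub>F n in sequentially. cmod (emp_char n (e n) t - char_poly_sum m t J) \<le> eps J" for J
  proof -
    have "Suc (2 * J + 1) = 2 * J + 2" by simp
    then have ap: "cmod (iexp x - (\<Sum>p\<le>2 * J + 1. (\<i> * of_real x) ^ p / fact p)) \<le> \<bar>x\<bar> ^ (2 * J + 2) / fact (2 * J + 2)" for x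
      using iexp_approx1[of x "2 * J + 1"] by (simp only:)
    have A: "cmod (emp_char n (e n) t - char_poly_sum (mn n) t J) \<le> \<bar>t\<bar> ^ (2 * J + 2) * mn n (2 * J + 2) / fact (2 * J + 2)"
      if n: "n > 0" for n
    proof -
      have "char_poly_sum (mn n) t J = (\<Sum>p\<le>2 * J + 1. \<Sum>k<n. (\<i> * of_real (t * e n k)) ^ p / fact p / of_nat n)"
        unfolding char_poly_sum_def mn_def
        by (intro sum.cong refl) (simp add: sum_distrib_left sum_divide_distrib power_mult_distrib mult_ac)
      also have "\<dots> = (\<Sum>k<n. \<Sum>p\<le>2 * J + 1. (\<i> * of_real (t * e n k)) ^ p / fact p) / of_nat n"
        by (subst sum.swap) (simp only: sum_divide_distrib)
      finally have "emp_char n (e n) t - char_poly_sum (mn n) t J =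
        (\<Sum>k<n. iexp (t * e n k) - (\<Sum>p\<le>2 * J + 1. (\<i> * of_real (t * e n k)) ^ p / fact p)) / of_nat n"
        by (simp add: emp_char_def sum_subtractf diff_divide_distrib)
      then have "cmod (emp_char n (e n) t - char_poly_sum (mn n) t J) =
        cmod (\<Sum>k<n. iexp (t * e n k) - (\<Sum>p\<le>2 * J + 1. (\<i> * of_real (t * e n k)) ^ p / fact p)) / real n"
        by (simp add: norm_divide)
      also have "\<dots> \<le> (\<Sum>k<n. \<bar>t * e n k\<bar> ^ (2 * J + 2) / fact (2 * J + 2)) / real n"
        by (intro divide_right_mono sum_norm_le ap of_nat_0_le_iff)
      also have "\<dots> = (\<Sum>k<n. \<bar>t\<bar> ^ (2 * J + 2) * e n k ^ (2 * J + 2) / fact (2 * J + 2)) / real n"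
        by (intro arg_cong2[where f = "(/)"] sum.cong refl) (simp only: abs_mult power_mult_distrib, simp add: power_even_abs)
      also have "\<dots> = \<bar>t\<bar> ^ (2 * J + 2) * mn n (2 * J + 2) / fact (2 * J + 2)"
        by (simp add: mn_def sum_distrib_left sum_divide_distrib mult_ac del: power_Suc)
      finally show ?thesis .
    qed
    have "(\<lambda>n. char_poly_sum (mn n) t J) \<longlonglongrightarrow> char_poly_sum m t J"
      unfolding char_poly_sum_def mn_def by (intro tendsto_sum tendsto_divide tendsto_mult tendsto_const tendsto_of_real mom) auto
    then have "\<forall>\<^sub>F n in sequentially. dist (char_poly_sum (mn n) t J) (char_poly_sum m t J) < 1 / (2 * real (Suc J))"
      by (rule tendstoD) simp
    moreover have "(\<lambda>n. \<bar>t\<bar> ^ (2 * J + 2) * mn n (2 * J + 2) / fact (2 * J + 2))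
        \<longlonglongrightarrow> \<bar>t\<bar> ^ (2 * J + 2) * m (2 * J + 2) / fact (2 * J + 2)"
      unfolding mn_def by (intro tendsto_divide tendsto_mult tendsto_const mom) auto
    then have "\<forall>\<^sub>F n in sequentially. dist (\<bar>t\<bar> ^ (2 * J + 2) * mn n (2 * J + 2) / fact (2 * J + 2))
        (\<bar>t\<bar> ^ (2 * J + 2) * m (2 * J + 2) / fact (2 * J + 2)) < 1 / (2 * real (Suc J))"
      by (rule tendstoD) simp
    ultimately show ?thesis
      using eventually_gt_at_top[of 0]
    proof eventually_elim
      case (elim n)
      have tri: "x \<le> y + d \<Longrightarrow> y \<le> P \<Longrightarrow> d < h \<Longrightarrow> \<bar>P - Q\<bar> < h \<Longrightarrow> h + h = g \<Longrightarrow> x \<le> Q + g"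
        for x y d h P Q g :: real by linarith
      have h: "1 / (2 * real (Suc J)) + 1 / (2 * real (Suc J)) = 1 / real (Suc J)" by (simp add: field_simps)
      have "cmod (emp_char n (e n) t - char_poly_sum m t J) \<le>
        cmod (emp_char n (e n) t - char_poly_sum (mn n) t J) + dist (char_poly_sum (mn n) t J) (char_poly_sum m t J)"
        unfolding dist_norm by norm
      from tri[OF this A[OF elim(3)] elim(1) elim(2)[unfolded dist_real_def] h]
      show ?case unfolding eps_def .
    qed
  qed
  from approx_scheme[OF close eps]
  show "convergent (char_poly_sum m t)" "(\<lambda>n. emp_char n (e n) t) \<longlonglongrightarrow> char_of_moments m t"
    by (simp_all add: char_of_moments_def)
qed

lemma tight_emp:
  assumes "\<And>n. (\<Sum>k<n. e n k ^ 2) / real n \<le> C"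
  shows "tight (\<lambda>n. emp (Suc n) (e (Suc n)))"
  unfolding tight_def
proof (intro conjI allI impI)
  fix n show "real_distribution (emp (Suc n) (e (Suc n)))" by (rule real_distribution_emp)
next
  fix \<epsilon> :: real assume \<epsilon>: "\<epsilon> > 0"
  \<comment> \<open>Chebyshev: at most a fraction \<open>C / R^2\<close> of the points lies outside
    the window, and R makes this less than \<epsilon>. The two added ones give a strict inequality
    and R > 0.\<close>
  define R where "R = sqrt ((\<bar>C\<bar> + 1) / \<epsilon>) + 1"
  have R: "R > 0" using \<epsilon> by (simp add: R_def add_nonneg_pos)
  have R2: "\<bar>C\<bar> < \<epsilon> * R\<^sup>2"
  proof -
    have "(\<bar>C\<bar> + 1) / \<epsilon> = (sqrt ((\<bar>C\<bar> + 1) / \<epsilon>))\<^sup>2" using \<epsilon> by simp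
    also have "\<dots> \<le> R\<^sup>2" unfolding R_def using \<epsilon> by (intro power_mono) auto
    finally show ?thesis using \<epsilon> by (simp add: pos_divide_le_eq mult.commute)
  qed
  have "measure (emp (Suc n) (e (Suc n))) {- R<..R} > 1 - \<epsilon>" for n
  proof -
    let ?e = "e (Suc n)"
    let ?A = "{k. k < Suc n \<and> ?e k \<notin> {- R<..R}}"
    have "measure (emp (Suc n) ?e) {- R<..R} = measure (measure_pmf (pmf_of_set {..<Suc n})) {k. ?e k \<in> {- R<..R}}"
      unfolding emp_def by (subst measure_distr) (auto simp: vimage_def)
    also have "\<dots> = real (card ({..<Suc n} \<inter> {k. ?e k \<in> {- R<..R}})) / real (Suc n)"
      by (subst measure_pmf_of_set) auto
    also have "card ({..<Suc n} \<inter> {k. ?e k \<in> {- R<..R}}) = Suc n - card ?A"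
    proof -
      have "{..<Suc n} \<inter> {k. ?e k \<in> {- R<..R}} = {..<Suc n} - ?A" by auto
      moreover have "card ({..<Suc n} - ?A) = card {..<Suc n} - card ?A"
        by (rule card_Diff_subset) auto
      ultimately show ?thesis by (simp only: card_lessThan)
    qed
    finally have m: "measure (emp (Suc n) ?e) {- R<..R} = real (Suc n - card ?A) / real (Suc n)" .
    have cA: "card ?A \<le> Suc n" using card_mono[of "{..<Suc n}" ?A] by (auto simp: subset_eq)
    have "real (card ?A) * R\<^sup>2 = (\<Sum>k\<in>?A. R\<^sup>2)" by simp
    also have "\<dots> \<le> (\<Sum>k\<in>?A. ?e k ^ 2)"
    proof (intro sum_mono)
      fix k assume "k \<in> ?A"
      then have "\<bar>?e k\<bar> \<ge> R" using R by auto
      then show "R\<^sup>2 \<le> ?e k ^ 2" using R by (metis abs_le_square_iff abs_of_pos)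
    qed
    also have "\<dots> \<le> (\<Sum>k<Suc n. ?e k ^ 2)" by (intro sum_mono2) auto
    also have "\<dots> \<le> C * real (Suc n)" using assms[of "Suc n"] by (simp add: pos_divide_le_eq)
    also have "\<dots> \<le> \<bar>C\<bar> * real (Suc n)" by (intro mult_right_mono) auto
    also have "\<dots> < \<epsilon> * R\<^sup>2 * real (Suc n)" using R2 by (intro mult_strict_right_mono) auto
    finally have "real (card ?A) * R\<^sup>2 < (\<epsilon> * real (Suc n)) * R\<^sup>2" by (simp add: mult_ac)
    then have "real (card ?A) < \<epsilon> * real (Suc n)" using R by (simp add: mult_less_cancel_right)
    then show ?thesis unfolding m using cA by (simp add: of_nat_diff field_simps)
  qed
  then show "\<exists>a b. a < b \<and> (\<forall>n. 1 - \<epsilon> < measure (emp (Suc n) (e (Suc n))) {a<..b})"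
    using R by (intro exI[of _ "- R"] exI[of _ R]) auto
qed

text \<open>Bounded second moments give tightness, hence a weak limit along a subsequence. Its
  characteristic function must be the given pointwise limit, so continuity of \<Phi> need not be
  checked separately.\<close>

lemma limit_distribution_exists:
  assumes bd: "\<And>n. (\<Sum>k<n. e n k ^ 2) / real n \<le> C"
    and ch: "\<And>t. (\<lambda>n. emp_char n (e n) t) \<longlonglongrightarrow> \<Phi> t"
  shows "\<exists>\<mu>. real_distribution \<mu> \<and> char \<mu> = \<Phi>"
proof -
  let ?M = "\<lambda>n. emp (Suc n) (e (Suc n))"
  have "\<exists>r \<mu>. strict_mono r \<and> real_distribution \<mu> \<and> weak_conv_m (?M \<circ> id \<circ> r) \<mu>"
    by (rule tight_imp_convergent_subsubsequence[OF tight_emp[OF bd] strict_mono_id])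
  then obtain r \<mu> where r: "strict_mono r" and \<mu>: "real_distribution \<mu>" "weak_conv_m (?M \<circ> r) \<mu>"
    unfolding comp_id by blast
  have "char \<mu> t = \<Phi> t" for t
  proof (rule LIMSEQ_unique)
    show "(\<lambda>n. char ((?M \<circ> r) n) t) \<longlonglongrightarrow> char \<mu> t"
      by (rule levy_continuity1[OF _ \<mu>]) (simp add: real_distribution_emp)
    have "(\<lambda>n. emp_char (Suc n) (e (Suc n)) t) \<longlonglongrightarrow> \<Phi> t" by (rule LIMSEQ_Suc[OF ch])
    from LIMSEQ_subseq_LIMSEQ[OF this r]
    show "(\<lambda>n. char ((?M \<circ> r) n) t) \<longlonglongrightarrow> \<Phi> t" by (simp add: char_emp comp_def)
  qed
  with \<mu>(1) show ?thesis by blast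
qed

lemma weak_conv_from_char:
  assumes \<mu>: "real_distribution \<mu>" and ch: "\<And>t. (\<lambda>n. emp_char n (e n) t) \<longlonglongrightarrow> char \<mu> t"
    and F: "\<And>n s. n > 0 \<Longrightarrow> F n s = real (card {k. k < n \<and> e n k \<le> s}) / real n"
  shows "weak_conv F (cdf \<mu>)"
proof -
  let ?M = "\<lambda>n. emp (Suc n) (e (Suc n))"
  have "weak_conv_m ?M \<mu>"
  proof (rule levy_continuity[OF _ \<mu>])
    show "(\<lambda>n. char (?M n) t) \<longlonglongrightarrow> char \<mu> t" for t
      using LIMSEQ_Suc[OF ch[of t]] by (simp add: char_emp)
  qed (rule real_distribution_emp)
  then have step: "(\<lambda>n. F (Suc n) s) \<longlonglongrightarrow> cdf \<mu> s" if "isCont (cdf \<mu>) s" for s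
    using that unfolding weak_conv_m_def weak_conv_def by (simp add: cdf_emp F)
  show ?thesis unfolding weak_conv_def by (intro allI impI, rule LIMSEQ_imp_Suc, rule step)
qed

section \<open>Moment sequences determined by their characteristic function\<close>

definition tame_moments :: "(nat \<Rightarrow> real) \<Rightarrow> bool" where
  "tame_moments m \<longleftrightarrow> m 0 = 1 \<and> (\<forall>p. odd p \<longrightarrow> m p = 0) \<and>
     (\<exists>C. \<forall>k. \<bar>m (2 * k)\<bar> \<le> C ^ Suc k * (fact (2 * k) / fact k))"

text \<open>Division by (2k)! reduces the bound to terms of the exponential series in
  \<open>C * t^2\<close>, so the series converges for every t.\<close>

lemma tame_moments_summable:
  assumes "tame_moments m"
  shows "summable (\<lambda>p. \<bar>m p\<bar> * \<bar>t\<bar> ^ p / fact p)"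
proof -
  obtain C where C: "\<And>k. \<bar>m (2 * k)\<bar> \<le> C ^ Suc k * (fact (2 * k) / fact k)"
    and odd: "\<And>p. odd p \<Longrightarrow> m p = 0"
    using assms unfolding tame_moments_def by blast
  let ?f = "\<lambda>p. \<bar>m p\<bar> * \<bar>t\<bar> ^ p / fact p"
  have "summable (\<lambda>k. ?f (2 * k))"
  proof (rule summable_comparison_test')
    show "summable (\<lambda>k. C * ((C * t\<^sup>2) ^ k /\<^sub>R fact k))"
      by (rule summable_mult, rule summable_exp_generic)
    fix k :: nat
    have "?f (2 * k) \<le> (C ^ Suc k * (fact (2 * k) / fact k)) * \<bar>t\<bar> ^ (2 * k) / fact (2 * k)"
      using C[of k] by (intro divide_right_mono mult_right_mono) auto
    also have "\<dots> = (C ^ Suc k * (fact (2 * k) / fact k)) * (t\<^sup>2) ^ k / fact (2 * k)" by (simp add: power_mult)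
    also have "(C ^ Suc k * (fact (2 * k) / fact k)) * (t\<^sup>2) ^ k / fact (2 * k) = C * ((C * t\<^sup>2) ^ k /\<^sub>R fact k)"
      by (simp add: power_mult_distrib field_simps)
    finally have "?f (2 * k) \<le> C * ((C * t\<^sup>2) ^ k /\<^sub>R fact k)" .
    then show "norm (?f (2 * k)) \<le> C * ((C * t\<^sup>2) ^ k /\<^sub>R fact k)" by (simp only: real_norm_def, simp)
  qed
  moreover have "?f p = 0" if "p \<notin> range (\<lambda>k. 2 * k)" for p
    using that odd[of p] by (auto elim!: evenE)
  moreover have "strict_mono (\<lambda>k :: nat. 2 * k)" by (simp add: strict_mono_def)
  ultimately show ?thesis using summable_mono_reindex[of "\<lambda>k. 2 * k" ?f] by blast
qed

lemma tame_moments_growth: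
  assumes "tame_moments m"
  shows "(\<lambda>J. \<bar>t\<bar> ^ (2 * J + 2) * m (2 * J + 2) / fact (2 * J + 2)) \<longlonglongrightarrow> 0"
proof -
  have "strict_mono (\<lambda>J :: nat. 2 * J + 2)" by (simp add: strict_mono_def)
  from LIMSEQ_subseq_LIMSEQ[OF summable_LIMSEQ_zero[OF tame_moments_summable[OF assms, of t]] this]
  have "(\<lambda>J. \<bar>m (2 * J + 2)\<bar> * \<bar>t\<bar> ^ (2 * J + 2) / fact (2 * J + 2)) \<longlonglongrightarrow> 0" by (simp only: comp_def)
  moreover have "\<bar>\<bar>t\<bar> ^ q * m q / fact q\<bar> = \<bar>m q\<bar> * \<bar>t\<bar> ^ q / fact q" for q
    by (simp add: abs_mult)
  ultimately have "(\<lambda>J. \<bar>\<bar>t\<bar> ^ (2 * J + 2) * m (2 * J + 2) / fact (2 * J + 2)\<bar>) \<longlonglongrightarrow> 0"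
    by (simp only:)
  then show ?thesis by (rule tendsto_rabs_zero_cancel)
qed

lemma char_of_moments_sums:
  assumes "tame_moments m"
  shows "(\<lambda>p. \<i> ^ p * of_real (m p) / fact p * of_real t ^ p) sums char_of_moments m t"
proof -
  let ?f = "\<lambda>p. \<i> ^ p * of_real (m p) / fact p * of_real t ^ p :: complex"
  have "summable (\<lambda>p. norm (?f p))"
    using tame_moments_summable[OF assms, of t] by (simp add: norm_mult norm_divide norm_power)
  then have f: "summable ?f" by (rule summable_norm_cancel)
  have "char_poly_sum m t = (\<lambda>n. sum ?f {..<n}) \<circ> (\<lambda>J. 2 * J + 2)"
    unfolding char_poly_sum_def comp_def fun_eq_iff
    by (intro allI sum.cong) (auto simp: power_mult_distrib)
  moreover have "strict_mono (\<lambda>J :: nat. 2 * J + 2)" by (simp add: strict_mono_def)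
  ultimately have "char_poly_sum m t \<longlonglongrightarrow> suminf ?f"
    using LIMSEQ_subseq_LIMSEQ[OF summable_LIMSEQ[OF f], of "\<lambda>J. 2 * J + 2"] by (simp only:)
  then have "char_of_moments m t = suminf ?f" unfolding char_of_moments_def by (rule limI)
  then show ?thesis using f by (simp add: summable_sums)
qed

text \<open>The difference of the two power series vanishes on the real line, but a nonzero
  coefficient would keep it from vanishing in a punctured disc around 0.\<close>

lemma char_of_moments_inj:
  assumes m: "tame_moments m" and m': "tame_moments m'" and eq: "char_of_moments m = char_of_moments m'"
  shows "m p = m' p"
proof (rule ccontr)
  assume ne: "m p \<noteq> m' p"
  \<comment> \<open>Both sequences start with 1, so the differing coefficient has positive order, as
    the theorem on isolated zeros requires.\<close>
  then have p: "p > 0" using m m' by (cases p) (auto simp: tame_moments_def)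
  define a :: "nat \<Rightarrow> complex" where "a q = \<i> ^ q * of_real (m q) / fact q - \<i> ^ q * of_real (m' q) / fact q" for q
  have abs_sum: "summable (\<lambda>q. \<i> ^ q * of_real (n q) / fact q * z ^ q)" if "tame_moments n" for n and z :: complex
    by (rule summable_norm_cancel)
       (use tame_moments_summable[OF that, of "cmod z"] in \<open>simp add: norm_mult norm_divide norm_power\<close>)
  have sums: "(\<lambda>q. a q * (z - 0) ^ q) sums (\<Sum>q. a q * z ^ q)" for z
  proof -
    have "summable (\<lambda>q. a q * z ^ q)"
      using summable_diff[OF abs_sum[OF m, of z] abs_sum[OF m', of z]] by (simp only: a_def left_diff_distrib)
    then show ?thesis unfolding diff_zero by (rule summable_sums)
  qed
  have zero: "(\<Sum>q. a q * of_real t ^ q) = 0" for t :: real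
  proof -
    have "(\<lambda>q. a q * of_real t ^ q) sums 0"
      using sums_diff[OF char_of_moments_sums[OF m, of t] char_of_moments_sums[OF m', of t]]
      by (simp only: eq a_def left_diff_distrib diff_self)
    then show ?thesis by (rule sums_unique[symmetric])
  qed
  have ap: "a p \<noteq> 0" using ne by (simp add: a_def)
  have "\<exists>s>0. \<forall>z\<in>cball 0 s - {0}. (\<Sum>q. a q * z ^ q) \<noteq> 0"
  proof (rule powser_0_nonzero[where r = 1 and \<xi> = 0 and a = a and f = "\<lambda>z. \<Sum>q. a q * z ^ q" and m = p])
    show "(\<Sum>q. a q * 0 ^ q) = 0" using zero[of 0] by (simp only: of_real_0)
    show "(0 :: real) < 1" by simp
    show "a p \<noteq> 0" by (rule ap)
    show "p > 0" by (rule p)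
    show "(\<lambda>n. a n * (x - 0) ^ n) sums (\<Sum>q. a q * x ^ q)" for x by (rule sums)
    fix s :: real assume "0 < s" "\<And>z. z \<in> cball 0 s - {0} \<Longrightarrow> (\<Sum>q. a q * z ^ q) \<noteq> 0"
    then show "\<exists>s>0. \<forall>z\<in>cball 0 s - {0}. (\<Sum>q. a q * z ^ q) \<noteq> 0" by blast
  qed
  then obtain s where s: "0 < s" "\<And>z. z \<in> cball 0 s - {0} \<Longrightarrow> (\<Sum>q. a q * z ^ q) \<noteq> 0"
    by blast
  have "(\<Sum>q. a q * of_real s ^ q) \<noteq> 0" using s by (intro s(2)) auto
  with zero[of s] show False by simp
qed

section \<open>Torus families\<close>

lemma (in prob_space) indep_vars_inj_reindex:
  assumes X: "indep_vars (\<lambda>_. N) X J" and f: "inj_on f I" "f ` I \<subseteq> J"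
  shows "indep_vars (\<lambda>_. N) (\<lambda>i. X (f i)) I"
proof -
  let ?F = "\<lambda>j. {X j -` A \<inter> space M |A. A \<in> sets N}"
  have F: "indep_sets ?F J" and rv: "\<And>j. j \<in> J \<Longrightarrow> random_variable N (X j)"
    using X by (auto simp: indep_vars_def2)
  have "indep_sets (\<lambda>i. ?F (f i)) I"
  proof (rule indep_setsI)
    fix i assume "i \<in> I"
    then show "?F (f i) \<subseteq> events" using F f unfolding indep_sets_def by blast
  next
    fix A K assume K: "K \<noteq> {}" "K \<subseteq> I" "finite K" and A: "\<forall>j\<in>K. A j \<in> ?F (f j)"
    have inj: "inj_on f K" using f(1) K(2) by (rule inj_on_subset)
    define A' where "A' = A \<circ> inv_into K f"
    have A': "A' (f j) = A j" if "j \<in> K" for j using that inj by (simp add: A'_def)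
    have "prob (\<Inter>j\<in>f ` K. A' j) = (\<Prod>j\<in>f ` K. prob (A' j))"
    proof (rule indep_setsD[OF F])
      show "f ` K \<subseteq> J" using K(2) f(2) by blast
      show "\<forall>j\<in>f ` K. A' j \<in> ?F j"
      proof
        fix j assume "j \<in> f ` K"
        then obtain i where "i \<in> K" "j = f i" by blast
        with A A' show "A' j \<in> ?F j" by simp
      qed
    qed (use K in auto)
    moreover have "(\<Inter>j\<in>f ` K. A' j) = (\<Inter>j\<in>K. A j)" using A' by auto
    moreover have "(\<Prod>j\<in>f ` K. prob (A' j)) = (\<Prod>j\<in>K. prob (A j))"
      using inj A' by (subst prod.reindex) auto
    ultimately show "prob (\<Inter>j\<in>K. A j) = (\<Prod>j\<in>K. prob (A j))" by simp
  qed
  then show ?thesis using rv f unfolding indep_vars_def2 by auto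
qed

text \<open>What the moment method uses of the input; (A1), (A3) and the truncated form of (A2) all
  provide it.\<close>

definition bounded_moments :: "'w measure \<Rightarrow> (nat \<Rightarrow> 'w \<Rightarrow> real) \<Rightarrow> bool" where
  "bounded_moments M x \<longleftrightarrow> prob_space M \<and> prob_space.indep_vars M (\<lambda>_. borel) x UNIV \<and>
     (\<forall>i k. integrable M (\<lambda>\<omega>. x i \<omega> ^ k)) \<and> (\<forall>i. integral\<^sup>L M (x i) = 0) \<and>
     (\<forall>i. (\<integral>\<omega>. x i \<omega> ^ 2 \<partial>M) = 1) \<and> (\<forall>k. \<exists>C. \<forall>i. \<bar>\<integral>\<omega>. x i \<omega> ^ k \<partial>M\<bar> \<le> C)"

lemma bounded_moments_uniform:
  assumes "bounded_moments M x"
  obtains B where "B \<ge> 1" "\<And>i k. k \<le> K \<Longrightarrow> \<bar>\<integral>\<omega>. x i \<omega> ^ k \<partial>M\<bar> \<le> B"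
proof -
  obtain C where C: "\<And>k i. \<bar>\<integral>\<omega>. x i \<omega> ^ k \<partial>M\<bar> \<le> C k"
    using assms unfolding bounded_moments_def by metis
  show ?thesis
  proof (rule that[of "1 + (\<Sum>k\<le>K. \<bar>C k\<bar>)"])
    show "1 \<le> 1 + (\<Sum>k\<le>K. \<bar>C k\<bar>)" by (simp add: sum_nonneg)
    fix i k assume "k \<le> K"
    then have "\<bar>C k\<bar> \<le> (\<Sum>k\<le>K. \<bar>C k\<bar>)" by (intro member_le_sum) auto
    then show "\<bar>\<integral>\<omega>. x i \<omega> ^ k \<partial>M\<bar> \<le> 1 + (\<Sum>k\<le>K. \<bar>C k\<bar>)" using C[where k = k and i = i] by linarith
  qed
qed

lemma Re_of_real_mult: "Re (of_real r * z) = r * Re z"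
  by simp

lemma summable_inverse_Suc_square: "summable (\<lambda>n. 1 / real (Suc n) ^ 2)"
  using summable_Suc_iff[of "\<lambda>n. inverse (real n ^ 2)"] inverse_power_summable[of 2, where 'a = real]
  by (simp add: inverse_eq_divide del: of_nat_Suc)

lemma fpow_scale: "fpow n (\<lambda>i j. c * M i j) p a b = c ^ p * fpow n M p a b"
  by (induction p arbitrary: a) (auto simp: sum_distrib_left mult_ac)

lemma fpow_restrict:
  assumes "n \<le> N" "\<And>i j. i < N \<Longrightarrow> j < N \<Longrightarrow> i \<ge> n \<or> j \<ge> n \<Longrightarrow> M i j = 0" "a < n"
  shows "fpow N M p a b = fpow n M p a b"
  using assms(3)
proof (induction p arbitrary: a)
  case (Suc p)
  have "(\<Sum>k<N. M a k * fpow N M p k b) = (\<Sum>k<n. M a k * fpow N M p k b)"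
    using assms(1,2) Suc.prems by (intro sum.mono_neutral_right) auto
  with Suc show ?case by simp
qed simp

text \<open>Rows outside the corner vanish and add nothing to the diagonal of a positive power; for
  p = 0 the identity would count N instead of n.\<close>

lemma fpow_restrict_trace:
  assumes "n \<le> N" "\<And>i j. i < N \<Longrightarrow> j < N \<Longrightarrow> i \<ge> n \<or> j \<ge> n \<Longrightarrow> M i j = 0" "p > 0"
  shows "(\<Sum>a<n. fpow n M p a a) = (\<Sum>a<N. fpow N M p a a)"
proof -
  obtain q where p: "p = Suc q" using assms(3) by (cases p) auto
  have "(\<Sum>a<N. fpow N M p a a) = (\<Sum>a<n. fpow N M p a a)"
    using assms unfolding p by (intro sum.mono_neutral_right) auto
  also have "\<dots> = (\<Sum>a<n. fpow n M p a a)"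
    using assms by (intro sum.cong refl fpow_restrict) auto
  finally show ?thesis ..
qed

text \<open>The \<open>n \<times> n\<close> matrices of the family are cut out of torus matrices of size \<open>N = d n\<close>; this turns
  a Hankel matrix (\<open>d = 2\<close>) into a corner of a reverse circulant one.\<close>

locale torus_family = hermitian_weight +
  fixes d :: nat and \<iota> :: "nat \<Rightarrow> nat \<Rightarrow> nat"
  assumes d: "d \<ge> 1"
    and inj: "inj_on (\<iota> n) {..<d * n}"
    and range: "c < d * n \<Longrightarrow> \<iota> n c \<le> 2 * n"
    and cut: "\<And>s t :: real. 0 \<le> s \<Longrightarrow> s < 1 \<Longrightarrow> 0 \<le> t \<Longrightarrow> t < 1 \<Longrightarrow>
      1 \<le> real d * s \<or> 1 \<le> real d * t \<Longrightarrow> \<phi> s t = 0"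
begin

definition hmat :: "nat \<Rightarrow> (nat \<Rightarrow> real) \<Rightarrow> nat \<Rightarrow> nat \<Rightarrow> complex" where
  "hmat n x i j = of_real (1 / sqrt (real n)) * tmat \<phi> (d * n) (\<lambda>c. x (\<iota> n c)) i j"

lemma hmat_herm: "hmat n x i j = cnj (hmat n x j i)"
  unfolding hmat_def by (subst tmat_herm) simp

definition is_spec :: "nat \<Rightarrow> (nat \<Rightarrow> real) \<Rightarrow> (nat \<Rightarrow> real) \<Rightarrow> bool" where
  "is_spec n x e \<longleftrightarrow> (\<exists>u. eigensystem n (hmat n x) u e) \<and>
     (\<forall>c A. map_mat complex_of_real A = c \<cdot>\<^sub>m mat n n (\<lambda>(i, j). hmat n x i j) \<longrightarrow>
       spectrum_mset A = mset (map (\<lambda>k. c * of_real (e k)) [0..<n]))"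

text \<open>A choice made separately for each realisation. It need not be measurable in the outcome:
  measurability enters only through traces, to which the power sums of the eigenvalues are
  reduced.\<close>

definition spec :: "nat \<Rightarrow> (nat \<Rightarrow> real) \<Rightarrow> nat \<Rightarrow> real" where
  "spec n x = (SOME e. is_spec n x e)"

lemma spec: "is_spec n x (spec n x)"
proof -
  have h: "hmat n x i j = cnj (hmat n x j i)" for i j by (rule hmat_herm)
  have "\<exists>e. is_spec n x e"
    by (rule hermitian_eigensystem[where M = "hmat n x" and n = n], rule h) (auto simp: is_spec_def)
  then show ?thesis unfolding spec_def by (rule someI_ex)
qed

lemma spec_moment:
  assumes n: "n > 0" and p: "p > 0"
  shows "(\<Sum>k<n. spec n x k ^ p) / real n
    = Re (\<Sum>a<d * n. fpow (d * n) (tmat \<phi> (d * n) (\<lambda>c. x (\<iota> n c))) p a a) / (real n * sqrt (real n) ^ p)"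
proof -
  let ?T = "tmat \<phi> (d * n) (\<lambda>c. x (\<iota> n c))"
  obtain u where "eigensystem n (hmat n x) u (spec n x)" using spec unfolding is_spec_def by blast
  from eigensystem_trace[OF this, of p]
  have "complex_of_real (\<Sum>k<n. spec n x k ^ p) = (\<Sum>a<n. fpow n (hmat n x) p a a)" ..
  also have "hmat n x = (\<lambda>i j. of_real (1 / sqrt (real n)) * ?T i j)" by (simp add: hmat_def fun_eq_iff)
  also have "(\<Sum>a<n. fpow n (\<lambda>i j. of_real (1 / sqrt (real n)) * ?T i j) p a a)
      = of_real ((1 / sqrt (real n)) ^ p) * (\<Sum>a<n. fpow n ?T p a a)"
    by (simp only: fpow_scale sum_distrib_left of_real_power)
  also have "(\<Sum>a<n. fpow n ?T p a a) = (\<Sum>a<d * n. fpow (d * n) ?T p a a)"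
  proof (rule fpow_restrict_trace)
    show "n \<le> d * n" using d by simp
    fix i j assume ij: "i < d * n" "j < d * n" "i \<ge> n \<or> j \<ge> n"
    have "\<phi> (real i / real (d * n)) (real j / real (d * n)) = 0"
    proof (rule cut)
      show "1 \<le> real d * (real i / real (d * n)) \<or> 1 \<le> real d * (real j / real (d * n))"
        using ij n d by (auto simp: field_simps)
    qed (use ij n d in \<open>auto simp: field_simps simp flip: of_nat_mult\<close>)
    then show "?T i j = 0" by (simp add: tmat_def)
  qed (rule p)
  finally have "(\<Sum>k<n. spec n x k ^ p) = Re (of_real ((1 / sqrt (real n)) ^ p) * (\<Sum>a<d * n. fpow (d * n) ?T p a a))"
    by (metis Re_complex_of_real)
  also have "\<dots> = (1 / sqrt (real n)) ^ p * Re (\<Sum>a<d * n. fpow (d * n) ?T p a a)"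
    by (rule Re_of_real_mult)
  finally show ?thesis by (simp add: power_one_over)
qed

text \<open>With k = p div 2, the factor \<open>d ^ (k + 1)\<close> converts normalisation by
  \<open>N = d * n\<close> into normalisation by n. Order 0 is set apart because the formula would
  count all N diagonal entries of the torus matrix and give d.\<close>

definition lim_mom :: "nat \<Rightarrow> real" where
  "lim_mom p = (if p = 0 then 1 else if even p then real d ^ Suc (p div 2) * Re (limit_moment (p div 2)) else 0)"

lemma tame_lim_mom: "tame_moments lim_mom"
  unfolding tame_moments_def
proof (intro conjI allI impI exI[of _ "real d"])
  show "lim_mom 0 = 1" by (simp add: lim_mom_def)
  show "lim_mom p = 0" if "odd p" for p using that by (auto simp: lim_mom_def elim: oddE)
  fix k
  show "\<bar>lim_mom (2 * k)\<bar> \<le> real d ^ Suc k * (fact (2 * k) / fact k)"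
  proof (cases "k = 0")
    case True
    then show ?thesis using d by (simp add: lim_mom_def)
  next
    case False
    have "\<bar>Re (limit_moment k)\<bar> \<le> fact (2 * k) / fact k"
      using abs_Re_le_cmod[of "limit_moment k"] limit_moment_bound[of k] by linarith
    then have "real d ^ Suc k * \<bar>Re (limit_moment k)\<bar> \<le> real d ^ Suc k * (fact (2 * k) / fact k)"
      by (intro mult_left_mono) auto
    then show ?thesis using False by (simp add: lim_mom_def abs_mult)
  qed
qed

lemma torus_modelI:
  assumes "bounded_moments M x" "n > 0"
  shows "torus_model M (d * n) (\<lambda>c. x (\<iota> n c)) \<phi>"
proof -
  interpret prob_space M using assms by (simp add: bounded_moments_def)
  have "indep_vars (\<lambda>_. borel) (\<lambda>c. x (\<iota> n c)) {..<d * n}"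
    by (rule indep_vars_inj_reindex[OF _ inj subset_UNIV]) (use assms(1) in \<open>simp add: bounded_moments_def\<close>)
  then show ?thesis
  proof unfold_locales
    fix a k :: nat
    show "integrable M (\<lambda>\<omega>. x (\<iota> n a) \<omega> ^ k)" "expectation (x (\<iota> n a)) = 0"
      "expectation (\<lambda>\<omega>. (x (\<iota> n a) \<omega>)\<^sup>2) = 1"
      using assms(1) unfolding bounded_moments_def by blast+
    show "0 < d * n" using assms(2) d by simp
  qed
qed

lemma AE_moment_odd:
  assumes x: "bounded_moments M x" and p: "odd p"
  shows "AE \<omega> in M. (\<lambda>n. (\<Sum>k<n. spec n (\<lambda>i. x i \<omega>) k ^ p) / real n) \<longlonglongrightarrow> 0"
proof -
  obtain B where B: "B \<ge> 1" "\<And>i k. k \<le> 2 * p \<Longrightarrow> \<bar>\<integral>\<omega>. x i \<omega> ^ k \<partial>M\<bar> \<le> B"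
    using bounded_moments_uniform[OF x] by blast
  define T where "T n \<omega> = Re (\<Sum>a<d * Suc n. fpow (d * Suc n) (tmat \<phi> (d * Suc n) (\<lambda>c. x (\<iota> (Suc n) c) \<omega>)) p a a)" for n \<omega>
  \<comment> \<open>\<open>2 + p\<close> is the exponent of n in the square of the normalisation
    \<open>n * sqrt n ^ p\<close>.\<close>
  define X where "X n \<omega> = (T n \<omega>)\<^sup>2 / (real (Suc n) ^ (2 + p))" for n \<omega>
  define K where "K = real (p ^ (2 * p)) * (4 * B ^ (2 * p)) * real d ^ p"
  have *: "integrable M (X n) \<and> (\<integral>\<omega>. X n \<omega> \<partial>M) \<le> K * (1 / real (Suc n) ^ 2)" for n
  proof -
    define N where "N = d * Suc n"
    interpret torus_model M N "\<lambda>c. x (\<iota> (Suc n) c)" \<phi>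
      unfolding N_def by (rule torus_modelI[OF x]) simp
    have T: "T n = tr p" by (rule ext) (simp only: T_def tr_def N_def[symmetric])
    have "\<bar>mom a j\<bar> \<le> B" if "j \<le> 2 * p" for a j using B(2)[OF that] by (simp add: mom_def)
    note s = second_moment_odd[OF p this B(1)]
    have "(\<integral>\<omega>. X n \<omega> \<partial>M) = expectation (\<lambda>\<omega>. (tr p \<omega>)\<^sup>2) / real (Suc n) ^ (2 + p)"
      unfolding X_def T by simp
    also have "\<dots> \<le> real (p ^ (2 * p)) * (4 * B ^ (2 * p)) * real N ^ p / real (Suc n) ^ (2 + p)"
      by (intro divide_right_mono s) auto
    also have "\<dots> = K * (1 / real (Suc n) ^ 2)"
      by (simp add: K_def N_def power_add power_mult_distrib power2_eq_square field_simps del: of_nat_Suc mult_Suc_right)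
    finally have "(\<integral>\<omega>. X n \<omega> \<partial>M) \<le> K * (1 / real (Suc n) ^ 2)" .
    moreover have "integrable M (X n)" using s(1) unfolding X_def T by simp
    ultimately show ?thesis by blast
  qed
  have summ: "summable (\<lambda>n. K * (1 / real (Suc n) ^ 2))"
    by (intro summable_mult summable_inverse_Suc_square)
  have nn: "X n \<omega> \<ge> 0" for n \<omega> by (simp add: X_def)
  have "AE \<omega> in M. (\<lambda>n. X n \<omega>) \<longlonglongrightarrow> 0"
    by (rule AE_tendsto_0_if_summable_expectation[OF _ nn _ summ]) (use * in blast)+
  then show ?thesis
  proof eventually_elim
    case (elim \<omega>)
    have "X n \<omega> = ((\<Sum>k<Suc n. spec (Suc n) (\<lambda>i. x i \<omega>) k ^ p) / real (Suc n))\<^sup>2" for n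
    proof -
      have "(real (Suc n) * sqrt (real (Suc n)) ^ p)\<^sup>2 = real (Suc n) ^ 2 * ((sqrt (real (Suc n)))\<^sup>2) ^ p"
        unfolding power_mult_distrib by (simp only: power_mult[symmetric] mult.commute[of p 2])
      also have "\<dots> = real (Suc n) ^ (2 + p)" by (simp only: real_sqrt_pow2[OF of_nat_0_le_iff] power_add)
      finally have q: "(real (Suc n) * sqrt (real (Suc n)) ^ p)\<^sup>2 = real (Suc n) ^ (2 + p)" .
      show ?thesis unfolding X_def spec_moment[OF zero_less_Suc odd_pos[OF p]] power_divide q T_def ..
    qed
    with elim have sq: "(\<lambda>n. ((\<Sum>k<Suc n. spec (Suc n) (\<lambda>i. x i \<omega>) k ^ p) / real (Suc n))\<^sup>2) \<longlonglongrightarrow> 0" by simp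
    then have "(\<lambda>n. \<bar>(\<Sum>k<Suc n. spec (Suc n) (\<lambda>i. x i \<omega>) k ^ p) / real (Suc n)\<bar>) \<longlonglongrightarrow> 0"
      using tendsto_real_sqrt[OF sq] by (simp only: real_sqrt_abs real_sqrt_zero)
    then have "(\<lambda>n. (\<Sum>k<Suc n. spec (Suc n) (\<lambda>i. x i \<omega>) k ^ p) / real (Suc n)) \<longlonglongrightarrow> 0"
      by (rule tendsto_rabs_zero_cancel)
    then show ?case by (rule LIMSEQ_imp_Suc)
  qed
qed

lemma AE_moment_even:
  assumes x: "bounded_moments M x" and k: "k \<ge> 1"
  shows "AE \<omega> in M. (\<lambda>n. (\<Sum>j<n. spec n (\<lambda>i. x i \<omega>) j ^ (2 * k)) / real n) \<longlonglongrightarrow> lim_mom (2 * k)"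
proof -
  define p where "p = 2 * k"
  obtain B where B: "B \<ge> 1" "\<And>i j. j \<le> 4 * p \<Longrightarrow> \<bar>\<integral>\<omega>. x i \<omega> ^ j \<partial>M\<bar> \<le> B"
    using bounded_moments_uniform[OF x] by blast
  define T where "T n \<omega> = Re (\<Sum>a<d * Suc n. fpow (d * Suc n) (tmat \<phi> (d * Suc n) (\<lambda>c. x (\<iota> (Suc n) c) \<omega>)) p a a)" for n \<omega>
  define E where "E n = integral\<^sup>L M (T n)" for n
  define X where "X n \<omega> = (T n \<omega> - E n) ^ 4 / (real (Suc n) ^ Suc k) ^ 4" for n \<omega>
  define K where "K = real (\<Sum>b\<le>2*p. (b ^ p) ^ 4) * (16 * B ^ (4 * p)) * real d ^ 4 * real d ^ (2 * p - 2)"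
  define K' where "K' = real (k ^ (2 * k)) * B ^ (2 * k) * real d ^ k"
  have *: "integrable M (X n) \<and> (\<integral>\<omega>. X n \<omega> \<partial>M) \<le> K * (1 / real (Suc n) ^ 2)
      \<and> cmod (of_real (E n) - trace_main k (d * Suc n)) \<le> K' * real (Suc n) ^ k" for n
  proof -
    define N where "N = d * Suc n"
    interpret torus_model M N "\<lambda>c. x (\<iota> (Suc n) c)" \<phi>
      unfolding N_def by (rule torus_modelI[OF x]) simp
    have T: "T n = tr p" by (rule ext) (simp only: T_def tr_def N_def[symmetric])
    have E: "E n = trE p" by (simp only: E_def trE_def T)
    have pe: "even p" by (simp add: p_def)
    have Bm: "\<bar>mom a j\<bar> \<le> B" if "j \<le> 4 * p" for a j using B(2)[OF that] by (simp add: mom_def)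
    note s = fourth_moment[OF pe Bm B(1)]
    have "(\<integral>\<omega>. X n \<omega> \<partial>M) = expectation (\<lambda>\<omega>. (tr p \<omega> - trE p) ^ 4) / (real (Suc n) ^ Suc k) ^ 4"
      unfolding X_def T E by simp
    also have "\<dots> \<le> real (\<Sum>b\<le>2*p. (b ^ p) ^ 4) * (16 * B ^ (4 * p)) * real N ^ 4 * real N ^ (2 * p - 2)
        / (real (Suc n) ^ Suc k) ^ 4"
      by (intro divide_right_mono s) auto
    also have "\<dots> = K * (real (Suc n) ^ 4 * real (Suc n) ^ (2 * p - 2) / (real (Suc n) ^ Suc k) ^ 4)"
      by (simp only: K_def N_def of_nat_mult power_mult_distrib mult_ac times_divide_eq_right)
    also have "(real (Suc n) ^ Suc k) ^ 4 = real (Suc n) ^ 4 * real (Suc n) ^ (2 * p - 2) * real (Suc n) ^ 2"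
    proof -
      \<comment> \<open>With \<open>p = 2 * k\<close> the normalisation exceeds the fourth-moment
        bound by exactly two powers of n, which makes the expectations summable.\<close>
      have "Suc k * 4 = 4 + (2 * p - 2) + 2" using k by (simp add: p_def)
      then show ?thesis by (simp only: power_mult[symmetric] power_add[symmetric])
    qed
    also have "real (Suc n) ^ 4 * real (Suc n) ^ (2 * p - 2) / (real (Suc n) ^ 4 * real (Suc n) ^ (2 * p - 2) * real (Suc n) ^ 2)
        = 1 / real (Suc n) ^ 2"
      by (simp del: of_nat_Suc)
    finally have 1: "(\<integral>\<omega>. X n \<omega> \<partial>M) \<le> K * (1 / real (Suc n) ^ 2)" .
    have "cmod (of_real (trE (2 * k)) - trace_main k N) \<le> real (k ^ (2 * k)) * B ^ (2 * k) * real N ^ k"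
      using Bm by (intro mean_even k B(1)) (auto simp: p_def)
    also have "\<dots> = K' * real (Suc n) ^ k" by (simp only: K'_def N_def of_nat_mult power_mult_distrib mult_ac)
    finally have 2: "cmod (of_real (E n) - trace_main k (d * Suc n)) \<le> K' * real (Suc n) ^ k"
      unfolding E p_def N_def .
    have "integrable M (X n)" using s(1) unfolding X_def T E by simp
    with 1 2 show ?thesis by blast
  qed
  have summ: "summable (\<lambda>n. K * (1 / real (Suc n) ^ 2))"
    by (intro summable_mult summable_inverse_Suc_square)
  have nn: "X n \<omega> \<ge> 0" for n \<omega> by (simp add: X_def)
  have AEX: "AE \<omega> in M. (\<lambda>n. X n \<omega>) \<longlonglongrightarrow> 0"
    by (rule AE_tendsto_0_if_summable_expectation[OF _ nn _ summ]) (use * in blast)+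
  have EL: "(\<lambda>n. E n / real (Suc n) ^ Suc k) \<longlonglongrightarrow> lim_mom p"
  proof -
    let ?t = "\<lambda>n. trace_main k (d * Suc n) / of_nat (Suc n) ^ Suc k"
    \<comment> \<open>The torus sizes \<open>d * Suc n\<close> form a subsequence along which the
      known limit of \<open>trace_main\<close> is read off.\<close>
    have "strict_mono (\<lambda>n. d * Suc n)" using d by (auto simp: strict_mono_def)
    from LIMSEQ_subseq_LIMSEQ[OF trace_main_tendsto this]
    have "(\<lambda>n. trace_main k (d * Suc n) / of_nat (d * Suc n) ^ Suc k) \<longlonglongrightarrow> limit_moment k" by (simp only: comp_def)
    then have "(\<lambda>n. of_nat d ^ Suc k * (trace_main k (d * Suc n) / of_nat (d * Suc n) ^ Suc k)) \<longlonglongrightarrow> of_nat d ^ Suc k * limit_moment k"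
      by (intro tendsto_mult tendsto_const)
    moreover have "of_nat d ^ Suc k * (trace_main k (d * Suc n) / of_nat (d * Suc n) ^ Suc k) = ?t n" for n
    proof -
      have gen: "c ^ q * (t / (c * m) ^ q) = t / m ^ q" if "c \<noteq> 0" for c t m :: complex and q
        using that by (simp add: power_mult_distrib)
      show ?thesis unfolding of_nat_mult by (rule gen) (use d in simp)
    qed
    ultimately have 1: "?t \<longlonglongrightarrow> of_nat d ^ Suc k * limit_moment k" by (simp only:)
    have 2: "(\<lambda>n. of_real (E n) / of_nat (Suc n) ^ Suc k - ?t n) \<longlonglongrightarrow> 0"
    proof (rule tendsto_norm_zero_cancel, rule tendsto_sandwich[OF always_eventually always_eventually])
      show "\<forall>n. 0 \<le> cmod (of_real (E n) / of_nat (Suc n) ^ Suc k - ?t n)" by simp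
      show "\<forall>n. cmod (of_real (E n) / of_nat (Suc n) ^ Suc k - ?t n) \<le> K' * (1 / real (Suc n))"
      proof
        fix n
        have "cmod (of_real (E n) / of_nat (Suc n) ^ Suc k - ?t n) = cmod (of_real (E n) - trace_main k (d * Suc n)) / real (Suc n) ^ Suc k"
          by (simp only: diff_divide_distrib[symmetric] norm_divide norm_power norm_of_nat)
        also have "\<dots> \<le> K' * real (Suc n) ^ k / real (Suc n) ^ Suc k" using * by (intro divide_right_mono) auto
        also have "\<dots> = K' * (1 / real (Suc n))" by (simp add: field_simps del: of_nat_Suc)
        finally show "cmod (of_real (E n) / of_nat (Suc n) ^ Suc k - ?t n) \<le> K' * (1 / real (Suc n))" .
      qed
      have "(\<lambda>n. K' * (1 / real (Suc n))) \<longlonglongrightarrow> K' * 0"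
        by (intro tendsto_mult tendsto_const LIMSEQ_Suc[OF lim_1_over_n])
      then show "(\<lambda>n. K' * (1 / real (Suc n))) \<longlonglongrightarrow> 0" by simp
    qed simp
    have "(\<lambda>n. of_real (E n) / of_nat (Suc n) ^ Suc k) \<longlonglongrightarrow> of_nat d ^ Suc k * limit_moment k"
      using tendsto_add[OF 2 1] by (simp only: diff_add_cancel add_0)
    from tendsto_Re[OF this]
    have "(\<lambda>n. E n / real (Suc n) ^ Suc k) \<longlonglongrightarrow> Re (of_nat d ^ Suc k * limit_moment k)"
    proof -
      have "Re (of_real r / of_nat m ^ q) = r / real m ^ q" for r m q
        by (metis Re_complex_of_real of_real_divide of_real_of_nat_eq of_real_power)
      with \<open>(\<lambda>n. Re (of_real (E n) / of_nat (Suc n) ^ Suc k)) \<longlonglongrightarrow> Re (of_nat d ^ Suc k * limit_moment k)\<close>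
      show ?thesis by (simp only:)
    qed
    also have "Re (of_nat d ^ Suc k * limit_moment k) = lim_mom p"
    proof -
      have "of_nat d ^ Suc k * limit_moment k = of_real (real d ^ Suc k) * limit_moment k" by simp
      then have "Re (of_nat d ^ Suc k * limit_moment k) = real d ^ Suc k * Re (limit_moment k)"
        by (simp only: Re_of_real_mult)
      then show ?thesis using k by (simp add: lim_mom_def p_def)
    qed
    finally show ?thesis .
  qed
  from AEX show ?thesis
  proof eventually_elim
    case (elim \<omega>)
    define D where "D n = (T n \<omega> - E n) / real (Suc n) ^ Suc k" for n
    have "X n \<omega> = D n ^ 4" for n by (simp only: X_def D_def power_divide)
    with elim have "(\<lambda>n. D n ^ 4) \<longlonglongrightarrow> 0" by (simp only:)
    then have "(\<lambda>n. root 4 (D n ^ 4)) \<longlonglongrightarrow> root 4 0" by (rule tendsto_real_root)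
    moreover have "root 4 (D n ^ 4) = \<bar>D n\<bar>" for n
      using real_root_power_cancel[of 4 "\<bar>D n\<bar>"] by (simp add: power_even_abs)
    ultimately have "(\<lambda>n. \<bar>D n\<bar>) \<longlonglongrightarrow> 0" by (simp only: real_root_zero)
    then have "D \<longlonglongrightarrow> 0" by (rule tendsto_rabs_zero_cancel)
    from tendsto_add[OF this EL] have "(\<lambda>n. T n \<omega> / real (Suc n) ^ Suc k) \<longlonglongrightarrow> lim_mom p"
      by (simp only: D_def add_divide_distrib[symmetric] diff_add_cancel add_0)
    moreover have "T n \<omega> / real (Suc n) ^ Suc k = (\<Sum>j<Suc n. spec (Suc n) (\<lambda>i. x i \<omega>) j ^ p) / real (Suc n)" for n
    proof -
      have "real (Suc n) * sqrt (real (Suc n)) ^ p = real (Suc n) * ((sqrt (real (Suc n)))\<^sup>2) ^ k"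
        by (simp only: p_def power_mult)
      also have "\<dots> = real (Suc n) ^ Suc k" by simp
      finally have q: "real (Suc n) * sqrt (real (Suc n)) ^ p = real (Suc n) ^ Suc k" .
      have pp: "p > 0" using k by (simp add: p_def)
      show ?thesis unfolding spec_moment[OF zero_less_Suc pp] q T_def ..
    qed
    ultimately have "(\<lambda>n. (\<Sum>j<Suc n. spec (Suc n) (\<lambda>i. x i \<omega>) j ^ p) / real (Suc n)) \<longlonglongrightarrow> lim_mom p" by (simp only:)
    then show ?case unfolding p_def by (rule LIMSEQ_imp_Suc)
  qed
qed

lemma AE_moments:
  assumes x: "bounded_moments M x"
  shows "AE \<omega> in M. \<forall>p. (\<lambda>n. (\<Sum>j<n. spec n (\<lambda>i. x i \<omega>) j ^ p) / real n) \<longlonglongrightarrow> lim_mom p"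
proof -
  have "AE \<omega> in M. (\<lambda>n. (\<Sum>j<n. spec n (\<lambda>i. x i \<omega>) j ^ p) / real n) \<longlonglongrightarrow> lim_mom p" for p
  proof -
    consider "p = 0" | "odd p" | k where "p = 2 * k" "k \<ge> 1"
      by (cases "even p"; cases "p = 0") (auto elim!: evenE)
    then show ?thesis
    proof cases
      case 1
      have "(\<lambda>n. (\<Sum>j<Suc n. 1) / real (Suc n)) \<longlonglongrightarrow> 1" by (simp del: of_nat_Suc)
      then have "(\<lambda>n. (\<Sum>j<n. 1) / real n) \<longlonglongrightarrow> 1" by (rule LIMSEQ_imp_Suc)
      then show ?thesis using 1 by (simp add: lim_mom_def)
    next
      case 2
      then show ?thesis using AE_moment_odd[OF x 2] tame_lim_mom by (simp add: tame_moments_def)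
    next
      case (3 k)
      show ?thesis unfolding 3(1) by (rule AE_moment_even[OF x 3(2)])
    qed
  qed
  then show ?thesis by (simp add: AE_all_countable)
qed

lemma AE_emp_char:
  assumes x: "bounded_moments M x"
  shows "AE \<omega> in M. \<forall>t. (\<lambda>n. emp_char n (spec n (\<lambda>i. x i \<omega>)) t) \<longlonglongrightarrow> char_of_moments lim_mom t"
  using AE_moments[OF x]
proof eventually_elim
  case (elim \<omega>)
  show ?case
  proof (rule allI, rule moments_to_char(2))
    show "(\<lambda>n. (\<Sum>k<n. spec n (\<lambda>i. x i \<omega>) k ^ p) / real n) \<longlonglongrightarrow> lim_mom p" for p using elim by blast
  qed (rule tame_moments_growth[OF tame_lim_mom])
qed

text \<open>A single outcome from the almost sure event supplies a deterministic sequence of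
  spectra, to which the tightness argument applies.\<close>

lemma lim_distribution_exists:
  assumes x: "bounded_moments M x"
  shows "\<exists>\<mu>. real_distribution \<mu> \<and> char \<mu> = char_of_moments lim_mom"
proof -
  interpret prob_space M using x by (simp add: bounded_moments_def)
  have "AE \<omega> in M. (\<forall>p. (\<lambda>n. (\<Sum>j<n. spec n (\<lambda>i. x i \<omega>) j ^ p) / real n) \<longlonglongrightarrow> lim_mom p) \<and>
     (\<forall>t. (\<lambda>n. emp_char n (spec n (\<lambda>i. x i \<omega>)) t) \<longlonglongrightarrow> char_of_moments lim_mom t)"
    using AE_moments[OF x] AE_emp_char[OF x] by eventually_elim auto
  from eventually_happens'[OF ae_filter_bot this]
  obtain \<omega> where w: "\<And>p. (\<lambda>n. (\<Sum>j<n. spec n (\<lambda>i. x i \<omega>) j ^ p) / real n) \<longlonglongrightarrow> lim_mom p"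
    "\<And>t. (\<lambda>n. emp_char n (spec n (\<lambda>i. x i \<omega>)) t) \<longlonglongrightarrow> char_of_moments lim_mom t"
    by blast
  from w(1)[of 2] have "Bseq (\<lambda>n. (\<Sum>j<n. spec n (\<lambda>i. x i \<omega>) j ^ 2) / real n)"
    by (intro convergent_imp_Bseq convergentI)
  then obtain C where C: "\<And>n. norm ((\<Sum>j<n. spec n (\<lambda>i. x i \<omega>) j ^ 2) / real n) \<le> C" by (auto simp: Bseq_def)
  have "(\<Sum>j<n. spec n (\<lambda>i. x i \<omega>) j ^ 2) / real n \<le> C" for n
    by (rule abs_le_D1) (use C[of n] in \<open>simp only: real_norm_def\<close>)
  from limit_distribution_exists[OF this w(2)] show ?thesis by blast
qed

end

section \<open>Independent identically distributed input\<close>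

text \<open>The largest sum of at most K consecutive terms beginning at s, the empty sum included.
  The recursion at the front, rather than a maximum over lengths, is the form that Garsia's argument
  needs.\<close>

primrec mxsum :: "nat \<Rightarrow> (nat \<Rightarrow> real) \<Rightarrow> nat \<Rightarrow> real" where
  "mxsum 0 v s = 0"
| "mxsum (Suc K) v s = max 0 (v s + mxsum K v (Suc s))"

lemma mxsum_nonneg: "mxsum K v s \<ge> 0"
  by (cases K) auto

lemma mxsum_mono: "mxsum K v s \<le> mxsum (Suc K) v s"
proof (induction K arbitrary: s)
  case (Suc K)
  show ?case using Suc[of "Suc s"] by (auto simp: max_def)
qed simp

lemma mxsum_ge: "n \<le> K \<Longrightarrow> (\<Sum>i<n. v (s + i)) \<le> mxsum K v s"
proof (induction n arbitrary: s K)
  case 0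
  then show ?case by (simp add: mxsum_nonneg)
next
  case (Suc n)
  then obtain K' where K: "K = Suc K'" "n \<le> K'" by (cases K) auto
  have "(\<Sum>i<Suc n. v (s + i)) = v s + (\<Sum>i<n. v (Suc s + i))"
    by (subst sum.lessThan_Suc_shift) simp
  with Suc.IH[OF K(2), of "Suc s"] show ?case by (simp add: K(1) max_def)
qed

lemma mxsum_shift: "mxsum K v (Suc s) = mxsum K (\<lambda>i. v (Suc i)) s"
  by (induction K arbitrary: s) auto

lemma mxsum_cong: "(\<And>i. s \<le> i \<Longrightarrow> i < s + K \<Longrightarrow> v i = w i) \<Longrightarrow> mxsum K v s = mxsum K w s"
  by (induction K arbitrary: s) auto

lemma mxsum_le: "mxsum K v s \<le> (\<Sum>i<K. \<bar>v (s + i)\<bar>)"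
proof (induction K arbitrary: s)
  case (Suc K)
  have "(\<Sum>i<Suc K. \<bar>v (s + i)\<bar>) = \<bar>v s\<bar> + (\<Sum>i<K. \<bar>v (Suc s + i)\<bar>)"
    by (subst sum.lessThan_Suc_shift) simp
  moreover have "0 \<le> (\<Sum>i<K. \<bar>v (Suc s + i)\<bar>)" by (simp add: sum_nonneg)
  moreover have "v s + mxsum K v (Suc s) \<le> \<bar>v s\<bar> + (\<Sum>i<K. \<bar>v (Suc s + i)\<bar>)"
    using Suc[of "Suc s"] by linarith
  ultimately show ?case unfolding mxsum.simps by (intro max.boundedI) linarith+
qed simp

lemma mxsum_measurable:
  assumes "\<And>i. s \<le> i \<Longrightarrow> i < s + K \<Longrightarrow> (\<lambda>\<omega>. v \<omega> i) \<in> borel_measurable M"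
  shows "(\<lambda>\<omega>. mxsum K (v \<omega>) s) \<in> borel_measurable M"
  using assms
proof (induction K arbitrary: s)
  case (Suc K)
  have "(\<lambda>\<omega>. mxsum K (v \<omega>) (Suc s)) \<in> borel_measurable M" using Suc.prems by (intro Suc.IH) auto
  moreover have "(\<lambda>\<omega>. v \<omega> s) \<in> borel_measurable M" using Suc.prems by auto
  ultimately show ?case by simp
qed simp

locale iid_sequence = prob_space +
  fixes x :: "nat \<Rightarrow> 'a \<Rightarrow> real"
  assumes indep: "indep_vars (\<lambda>_. borel) x UNIV"
    and same: "distr M borel (x i) = distr M borel (x j)"
begin

lemma x_measurable [measurable]: "x i \<in> borel_measurable M"
  using indep unfolding indep_vars_def by auto

lemma expectation_same:
  assumes [measurable]: "g \<in> borel_measurable borel"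
  shows "expectation (\<lambda>\<omega>. g (x i \<omega>)) = expectation (\<lambda>\<omega>. (g (x 0 \<omega>) :: real))"
proof -
  have "expectation (\<lambda>\<omega>. g (x i \<omega>)) = (\<integral>z. g z \<partial>distr M borel (x i))" by (subst integral_distr) auto
  also have "\<dots> = (\<integral>z. g z \<partial>distr M borel (x 0))" by (subst same[of i 0]) simp
  also have "\<dots> = expectation (\<lambda>\<omega>. g (x 0 \<omega>))" by (subst integral_distr) auto
  finally show ?thesis .
qed

lemma integrable_same:
  assumes [measurable]: "g \<in> borel_measurable borel" and i: "integrable M (\<lambda>\<omega>. g (x 0 \<omega>) :: real)"
  shows "integrable M (\<lambda>\<omega>. g (x i \<omega>))"
proof -
  have "integrable (distr M borel (x 0)) g" using i by (subst integrable_distr_eq) auto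
  then have "integrable (distr M borel (x i)) g" by (subst same[of i 0])
  then show ?thesis by (subst (asm) integrable_distr_eq) auto
qed

text \<open>By independence and equal marginals, both blocks of K variables have the same product
  law. As F takes whole sequences, its dependence on the first K terms alone is a separate
  assumption.\<close>

lemma expectation_shift:
  fixes F :: "(nat \<Rightarrow> real) \<Rightarrow> real"
  assumes F: "F \<in> borel_measurable (Pi\<^sub>M {..<K} (\<lambda>_. borel))"
    and dep: "\<And>v w. (\<And>i. i < K \<Longrightarrow> v i = w i) \<Longrightarrow> F v = F w" and K: "K > 0"
  shows "expectation (\<lambda>\<omega>. F (\<lambda>i. x (Suc i) \<omega>)) = expectation (\<lambda>\<omega>. F (\<lambda>i. x i \<omega>))"
proof -
  have D: "distr M (Pi\<^sub>M {..<K} (\<lambda>_. borel)) (\<lambda>\<omega>. \<lambda>i\<in>{..<K}. y i \<omega>) = Pi\<^sub>M {..<K} (\<lambda>i. distr M borel (y i))"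
    if "indep_vars (\<lambda>_. borel) y {..<K}" for y :: "nat \<Rightarrow> 'a \<Rightarrow> real"
  proof (rule indep_vars_iff_distr_eq_PiM'[THEN iffD1, OF _ _ that])
    show "{..<K} \<noteq> {}" using K by auto
    show "random_variable borel (y i)" if "i \<in> {..<K}" for i
      using \<open>indep_vars (\<lambda>_. borel) y {..<K}\<close> that unfolding indep_vars_def by blast
  qed
  have E: "expectation (\<lambda>\<omega>. F (\<lambda>i. y i \<omega>)) = integral\<^sup>L (Pi\<^sub>M {..<K} (\<lambda>i. distr M borel (y i))) F"
    if y: "indep_vars (\<lambda>_. borel) y {..<K}" for y :: "nat \<Rightarrow> 'a \<Rightarrow> real"
  proof -
    have ym: "y i \<in> borel_measurable M" if "i \<in> {..<K}" for i using y that by (auto simp: indep_vars_def)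
    have m: "(\<lambda>\<omega>. \<lambda>i\<in>{..<K}. y i \<omega>) \<in> measurable M (Pi\<^sub>M {..<K} (\<lambda>_. borel))"
      using ym by (intro measurable_restrict) auto
    have "expectation (\<lambda>\<omega>. F (\<lambda>i. y i \<omega>)) = expectation (\<lambda>\<omega>. F (\<lambda>i\<in>{..<K}. y i \<omega>))"
      by (intro Bochner_Integration.integral_cong refl dep) simp
    also have "\<dots> = integral\<^sup>L (distr M (Pi\<^sub>M {..<K} (\<lambda>_. borel)) (\<lambda>\<omega>. \<lambda>i\<in>{..<K}. y i \<omega>)) F"
      using m F by (subst integral_distr) auto
    finally show ?thesis unfolding D[OF y] .
  qed
  have i1: "indep_vars (\<lambda>_. borel) x {..<K}" by (rule indep_vars_subset[OF indep]) auto
  have i2: "indep_vars (\<lambda>_. borel) (\<lambda>i. x (Suc i)) {..<K}"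
    by (rule indep_vars_inj_reindex[OF indep]) auto
  have "Pi\<^sub>M {..<K} (\<lambda>i. distr M borel (x (Suc i))) = Pi\<^sub>M {..<K} (\<lambda>i. distr M borel (x i))"
    by (intro PiM_cong refl same)
  then show ?thesis using E[OF i1] E[OF i2] by simp
qed

text \<open>Garsia's proof of the maximal ergodic inequality.\<close>

lemma maximal_inequality:
  assumes g: "g \<in> borel_measurable borel" "\<And>z. g z \<ge> 0" "integrable M (\<lambda>\<omega>. g (x 0 \<omega>))" and l: "l > 0"
  shows "prob {\<omega> \<in> space M. \<exists>n\<in>{1..K}. (\<Sum>i<n. g (x i \<omega>)) > l * real n} \<le> expectation (\<lambda>\<omega>. g (x 0 \<omega>)) / l"
proof -
  note [measurable] = g(1)
  define f where "f z = g z - l" for z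
  have [measurable]: "f \<in> borel_measurable borel" unfolding f_def by measurable
  have fi: "integrable M (\<lambda>\<omega>. f (x i \<omega>))" for i
    unfolding f_def using integrable_same[OF g(1,3)] by (intro Bochner_Integration.integrable_diff) auto
  define X where "X K s \<omega> = mxsum K (\<lambda>i. f (x i \<omega>)) s" for K s \<omega>
  have Xm [measurable]: "X K s \<in> borel_measurable M" for K s
    unfolding X_def[abs_def] by (intro mxsum_measurable) measurable
  have Xi: "integrable M (X K s)" for K s
  proof (rule Bochner_Integration.integrable_bound)
    show "integrable M (\<lambda>\<omega>. \<Sum>i<K. \<bar>f (x (s + i) \<omega>)\<bar>)" using fi by auto
    show "AE \<omega> in M. norm (X K s \<omega>) \<le> norm (\<Sum>i<K. \<bar>f (x (s + i) \<omega>)\<bar>)"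
      using mxsum_le mxsum_nonneg by (intro AE_I2) (simp add: X_def sum_nonneg)
  qed measurable
  \<comment> \<open>Stationarity: maximal sums begun at index 1 have the same mean as those begun at
    index 0.\<close>
  have shift: "expectation (X K 1) = expectation (X K 0)"
  proof (cases "K = 0")
    case False
    define F where "F v = mxsum K (\<lambda>i. f (v i)) 0" for v
    have Fm: "F \<in> borel_measurable (Pi\<^sub>M {..<K} (\<lambda>_. borel))"
      unfolding F_def[abs_def]
    proof (rule mxsum_measurable)
      fix i assume "i < 0 + K"
      then have "(\<lambda>v. v i) \<in> borel_measurable (Pi\<^sub>M {..<K} (\<lambda>_. borel :: real measure))"
        by (intro measurable_component_singleton) auto
      then show "(\<lambda>v. f (v i)) \<in> borel_measurable (Pi\<^sub>M {..<K} (\<lambda>_. borel))" by measurable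
    qed
    have Fd: "F v = F w" if "\<And>i. i < K \<Longrightarrow> v i = w i" for v w
      unfolding F_def using that by (intro mxsum_cong) auto
    have "K > 0" using False by simp
    from expectation_shift[OF Fm Fd this]
    have "expectation (\<lambda>\<omega>. F (\<lambda>i. x (Suc i) \<omega>)) = expectation (\<lambda>\<omega>. F (\<lambda>i. x i \<omega>))" .
    then show ?thesis by (simp add: F_def X_def[abs_def] mxsum_shift)
  qed (simp add: X_def[abs_def])
  define A where "A = {\<omega> \<in> space M. X (Suc K) 0 \<omega> > 0}"
  have [measurable]: "A \<in> sets M" unfolding A_def by measurable
  have iA: "integrable M (\<lambda>\<omega>. indicator A \<omega> * Y \<omega>)" if "integrable M Y" for Y :: "'a \<Rightarrow> real"
    using integrable_mult_indicator[OF _ that, of A] by simp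
  have "expectation (X K 0) \<le> expectation (X (Suc K) 0)"
    by (rule integral_mono[OF Xi Xi]) (simp only: X_def mxsum_mono)
  then have "0 \<le> expectation (X (Suc K) 0) - expectation (X K 0)" by simp
  also have "\<dots> = expectation (\<lambda>\<omega>. X (Suc K) 0 \<omega> - X K 1 \<omega>)"
    using shift Xi by simp
  also have "\<dots> \<le> expectation (\<lambda>\<omega>. indicator A \<omega> * f (x 0 \<omega>))"
  proof (rule integral_mono[OF _ iA[OF fi]])
    show "integrable M (\<lambda>\<omega>. X (Suc K) 0 \<omega> - X K 1 \<omega>)" using Xi by auto
    fix \<omega> assume w: "\<omega> \<in> space M"
    \<comment> \<open>On A the maximum is attained by the second argument, so the difference is
      exactly \<open>f (x 0 \<omega>)\<close>; off A the left term is 0 and the difference is at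
      most 0.\<close>
    have "X (Suc K) 0 \<omega> = max 0 (f (x 0 \<omega>) + X K 1 \<omega>)" by (simp add: X_def)
    moreover have "X K 1 \<omega> \<ge> 0" by (simp add: X_def mxsum_nonneg)
    ultimately show "X (Suc K) 0 \<omega> - X K 1 \<omega> \<le> indicator A \<omega> * f (x 0 \<omega>)"
      using w by (auto simp: A_def indicator_def max_def)
  qed
  also have "\<dots> = expectation (\<lambda>\<omega>. indicator A \<omega> * g (x 0 \<omega>)) - l * prob A"
  proof -
    have "(\<lambda>\<omega>. indicator A \<omega> * f (x 0 \<omega>)) = (\<lambda>\<omega>. indicator A \<omega> * g (x 0 \<omega>) - l * indicator A \<omega>)"
      by (simp add: f_def algebra_simps fun_eq_iff)
    then show ?thesis using iA[OF g(3)] by (simp add: emeasure_eq_measure)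
  qed
  also have "expectation (\<lambda>\<omega>. indicator A \<omega> * g (x 0 \<omega>)) \<le> expectation (\<lambda>\<omega>. g (x 0 \<omega>))"
    using g(2) by (intro integral_mono[OF iA[OF g(3)] g(3)]) (auto simp: indicator_def)
  finally have "l * prob A \<le> expectation (\<lambda>\<omega>. g (x 0 \<omega>))" by simp
  then have PA: "prob A \<le> expectation (\<lambda>\<omega>. g (x 0 \<omega>)) / l" using l by (simp add: pos_le_divide_eq mult.commute)
  have "{\<omega> \<in> space M. \<exists>n\<in>{1..K}. (\<Sum>i<n. g (x i \<omega>)) > l * real n} \<subseteq> A"
  proof
    fix \<omega> assume "\<omega> \<in> {\<omega> \<in> space M. \<exists>n\<in>{1..K}. (\<Sum>i<n. g (x i \<omega>)) > l * real n}"
    then obtain n where w: "\<omega> \<in> space M" and n: "n \<le> K" "(\<Sum>i<n. g (x i \<omega>)) > l * real n" by auto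
    have "(\<Sum>i<n. f (x (0 + i) \<omega>)) \<le> X (Suc K) 0 \<omega>"
      unfolding X_def using n(1) by (intro mxsum_ge[of n "Suc K" "\<lambda>i. f (x i \<omega>)" 0]) simp
    then have "(\<Sum>i<n. g (x i \<omega>)) - l * real n \<le> X (Suc K) 0 \<omega>"
      by (simp add: f_def sum_subtractf mult.commute)
    with n(2) w show "\<omega> \<in> A" by (simp add: A_def)
  qed
  then have "prob {\<omega> \<in> space M. \<exists>n\<in>{1..K}. (\<Sum>i<n. g (x i \<omega>)) > l * real n} \<le> prob A"
    by (intro finite_measure_mono) auto
  with PA show ?thesis by linarith
qed

lemma maximal_inequality_all:
  assumes g: "g \<in> borel_measurable borel" "\<And>z. g z \<ge> 0" "integrable M (\<lambda>\<omega>. g (x 0 \<omega>))" and l: "l > 0"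
  shows "{\<omega> \<in> space M. \<exists>n\<ge>1. (\<Sum>i<n. g (x i \<omega>)) > l * real n} \<in> events"
    "prob {\<omega> \<in> space M. \<exists>n\<ge>1. (\<Sum>i<n. g (x i \<omega>)) > l * real n} \<le> expectation (\<lambda>\<omega>. g (x 0 \<omega>)) / l"
proof -
  note [measurable] = g(1)
  show "{\<omega> \<in> space M. \<exists>n\<ge>1. (\<Sum>i<n. g (x i \<omega>)) > l * real n} \<in> events" by measurable
  define A where "A K = {\<omega> \<in> space M. \<exists>n\<in>{1..K}. (\<Sum>i<n. g (x i \<omega>)) > l * real n}" for K
  have "range A \<subseteq> events" unfolding A_def by auto
  moreover have "incseq A" by (auto simp: A_def incseq_def)
  ultimately have "(\<lambda>K. prob (A K)) \<longlonglongrightarrow> prob (\<Union>K. A K)" by (rule finite_Lim_measure_incseq)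
  moreover have "(\<Union>K. A K) = {\<omega> \<in> space M. \<exists>n\<ge>1. (\<Sum>i<n. g (x i \<omega>)) > l * real n}"
    by (auto simp: A_def) (meson atLeastAtMost_iff order_refl)
  ultimately have "(\<lambda>K. prob (A K)) \<longlonglongrightarrow> prob {\<omega> \<in> space M. \<exists>n\<ge>1. (\<Sum>i<n. g (x i \<omega>)) > l * real n}" by simp
  then show "prob {\<omega> \<in> space M. \<exists>n\<ge>1. (\<Sum>i<n. g (x i \<omega>)) > l * real n} \<le> expectation (\<lambda>\<omega>. g (x 0 \<omega>)) / l"
    by (rule LIMSEQ_le_const2) (use maximal_inequality[OF g l] in \<open>auto simp: A_def\<close>)
qed

end

section \<open>Truncation of square integrable input\<close>

locale standardized_iid = iid_sequence +
  assumes int1: "integrable M (x 0)" and mean0: "expectation (x 0) = 0"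
    and int2: "integrable M (\<lambda>\<omega>. x 0 \<omega> ^ 2)" and var1: "expectation (\<lambda>\<omega>. x 0 \<omega> ^ 2) = 1"
begin

text \<open>Cutting off at a high level changes the mean and the variance only slightly; recentring
  and rescaling restore 0 and 1 at a small cost in mean square.\<close>

lemma truncation_exists:
  assumes \<delta>: "\<delta> > 0"
  obtains h where "h \<in> borel_measurable borel" "\<exists>C. \<forall>z. \<bar>h z\<bar> \<le> C"
    "expectation (\<lambda>\<omega>. h (x 0 \<omega>)) = 0" "expectation (\<lambda>\<omega>. h (x 0 \<omega>) ^ 2) = 1"
    "integrable M (\<lambda>\<omega>. (x 0 \<omega> - h (x 0 \<omega>)) ^ 2)"
    "expectation (\<lambda>\<omega>. (x 0 \<omega> - h (x 0 \<omega>)) ^ 2) \<le> \<delta>"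
proof -
  define T where "T n z = (if \<bar>z\<bar> \<le> real n then z else 0)" for n and z :: real
  have Tm [measurable]: "T n \<in> borel_measurable borel" for n unfolding T_def by measurable
  have Tb: "\<bar>T n z\<bar> \<le> real n" "\<bar>T n z\<bar> \<le> \<bar>z\<bar>" for n z by (auto simp: T_def)
  have Tl: "(\<lambda>n. T n z) \<longlonglongrightarrow> z" for z
  proof (rule tendsto_eventually)
    show "\<forall>\<^sub>F n in sequentially. T n z = z"
      using eventually_ge_at_top[of "nat \<lceil>\<bar>z\<bar>\<rceil>"] by eventually_elim (auto simp: T_def; linarith)
  qed
  define \<mu> where "\<mu> n = expectation (\<lambda>\<omega>. T n (x 0 \<omega>))" for n
  define a where "a n = expectation (\<lambda>\<omega>. T n (x 0 \<omega>) ^ 2)" for n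
  define \<sigma> where "\<sigma> n = sqrt (a n - (\<mu> n)\<^sup>2)" for n
  have \<mu>: "\<mu> \<longlonglongrightarrow> 0"
    unfolding \<mu>_def[abs_def] mean0[symmetric]
    by (rule integral_dominated_convergence[where w = "\<lambda>\<omega>. \<bar>x 0 \<omega>\<bar>"])
       (use int1 Tl Tb in auto)
  have a: "a \<longlonglongrightarrow> 1"
    unfolding a_def[abs_def] var1[symmetric]
  proof (rule integral_dominated_convergence[where w = "\<lambda>\<omega>. x 0 \<omega> ^ 2"])
    show "AE \<omega> in M. (\<lambda>n. (T n (x 0 \<omega>))\<^sup>2) \<longlonglongrightarrow> (x 0 \<omega>)\<^sup>2" using Tl by (intro AE_I2 tendsto_power)
    show "AE \<omega> in M. norm ((T n (x 0 \<omega>))\<^sup>2) \<le> (x 0 \<omega>)\<^sup>2" for n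
      using Tb(2) by (intro AE_I2) (simp add: abs_le_square_iff)
  qed (use int2 in auto)
  have "(\<lambda>n. sqrt (a n - (\<mu> n)\<^sup>2)) \<longlonglongrightarrow> sqrt (1 - 0\<^sup>2)"
    by (intro tendsto_real_sqrt tendsto_diff tendsto_power a \<mu>)
  then have \<sigma>: "\<sigma> \<longlonglongrightarrow> 1" by (simp add: \<sigma>_def[abs_def])
  \<comment> \<open>This is the mean square distance between x and its standardised truncation: both
    have second moment 1, and the mean of their product is \<open>a n / \<sigma> n\<close>, because
    z times its truncation is the square of the truncation.\<close>
  have "(\<lambda>n. 2 - 2 * (a n / \<sigma> n)) \<longlonglongrightarrow> 2 - 2 * (1 / 1)"
    by (intro tendsto_diff tendsto_mult tendsto_divide tendsto_const a \<sigma>) simp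
  then have "\<forall>\<^sub>F n in sequentially. 2 - 2 * (a n / \<sigma> n) < \<delta>" using \<delta> by (intro order_tendstoD) auto
  moreover have "\<forall>\<^sub>F n in sequentially. \<sigma> n > 0" using \<sigma> by (intro order_tendstoD) auto
  ultimately have "\<forall>\<^sub>F n in sequentially. 2 - 2 * (a n / \<sigma> n) < \<delta> \<and> \<sigma> n > 0" by eventually_elim auto
  then obtain n where n: "2 - 2 * (a n / \<sigma> n) < \<delta>" "\<sigma> n > 0" by (auto simp: eventually_sequentially)
  have s2: "(\<sigma> n)\<^sup>2 = a n - (\<mu> n)\<^sup>2" using n(2) by (simp add: \<sigma>_def)
  have iT: "integrable M (\<lambda>\<omega>. T n (x 0 \<omega>))"
    using Tb(1) by (intro integrable_const_bound[where B = "real n"]) auto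
  have iT2: "integrable M (\<lambda>\<omega>. T n (x 0 \<omega>) ^ 2)"
    using Tb(2) by (intro Bochner_Integration.integrable_bound[OF int2]) (auto simp: abs_le_square_iff)
  define h where "h z = (T n z - \<mu> n) / \<sigma> n" for z
  have hm: "h \<in> borel_measurable borel" unfolding h_def[abs_def] by measurable
  have h2: "h z ^ 2 = (T n z ^ 2 - 2 * \<mu> n * T n z + (\<mu> n)\<^sup>2) / (\<sigma> n)\<^sup>2" for z
    by (simp add: h_def power_divide power2_diff algebra_simps)
  have Eh: "expectation (\<lambda>\<omega>. h (x 0 \<omega>)) = 0"
    unfolding h_def using iT by (simp add: \<mu>_def prob_space)
  have Eh2: "expectation (\<lambda>\<omega>. h (x 0 \<omega>) ^ 2) = 1"
  proof -
    have "expectation (\<lambda>\<omega>. h (x 0 \<omega>) ^ 2) = (a n - 2 * \<mu> n * \<mu> n + (\<mu> n)\<^sup>2) / (\<sigma> n)\<^sup>2"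
      unfolding h2 using iT iT2 by (simp add: a_def \<mu>_def prob_space)
    also have "\<dots> = 1" using n(2) unfolding s2[symmetric] by (simp add: s2 power2_eq_square) (metis n(2) less_irrefl power2_eq_square power_zero_numeral s2 zero_power2)
    finally show ?thesis .
  qed
  have xT: "z * T n z = T n z ^ 2" for z by (simp add: T_def power2_eq_square)
  have sq: "(z - h z) ^ 2 = z ^ 2 - 2 * ((T n z ^ 2 - \<mu> n * z) / \<sigma> n) + h z ^ 2" for z
  proof -
    have "z * h z = (T n z ^ 2 - \<mu> n * z) / \<sigma> n"
      unfolding h_def using xT[of z] by (simp add: algebra_simps)
    then show ?thesis by (simp add: power2_diff mult.assoc)
  qed
  have ih2: "integrable M (\<lambda>\<omega>. h (x 0 \<omega>) ^ 2)" unfolding h2 using iT iT2 by simp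
  have isq: "integrable M (\<lambda>\<omega>. (x 0 \<omega> - h (x 0 \<omega>)) ^ 2)"
    unfolding sq using int1 int2 iT2 ih2 by simp
  have "expectation (\<lambda>\<omega>. (x 0 \<omega> - h (x 0 \<omega>)) ^ 2) = 1 - 2 * (a n / \<sigma> n) + 1"
    unfolding sq using int1 int2 iT2 ih2 by (simp add: var1 Eh2 mean0 a_def)
  then have Esq: "expectation (\<lambda>\<omega>. (x 0 \<omega> - h (x 0 \<omega>)) ^ 2) \<le> \<delta>" using n(1) by simp
  have "\<bar>h z\<bar> \<le> (real n + \<bar>\<mu> n\<bar>) / \<sigma> n" for z
  proof -
    have "\<bar>T n z - \<mu> n\<bar> \<le> real n + \<bar>\<mu> n\<bar>" using Tb(1)[of n z] by linarith
    then show ?thesis using n(2) by (simp add: h_def divide_right_mono)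
  qed
  then have "\<exists>C. \<forall>z. \<bar>h z\<bar> \<le> C" by blast
  with hm Eh Eh2 isq Esq show ?thesis by (intro that)
qed

end

lemma bounded_momentsI:
  fixes x :: "nat \<Rightarrow> 'w \<Rightarrow> real"
  assumes M: "prob_space M" and ind: "prob_space.indep_vars M (\<lambda>_. borel) x UNIV"
    and mean: "\<And>i. integral\<^sup>L M (x i) = 0" and var: "\<And>i. (\<integral>\<omega>. x i \<omega> ^ 2 \<partial>M) = 1"
    and mom: "\<And>k. \<exists>C. \<forall>i. integrable M (\<lambda>\<omega>. \<bar>x i \<omega>\<bar> ^ k) \<and> (\<integral>\<omega>. \<bar>x i \<omega>\<bar> ^ k \<partial>M) \<le> C"
  shows "bounded_moments M x"
proof -
  interpret prob_space M by (rule M)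
  have m: "x i \<in> borel_measurable M" for i using ind by (auto simp: indep_vars_def)
  have eq: "norm (x i \<omega> ^ k) = \<bar>x i \<omega>\<bar> ^ k" for i k \<omega> by (simp add: power_abs)
  have int: "integrable M (\<lambda>\<omega>. x i \<omega> ^ k)" for i k
  proof -
    have "integrable M (\<lambda>\<omega>. norm (x i \<omega> ^ k))" unfolding eq using mom[of k] by blast
    then show ?thesis using m by (subst (asm) integrable_norm_iff) auto
  qed
  have "\<exists>C. \<forall>i. \<bar>\<integral>\<omega>. x i \<omega> ^ k \<partial>M\<bar> \<le> C" for k
  proof -
    obtain C where C: "\<And>i. (\<integral>\<omega>. \<bar>x i \<omega>\<bar> ^ k \<partial>M) \<le> C" using mom[of k] by blast
    have "\<bar>\<integral>\<omega>. x i \<omega> ^ k \<partial>M\<bar> \<le> C" for i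
      using integral_norm_bound[of M "\<lambda>\<omega>. x i \<omega> ^ k"] C[of i] unfolding eq by simp
    then show ?thesis by blast
  qed
  then show ?thesis unfolding bounded_moments_def using M ind mean var int by blast
qed

lemma bounded_moments_bounded:
  fixes x :: "nat \<Rightarrow> 'w \<Rightarrow> real"
  assumes M: "prob_space M" and ind: "prob_space.indep_vars M (\<lambda>_. borel) x UNIV"
    and mean: "\<And>i. integral\<^sup>L M (x i) = 0" and var: "\<And>i. (\<integral>\<omega>. x i \<omega> ^ 2 \<partial>M) = 1"
    and C: "\<And>i. AE \<omega> in M. \<bar>x i \<omega>\<bar> \<le> C"
  shows "bounded_moments M x"
proof (rule bounded_momentsI[OF M ind mean var])
  interpret prob_space M by (rule M)
  have [measurable]: "x i \<in> borel_measurable M" for i using ind by (auto simp: indep_vars_def)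
  fix k
  have b: "AE \<omega> in M. \<bar>x i \<omega>\<bar> ^ k \<le> \<bar>C\<bar> ^ k" for i
    using C[of i] by eventually_elim (intro power_mono, auto)
  have i: "integrable M (\<lambda>\<omega>. \<bar>x i \<omega>\<bar> ^ k)" for i
    using b[of i] by (intro integrable_const_bound[where B = "\<bar>C\<bar> ^ k"]) auto
  have "(\<integral>\<omega>. \<bar>x i \<omega>\<bar> ^ k \<partial>M) \<le> \<bar>C\<bar> ^ k" for i
    by (rule integral_le_const[OF i b])
  with i show "\<exists>C. \<forall>i. integrable M (\<lambda>\<omega>. \<bar>x i \<omega>\<bar> ^ k) \<and> (\<integral>\<omega>. \<bar>x i \<omega>\<bar> ^ k \<partial>M) \<le> C" by blast
qed

lemma input_sequence_cases:
  assumes "input_sequence M x"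
  shows "bounded_moments M x \<or> standardized_iid M x"
proof -
  interpret prob_space M using assms by (simp add: input_sequence_def)
  have std: "integrable M (X)" "expectation X = 0" "expectation (\<lambda>\<omega>. X \<omega> ^ 2) = 1"
    if "standardized X" for X
    using that unfolding standardized_def by auto
  consider (1) "input_A1 x" | (2) "input_A2 x" | (3) "input_A3 x"
    using assms unfolding input_sequence_def by blast
  then show ?thesis
  proof cases
    case 1
    then obtain C where "\<And>i. AE \<omega> in M. \<bar>x i \<omega>\<bar> \<le> C" unfolding input_A1_def by blast
    then have "bounded_moments M x"
      using 1 std unfolding input_A1_def by (intro bounded_moments_bounded prob_space_axioms) blast+
    then show ?thesis ..
  next
    case 2
    have s: "standardized (x 0)" using 2 by (simp add: input_A2_def)
    \<comment> \<open>The Bochner integral of a non-integrable function is 0 by convention, so a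
      second moment equal to 1 forces integrability.\<close>
    have "integrable M (\<lambda>\<omega>. x 0 \<omega> ^ 2)"
      using std(3)[OF s] by (rule_tac ccontr) (simp add: not_integrable_integral_eq)
    then have "standardized_iid M x"
      using 2 std[OF s] unfolding input_A2_def by unfold_locales blast+
    then show ?thesis ..
  next
    case 3
    then have "bounded_moments M x"
      using std unfolding input_A3_def by (intro bounded_momentsI prob_space_axioms) blast+
    then show ?thesis ..
  qed
qed

section \<open>Transfer from truncated input to i.i.d. input\<close>

context torus_family
begin

text \<open>Within a row of the corner each input occurs at most once. With n rows and the factor
  1/n from the scaling, the squared Hilbert-Schmidt distance is at most the sum of the squared input
  differences; indices up to \<open>2 * n\<close> give \<open>2 * n + 1\<close> terms.\<close>

lemma emp_char_diff:
  assumes n: "n > 0"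
  shows "cmod (emp_char n (spec n x) t - emp_char n (spec n y) t)
    \<le> \<bar>t\<bar> * sqrt ((\<Sum>m<2 * n + 1. (x m - y m)\<^sup>2) / real n)"
proof -
  define N where "N = d * n"
  have Nn: "n \<le> N" using d by (simp add: N_def)
  define D where "D = (\<Sum>m<2 * n + 1. (x m - y m)\<^sup>2)"
  obtain u v where u: "eigensystem n (hmat n x) u (spec n x)" and v: "eigensystem n (hmat n y) v (spec n y)"
    using spec[of n x] spec[of n y] unfolding is_spec_def by blast
  have ent: "(cmod (hmat n x i j - hmat n y i j))\<^sup>2 \<le> (1 / real n) * (x (\<iota> n ((i + j) mod N)) - y (\<iota> n ((i + j) mod N)))\<^sup>2" for i j
  proof -
    have "hmat n x i j - hmat n y i j = of_real (1 / sqrt (real n)) * (\<phi> (real i / real N) (real j / real N)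
        * of_real (x (\<iota> n ((i + j) mod N)) - y (\<iota> n ((i + j) mod N))))"
      by (simp add: hmat_def tmat_def N_def algebra_simps diff_divide_distrib)
    then have "(cmod (hmat n x i j - hmat n y i j))\<^sup>2 = (1 / real n) * ((cmod (\<phi> (real i / real N) (real j / real N)))\<^sup>2
        * (x (\<iota> n ((i + j) mod N)) - y (\<iota> n ((i + j) mod N)))\<^sup>2)"
      by (simp add: norm_mult norm_divide power_mult_distrib power_divide del: of_real_diff)
    also have "\<dots> \<le> (1 / real n) * (1 * (x (\<iota> n ((i + j) mod N)) - y (\<iota> n ((i + j) mod N)))\<^sup>2)"
      using bound by (intro mult_left_mono mult_right_mono power_le_one) auto
    finally show ?thesis by simp
  qed
  have row: "(\<Sum>j<n. (x (\<iota> n ((i + j) mod N)) - y (\<iota> n ((i + j) mod N)))\<^sup>2) \<le> D" if i: "i < n" for i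
  proof -
    have "inj_on (\<lambda>j. (i + j) mod N) {..<n}"
    proof (rule inj_onI)
      fix j j' assume j: "j \<in> {..<n}" "j' \<in> {..<n}" and eq: "(i + j) mod N = (i + j') mod N"
      have "[i + j = i + j'] (mod N)" using eq by (simp add: cong_def)
      then have "[j = j'] (mod N)" by (simp only: cong_add_lcancel_nat)
      then show "j = j'" using j Nn by (simp add: cong_def)
    qed
    moreover have "inj_on (\<iota> n) ((\<lambda>j. (i + j) mod N) ` {..<n})"
      by (rule inj_on_subset[OF inj[of n]]) (use n Nn in \<open>auto simp: N_def\<close>)
    ultimately have J: "inj_on (\<lambda>j. \<iota> n ((i + j) mod N)) {..<n}"
      using comp_inj_on[of "\<lambda>j. (i + j) mod N" "{..<n}" "\<iota> n"] by (simp add: comp_def)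
    have "(\<Sum>j<n. (x (\<iota> n ((i + j) mod N)) - y (\<iota> n ((i + j) mod N)))\<^sup>2)
        = (\<Sum>m\<in>(\<lambda>j. \<iota> n ((i + j) mod N)) ` {..<n}. (x m - y m)\<^sup>2)"
      by (simp add: sum.reindex[OF J])
    also have "\<dots> \<le> D" unfolding D_def
    proof (rule sum_mono2)
      show "(\<lambda>j. \<iota> n ((i + j) mod N)) ` {..<n} \<subseteq> {..<2 * n + 1}"
      proof (rule image_subsetI)
        fix j
        have "(i + j) mod N < d * n" using n Nn by (simp add: N_def)
        then show "\<iota> n ((i + j) mod N) \<in> {..<2 * n + 1}" using range[of "(i + j) mod N" n] by simp
      qed
    qed auto
    finally show ?thesis .
  qed
  have "(\<Sum>i<n. \<Sum>j<n. (cmod (hmat n x i j - hmat n y i j))\<^sup>2)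
      \<le> (\<Sum>i<n. \<Sum>j<n. (1 / real n) * (x (\<iota> n ((i + j) mod N)) - y (\<iota> n ((i + j) mod N)))\<^sup>2)"
    by (intro sum_mono ent)
  also have "\<dots> = (\<Sum>i<n. (1 / real n) * (\<Sum>j<n. (x (\<iota> n ((i + j) mod N)) - y (\<iota> n ((i + j) mod N)))\<^sup>2))"
    by (simp only: sum_distrib_left)
  also have "\<dots> \<le> (\<Sum>i<n. (1 / real n) * D)" by (intro sum_mono mult_left_mono row) auto
  also have "\<dots> = D" using n by simp
  finally have HS: "(\<Sum>i<n. \<Sum>j<n. (cmod (hmat n x i j - hmat n y i j))\<^sup>2) \<le> D" .
  have "cmod ((\<Sum>k<n. iexp (t * spec n x k)) - (\<Sum>k<n. iexp (t * spec n y k)))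
      \<le> \<bar>t\<bar> * sqrt (real n * (\<Sum>i<n. \<Sum>j<n. (cmod (hmat n x i j - hmat n y i j))\<^sup>2))"
    by (rule lipschitz_spectral_sum[where f = "\<lambda>x. iexp (t * x)", OF u v iexp_lipschitz abs_ge_zero])
  also have "\<dots> \<le> \<bar>t\<bar> * sqrt (real n * D)" by (intro mult_left_mono real_sqrt_le_mono HS) auto
  finally have "cmod ((\<Sum>k<n. iexp (t * spec n x k)) - (\<Sum>k<n. iexp (t * spec n y k))) / real n \<le> \<bar>t\<bar> * sqrt (real n * D) / real n"
    by (rule divide_right_mono) simp
  also have "\<bar>t\<bar> * sqrt (real n * D) / real n = \<bar>t\<bar> * sqrt (D / real n)"
  proof -
    have "sqrt (real n * D) / real n = sqrt (D / real n)"
      using n by (simp add: real_sqrt_mult real_sqrt_divide field_simps)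
    then show ?thesis by (simp add: mult.commute flip: times_divide_eq_right)
  qed
  finally show ?thesis
    by (simp add: emp_char_def D_def norm_divide flip: diff_divide_distrib)
qed

text \<open>For a truncation with mean square error at most \<open>(1/8) ^ j\<close>, the maximal
  inequality at level \<open>(1/2) ^ j\<close> bounds by \<open>(1/4) ^ j\<close> the probability
  that some average of squared errors is too large. By Borel-Cantelli, for almost every outcome all
  late j are good for all n at once, so the truncated spectra approximate uniformly in n.\<close>

lemma AE_emp_char_iid:
  assumes "standardized_iid M x"
  shows "AE \<omega> in M. \<forall>t. (\<lambda>n. emp_char n (spec n (\<lambda>i. x i \<omega>)) t) \<longlonglongrightarrow> char_of_moments lim_mom t"
    and "\<exists>\<mu>. real_distribution \<mu> \<and> char \<mu> = char_of_moments lim_mom"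
proof -
  interpret standardized_iid M x by (rule assms)
  define good where "good j h \<longleftrightarrow> h \<in> borel_measurable borel \<and> (\<exists>C. \<forall>z. \<bar>h z\<bar> \<le> C) \<and>
    expectation (\<lambda>\<omega>. h (x 0 \<omega>)) = 0 \<and> expectation (\<lambda>\<omega>. h (x 0 \<omega>) ^ 2) = 1 \<and>
    integrable M (\<lambda>\<omega>. (x 0 \<omega> - h (x 0 \<omega>)) ^ 2) \<and>
    expectation (\<lambda>\<omega>. (x 0 \<omega> - h (x 0 \<omega>)) ^ 2) \<le> (1/8) ^ j" for j :: nat and h :: "real \<Rightarrow> real"
  have "\<exists>h. good j h" for j
  proof (rule truncation_exists[of "(1/8) ^ j"])
    show "(0::real) < (1/8) ^ j" by simp
  qed (unfold good_def, blast)
  then obtain h where "\<And>j. good j (h j)" using choice[of good] by blast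
  then have h: "\<And>j. h j \<in> borel_measurable borel" "\<And>j. \<exists>C. \<forall>z. \<bar>h j z\<bar> \<le> C"
    "\<And>j. expectation (\<lambda>\<omega>. h j (x 0 \<omega>)) = 0" "\<And>j. expectation (\<lambda>\<omega>. h j (x 0 \<omega>) ^ 2) = 1"
    "\<And>j. integrable M (\<lambda>\<omega>. (x 0 \<omega> - h j (x 0 \<omega>)) ^ 2)"
    "\<And>j. expectation (\<lambda>\<omega>. (x 0 \<omega> - h j (x 0 \<omega>)) ^ 2) \<le> (1/8) ^ j"
    unfolding good_def by blast+
  note [measurable] = h(1)
  have bm: "bounded_moments M (\<lambda>i \<omega>. h j (x i \<omega>))" for j
  proof -
    obtain C where C: "\<And>z. \<bar>h j z\<bar> \<le> C" using h(2) by blast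
    show ?thesis
    proof (rule bounded_moments_bounded[OF prob_space_axioms])
      show "indep_vars (\<lambda>_. borel) (\<lambda>i \<omega>. h j (x i \<omega>)) UNIV"
        by (rule indep_vars_compose2[OF indep]) simp
      show "expectation (\<lambda>\<omega>. h j (x i \<omega>)) = 0" for i using expectation_same[OF h(1), of j i] h(3) by simp
      show "expectation (\<lambda>\<omega>. (h j (x i \<omega>))\<^sup>2) = 1" for i
        using expectation_same[of "\<lambda>z. (h j z)\<^sup>2" i] h(4) by simp
      show "AE \<omega> in M. \<bar>h j (x i \<omega>)\<bar> \<le> C" for i using C by simp
    qed
  qed
  show "\<exists>\<mu>. real_distribution \<mu> \<and> char \<mu> = char_of_moments lim_mom"
    by (rule lim_distribution_exists[OF bm[of 0]])
  define A where "A j = {\<omega> \<in> space M. \<exists>n\<ge>1. (\<Sum>i<n. (x i \<omega> - h j (x i \<omega>))\<^sup>2) > (1/2) ^ j * real n}" for j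
  have gm: "(\<lambda>z. (z - h j z)\<^sup>2) \<in> borel_measurable borel" for j by measurable
  have Am: "A j \<in> events" for j
    unfolding A_def by (rule maximal_inequality_all(1)[OF gm _ h(5)]) auto
  have PA: "prob (A j) \<le> (1/4) ^ j" for j
  proof -
    have "prob (A j) \<le> expectation (\<lambda>\<omega>. (x 0 \<omega> - h j (x 0 \<omega>))\<^sup>2) / (1/2) ^ j"
      unfolding A_def by (rule maximal_inequality_all(2)[OF gm _ h(5)]) auto
    also have "\<dots> \<le> (1/8) ^ j / (1/2) ^ j" by (intro divide_right_mono h(6)) auto
    also have "\<dots> = (1/4) ^ j" by (simp flip: power_divide)
    finally show ?thesis .
  qed
  have "summable (\<lambda>j. prob (A j))"
    by (rule summable_comparison_test'[where g = "\<lambda>j. (1/4) ^ j" and N = 0]) (use PA in \<open>auto intro: summable_geometric\<close>)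
  then have "AE \<omega> in M. \<forall>\<^sub>F j in sequentially. \<omega> \<in> space M - A j"
    using Am by (intro borel_cantelli_AE1) (auto simp: emeasure_eq_measure)
  moreover have "AE \<omega> in M. \<forall>j t. (\<lambda>n. emp_char n (spec n (\<lambda>i. h j (x i \<omega>))) t) \<longlonglongrightarrow> char_of_moments lim_mom t"
    using AE_emp_char[OF bm] by (simp add: AE_all_countable)
  ultimately show "AE \<omega> in M. \<forall>t. (\<lambda>n. emp_char n (spec n (\<lambda>i. x i \<omega>)) t) \<longlonglongrightarrow> char_of_moments lim_mom t"
  proof eventually_elim
    case (elim \<omega>)
    obtain J0 where J0: "\<And>j. j \<ge> J0 \<Longrightarrow> \<omega> \<in> space M - A j" using elim(1) by (auto simp: eventually_sequentially)
    show ?case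
    proof
      fix t
      let ?L = "char_of_moments lim_mom t"
      define e where "e j = \<bar>t\<bar> * sqrt (3 * (1/2) ^ (j + J0)) + 1 / real (Suc j)" for j
      have "(\<lambda>j. (1/2 :: real) ^ (j + J0)) \<longlonglongrightarrow> 0"
        by (rule LIMSEQ_ignore_initial_segment) (rule LIMSEQ_power_zero, simp)
      then have "(\<lambda>j. \<bar>t\<bar> * sqrt (3 * (1/2) ^ (j + J0)) + 1 / real (Suc j)) \<longlonglongrightarrow> \<bar>t\<bar> * sqrt (3 * 0) + 0"
        by (intro tendsto_add tendsto_mult tendsto_const tendsto_real_sqrt LIMSEQ_Suc[OF lim_1_over_n])
      then have e: "e \<longlonglongrightarrow> 0" by (simp add: e_def[abs_def])
      have "\<forall>\<^sub>F n in sequentially. cmod (emp_char n (spec n (\<lambda>i. x i \<omega>)) t - ?L) \<le> e j" for j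
      proof -
        let ?j = "j + J0"
        have good: "(\<Sum>i<n. (x i \<omega> - h ?j (x i \<omega>))\<^sup>2) \<le> (1/2) ^ ?j * real n" if "n \<ge> 1" for n
          using J0[of ?j] that unfolding A_def by (auto simp: not_less)
        have "\<forall>\<^sub>F n in sequentially. dist (emp_char n (spec n (\<lambda>i. h ?j (x i \<omega>))) t) ?L < 1 / real (Suc j)"
          using elim(2) by (intro tendstoD) auto
        then show ?thesis
          using eventually_gt_at_top[of 0]
        proof eventually_elim
          case (elim n)
          have "(\<Sum>m<2 * n + 1. (x m \<omega> - h ?j (x m \<omega>))\<^sup>2) \<le> (1/2) ^ ?j * real (2 * n + 1)" by (rule good) simp
          \<comment> \<open>The matrix of size n uses inputs up to index \<open>2 * n\<close>, and
            \<open>2 * n + 1 \<le> 3 * n\<close>; this is the 3 in \<open>e\<close>.\<close>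
          also have "\<dots> \<le> (1/2) ^ ?j * (3 * real n)" using elim(2) by (intro mult_left_mono) auto
          finally have "(\<Sum>m<2 * n + 1. (x m \<omega> - h ?j (x m \<omega>))\<^sup>2) / real n \<le> 3 * (1/2) ^ ?j"
            using elim(2) by (simp add: pos_divide_le_eq mult_ac)
          then have "\<bar>t\<bar> * sqrt ((\<Sum>m<2 * n + 1. (x m \<omega> - h ?j (x m \<omega>))\<^sup>2) / real n) \<le> \<bar>t\<bar> * sqrt (3 * (1/2) ^ ?j)"
            by (intro mult_left_mono real_sqrt_le_mono) auto
          with emp_char_diff[OF elim(2), of "\<lambda>i. x i \<omega>" t "\<lambda>i. h ?j (x i \<omega>)"]
          have 1: "cmod (emp_char n (spec n (\<lambda>i. x i \<omega>)) t - emp_char n (spec n (\<lambda>i. h ?j (x i \<omega>))) t) \<le> \<bar>t\<bar> * sqrt (3 * (1/2) ^ ?j)"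
            by (rule order_trans)
          have "cmod (emp_char n (spec n (\<lambda>i. x i \<omega>)) t - ?L) \<le>
            cmod (emp_char n (spec n (\<lambda>i. x i \<omega>)) t - emp_char n (spec n (\<lambda>i. h ?j (x i \<omega>))) t)
            + cmod (emp_char n (spec n (\<lambda>i. h ?j (x i \<omega>))) t - ?L)" by norm
          with 1 elim(1) show ?case unfolding e_def dist_norm by linarith
        qed
      qed
      from approx_scheme(2)[OF this e] show "(\<lambda>n. emp_char n (spec n (\<lambda>i. x i \<omega>)) t) \<longlonglongrightarrow> ?L"
        by simp
    qed
  qed
qed

lemma AE_emp_char_input:
  assumes "input_sequence M x"
  shows "AE \<omega> in M. \<forall>t. (\<lambda>n. emp_char n (spec n (\<lambda>i. x i \<omega>)) t) \<longlonglongrightarrow> char_of_moments lim_mom t"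
    and "\<exists>\<mu>. real_distribution \<mu> \<and> char \<mu> = char_of_moments lim_mom"
  using input_sequence_cases[OF assms] AE_emp_char AE_emp_char_iid lim_distribution_exists by blast+

lemma is_lsdI:
  assumes x: "input_sequence M x" and \<mu>: "real_distribution \<mu>" "char \<mu> = char_of_moments lim_mom"
    and E: "\<And>n y s. n > 0 \<Longrightarrow> E (P n y) s = real (card {k. k < n \<and> spec n y k \<le> s}) / real n"
  shows "is_lsd M E (\<lambda>n \<omega>. P n (\<lambda>i. x i \<omega>)) (cdf \<mu>)"
  unfolding is_lsd_def
proof
  show "distribution_function (cdf \<mu>)" unfolding distribution_function_def using \<mu>(1) by blast
  show "AE \<omega> in M. weak_conv (\<lambda>n. E (P n (\<lambda>i. x i \<omega>))) (cdf \<mu>)"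
    using AE_emp_char_input(1)[OF x]
  proof eventually_elim
    case (elim \<omega>)
    show ?case
    proof (rule weak_conv_from_char[OF \<mu>(1)])
      show "(\<lambda>n. emp_char n (spec n (\<lambda>i. x i \<omega>)) t) \<longlonglongrightarrow> char \<mu> t" for t unfolding \<mu>(2) using elim by blast
    qed (rule E)
  qed
qed

text \<open>For c = \<open>- \<i>\<close> the eigenvalues are \<open>- \<i>\<close> times the real
  numbers \<open>spec n y k\<close>, and the factor \<open>\<i>\<close> in \<open>esd_skew\<close>
  undoes this rotation.\<close>

lemma esd_spec:
  assumes A: "map_mat complex_of_real A = c \<cdot>\<^sub>m mat n n (\<lambda>(i, j). hmat n y i j)"
  shows "c = 1 \<Longrightarrow> esd_sym A s = real (card {k. k < n \<and> spec n y k \<le> s}) / real n"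
    and "c = - \<i> \<Longrightarrow> esd_skew A s = real (card {k. k < n \<and> spec n y k \<le> s}) / real n"
proof -
  have sp: "spectrum_mset A = mset (map (\<lambda>k. c * of_real (spec n y k)) [0..<n])"
    using spec[of n y] A unfolding is_spec_def by blast
  have "dim_row (map_mat complex_of_real A) = n" unfolding A by simp
  then have dim: "dim_row A = n" by simp
  have cnt: "size {# l \<in># mset (map f [0..<n]). Q l #} = card {k. k < n \<and> Q (f k)}" for f :: "nat \<Rightarrow> complex" and Q
  proof -
    have "size {# l \<in># mset (map f [0..<n]). Q l #} = length (filter Q (map f [0..<n]))"
      by (simp only: mset_filter[symmetric] size_mset)
    also have "\<dots> = card {k. k < n \<and> Q (f k)}"
      unfolding length_filter_conv_card by (rule arg_cong[where f = card]) auto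
    finally show ?thesis .
  qed
  show "c = 1 \<Longrightarrow> esd_sym A s = real (card {k. k < n \<and> spec n y k \<le> s}) / real n"
    unfolding esd_sym_def sp cnt dim by simp
  show "c = - \<i> \<Longrightarrow> esd_skew A s = real (card {k. k < n \<and> spec n y k \<le> s}) / real n"
    unfolding esd_skew_def sp cnt dim by simp
qed

end

section \<open>The Hankel and reverse circulant families\<close>

text \<open>On the unit square this is the indicator of the corner with side 1/d: a quarter of the
  torus matrix for d = 2, all of it for d = 1.\<close>

definition cutoff :: "nat \<Rightarrow> real \<Rightarrow> real \<Rightarrow> complex" where
  "cutoff d s t = (if real d * s < 1 \<and> real d * t < 1 then 1 else 0)"

text \<open>The factor \<open>\<i>\<close> makes the skew-symmetric matrices Hermitian.\<close>

definition skew_cutoff :: "nat \<Rightarrow> real \<Rightarrow> real \<Rightarrow> complex" where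
  "skew_cutoff d s t = \<i> * of_real (sgn (t - s)) * cutoff d s t"

lemma eventually_less_iff:
  fixes f :: "_ \<Rightarrow> real"
  assumes "(f \<longlongrightarrow> l) F" "l \<noteq> c"
  shows "\<forall>\<^sub>F z in F. f z < c \<longleftrightarrow> l < c"
proof (cases "l < c")
  case True
  then have "\<forall>\<^sub>F z in F. f z < c" using assms(1) by (intro order_tendstoD)
  then show ?thesis by eventually_elim (use True in auto)
next
  case False
  then have "\<forall>\<^sub>F z in F. c < f z" using assms by (intro order_tendstoD) auto
  then show ?thesis by eventually_elim (use False in auto)
qed

lemma locally_constant_isCont:
  assumes "\<forall>\<^sub>F z in nhds p. f z = f p"
  shows "isCont f p"
proof -
  have "\<forall>\<^sub>F z in at p. f z = f p" using assms by (simp add: eventually_at_filter eventually_mono)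
  then show ?thesis unfolding isCont_def by (rule tendsto_eventually)
qed

lemma cutoff_locally_constant:
  assumes d: "d \<in> {1, 2}" and s: "2 * s \<notin> \<int>" and t: "2 * t \<notin> \<int>"
  shows "\<forall>\<^sub>F z in nhds (s, t). cutoff d (fst z) (snd z) = cutoff d s t"
proof -
  have ne: "real d * r \<noteq> 1" if "2 * r \<notin> \<int>" for r
  proof
    assume "real d * r = 1"
    then have "2 * r = 2 \<or> 2 * r = 1" using d by auto
    with that show False by auto
  qed
  have fl: "(fst \<longlongrightarrow> s) (nhds (s, t))" "(snd \<longlongrightarrow> t) (nhds (s, t))"
    using tendsto_fst[OF filterlim_ident, of "(s, t)"] tendsto_snd[OF filterlim_ident, of "(s, t)"] by simp_all
  have "\<forall>\<^sub>F z in nhds (s, t). real d * fst z < 1 \<longleftrightarrow> real d * s < 1"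
    by (rule eventually_less_iff[OF _ ne[OF s]]) (intro tendsto_intros fl)
  moreover have "\<forall>\<^sub>F z in nhds (s, t). real d * snd z < 1 \<longleftrightarrow> real d * t < 1"
    by (rule eventually_less_iff[OF _ ne[OF t]]) (intro tendsto_intros fl)
  ultimately show ?thesis by eventually_elim (simp add: cutoff_def)
qed

lemma sgn_locally_constant:
  assumes "s \<noteq> (t :: real)"
  shows "\<forall>\<^sub>F z in nhds (s, t). sgn (snd z - fst z) = sgn (t - s)"
proof -
  have fl: "((\<lambda>z. snd z - fst z) \<longlongrightarrow> t - s) (nhds (s, t))"
    using tendsto_diff[OF tendsto_snd[OF filterlim_ident] tendsto_fst[OF filterlim_ident], of "(s, t)"] by simp
  show ?thesis
  proof (cases "t - s > 0")
    case True
    then have "\<forall>\<^sub>F z in nhds (s, t). 0 < snd z - fst z" using fl by (intro order_tendstoD)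
    then show ?thesis by eventually_elim (use True in auto)
  next
    case False
    then have "t - s < 0" using assms by auto
    then have "\<forall>\<^sub>F z in nhds (s, t). snd z - fst z < 0" using fl by (intro order_tendstoD)
    then show ?thesis by eventually_elim (use \<open>t - s < 0\<close> in auto)
  qed
qed

lemma torus_family_cutoff:
  assumes d: "d \<in> {1, 2}" and i: "\<And>n. inj_on (\<iota> n) {..<d * n}" "\<And>n c. c < d * n \<Longrightarrow> \<iota> n c \<le> 2 * n"
  shows "torus_family (cutoff d) d \<iota>"
proof
  show "cmod (cutoff d x y) \<le> 1" for x y by (simp add: cutoff_def)
  show "isCont (\<lambda>z. cutoff d (fst z) (snd z)) (x, y)" if "2 * x \<notin> \<int>" "2 * y \<notin> \<int>" "x \<noteq> y" for x y
    by (rule locally_constant_isCont) (use cutoff_locally_constant[OF d that(1,2)] in simp)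
  show "cutoff d y x = cnj (cutoff d x y)" for x y by (simp add: cutoff_def)
  show "d \<ge> 1" using d by auto
  show "cutoff d s t = 0" if "1 \<le> real d * s \<or> 1 \<le> real d * t" for s t using that by (auto simp: cutoff_def)
qed (use i in auto)

lemma torus_family_skew_cutoff:
  assumes d: "d \<in> {1, 2}" and i: "\<And>n. inj_on (\<iota> n) {..<d * n}" "\<And>n c. c < d * n \<Longrightarrow> \<iota> n c \<le> 2 * n"
  shows "torus_family (skew_cutoff d) d \<iota>"
proof
  show "cmod (skew_cutoff d x y) \<le> 1" for x y by (simp add: skew_cutoff_def cutoff_def norm_mult sgn_if)
  show "isCont (\<lambda>z. skew_cutoff d (fst z) (snd z)) (x, y)" if "2 * x \<notin> \<int>" "2 * y \<notin> \<int>" "x \<noteq> y" for x y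
  proof (rule locally_constant_isCont)
    show "\<forall>\<^sub>F z in nhds (x, y). skew_cutoff d (fst z) (snd z) = skew_cutoff d (fst (x, y)) (snd (x, y))"
      using cutoff_locally_constant[OF d that(1,2)] sgn_locally_constant[OF that(3)]
      by eventually_elim (simp add: skew_cutoff_def)
  qed
  show "skew_cutoff d y x = cnj (skew_cutoff d x y)" for x y
    by (auto simp: skew_cutoff_def cutoff_def sgn_if)
  show "d \<ge> 1" using d by auto
  show "skew_cutoff d s t = 0" if "1 \<le> real d * s \<or> 1 \<le> real d * t" for s t
    using that by (auto simp: cutoff_def skew_cutoff_def)
qed (use i in auto)

text \<open>Zero-based indices i, j belong to the input of index i + j + 2, and their sums fill
  \<open>0, ..., 2 * n - 2\<close>. The one remaining label \<open>2 * n - 1\<close> of the torus is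
  sent to the free index 0 to keep the map injective.\<close>

definition iota_hankel :: "nat \<Rightarrow> nat \<Rightarrow> nat" where
  "iota_hankel n c = (if c < 2 * n - 1 then c + 2 else 0)"

text \<open>The shift by 2 again accounts for zero-based indices; modulo n it is a permutation of
  the labels.\<close>

definition iota_rc :: "nat \<Rightarrow> nat \<Rightarrow> nat" where
  "iota_rc n c = (c + 2) mod n"

lemma iota_hankel: "inj_on (iota_hankel n) {..<2 * n}" "c < 2 * n \<Longrightarrow> iota_hankel n c \<le> 2 * n"
  by (auto simp: inj_on_def iota_hankel_def split: if_splits)

lemma iota_rc: "inj_on (iota_rc n) {..<1 * n}" "c < 1 * n \<Longrightarrow> iota_rc n c \<le> 2 * n"
proof -
  show "inj_on (iota_rc n) {..<1 * n}"
  proof (rule inj_onI)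
    fix c c' assume c: "c \<in> {..<1 * n}" "c' \<in> {..<1 * n}" "iota_rc n c = iota_rc n c'"
    then have "[c + 2 = c' + 2] (mod n)" by (simp add: cong_def iota_rc_def)
    then have "[c = c'] (mod n)" by (simp only: cong_add_rcancel_nat)
    then show "c = c'" using c by (simp add: cong_def)
  qed
  assume "c < 1 * n"
  then have "(c + 2) mod n < n" by (intro mod_less_divisor) simp
  then show "iota_rc n c \<le> 2 * n" by (simp add: iota_rc_def)
qed

interpretation symH: torus_family "cutoff 2" 2 iota_hankel
  by (rule torus_family_cutoff) (use iota_hankel in auto)
interpretation skewH: torus_family "skew_cutoff 2" 2 iota_hankel
  by (rule torus_family_skew_cutoff) (use iota_hankel in auto)
interpretation symRC: torus_family "cutoff 1" 1 iota_rc
  by (rule torus_family_cutoff) (use iota_rc in auto)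
interpretation skewRC: torus_family "skew_cutoff 1" 1 iota_rc
  by (rule torus_family_skew_cutoff) (use iota_rc in auto)

lemma cutoff_nat:
  assumes "n > 0" "i < n" "j < n"
  shows "cutoff d (real i / real (d * n)) (real j / real (d * n)) = 1"
  using assms by (cases "d = 0") (simp_all add: cutoff_def field_simps)

lemma sgn_nat:
  assumes "n > 0" "d > 0"
  shows "sgn (real j / real (d * n) - real i / real (d * n)) = (if i < j then 1 else if i = j then 0 else - 1)"
proof -
  have "real j / real (d * n) - real i / real (d * n) = (real j - real i) / real (d * n)"
    by (simp add: diff_divide_distrib)
  moreover have "real (d * n) > 0" using assms by simp
  ultimately show ?thesis by (simp add: sgn_if divide_less_0_iff zero_less_divide_iff del: of_nat_mult)
qed

lemma iota_hankel_index: "i < n \<Longrightarrow> j < n \<Longrightarrow> iota_hankel n (i + j) = Suc (Suc (i + j))"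
  by (simp add: iota_hankel_def)

lemma iota_rc_index: "iota_rc n ((i + j) mod (1 * n)) = (Suc i + Suc j) mod n"
  by (simp add: iota_rc_def mod_Suc_eq) (metis mod_Suc_eq)

lemma hankel_mat: "n > 0 \<Longrightarrow> map_mat complex_of_real (scaled hankel n y) = 1 \<cdot>\<^sub>m mat n n (\<lambda>(i, j). symH.hmat n y i j)"
  by (rule eq_matI)
     (auto simp: scaled_def hankel_def symH.hmat_def tmat_def cutoff_nat[of n _ _ 2, simplified] iota_hankel_index)

lemma rc_mat: "n > 0 \<Longrightarrow> map_mat complex_of_real (scaled reverse_circulant n y) = 1 \<cdot>\<^sub>m mat n n (\<lambda>(i, j). symRC.hmat n y i j)"
  unfolding symRC.hmat_def
  by (rule eq_matI)
     (auto simp: scaled_def reverse_circulant_def tmat_def cutoff_nat[of n _ _ 1, simplified]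
       iota_rc_index[simplified])

lemma skew_hankel_mat: "n > 0 \<Longrightarrow> map_mat complex_of_real (scaled skew_hankel n y) = - \<i> \<cdot>\<^sub>m mat n n (\<lambda>(i, j). skewH.hmat n y i j)"
  by (rule eq_matI)
     (auto simp: scaled_def skew_hankel_def schur_prod_def sign_mat_def hankel_def skewH.hmat_def tmat_def skew_cutoff_def
        cutoff_nat[of n _ _ 2, simplified] sgn_nat[of n 2, simplified] iota_hankel_index)

lemma skew_rc_mat: "n > 0 \<Longrightarrow> map_mat complex_of_real (scaled skew_reverse_circulant n y) = - \<i> \<cdot>\<^sub>m mat n n (\<lambda>(i, j). skewRC.hmat n y i j)"
  unfolding skewRC.hmat_def
  by (rule eq_matI)
     (auto simp: scaled_def skew_reverse_circulant_def schur_prod_def sign_mat_def reverse_circulant_def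
        tmat_def skew_cutoff_def cutoff_nat[of n _ _ 1, simplified] sgn_nat[of n 1, simplified] iota_rc_index[simplified])

section \<open>The gap between the sixth moments\<close>

lemma skew_wt_le: "Re (wt (skew_cutoff d) N a w) \<le> Re (wt (cutoff d) N a w)"
proof -
  \<comment> \<open>The bound on the modulus is multiplicative along the walk, unlike the bound on
    real parts: \<open>skew_cutoff\<close> is dominated in modulus by the nonnegative real
    \<open>cutoff\<close>.\<close>
  have "Im (wt (cutoff d) N a w) = 0 \<and> cmod (wt (skew_cutoff d) N a w) \<le> Re (wt (cutoff d) N a w)"
  proof (induction w arbitrary: a)
    case (Cons l w)
    let ?b = "stp N a l"
    let ?c = "cutoff d (real a / real N) (real ?b / real N)"
    have c: "Im ?c = 0" "Re ?c \<ge> 0" "cmod (skew_cutoff d (real a / real N) (real ?b / real N)) \<le> Re ?c"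
      by (auto simp: cutoff_def skew_cutoff_def norm_mult sgn_if)
    have "cmod (skew_cutoff d (real a / real N) (real ?b / real N)) * cmod (wt (skew_cutoff d) N ?b w)
        \<le> Re ?c * Re (wt (cutoff d) N ?b w)"
      using Cons[of ?b] c by (intro mult_mono) auto
    then show ?case using Cons[of ?b] c by (simp add: norm_mult)
  qed simp
  then show ?thesis using complex_Re_le_cmod[of "wt (skew_cutoff d) N a w"] by linarith
qed

lemma stp_diff: "a \<le> l \<Longrightarrow> l < N \<Longrightarrow> stp N a l = l - a"
proof -
  assume a: "a \<le> l" "l < N"
  then have "stp N a l = ((l - a) + N) mod N" unfolding stp_def by (intro arg_cong2[of _ _ _ _ "(mod)"]) auto
  also have "\<dots> = l - a" unfolding mod_add_self2 using a by simp
  finally show ?thesis .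
qed

text \<open>A box of starting points and labels for the word \<open>abcabc\<close>: the closed walk visits, up to a small
  perturbation, the points \<open>8, 10, 2, 13, 5, 7\<close> (times \<open>N/32\<close>), and the cyclic sequence of its steps has two
  descents, so that the skew weight is \<open>\<i>\<^sup>6 = -1\<close> instead of \<open>1\<close>.\<close>

lemma box_walk:
  assumes d: "d \<in> {1, 2}" and N: "N = 256 * j" and lt: "\<alpha> < j" "\<beta> < j" "\<gamma> < j" "\<delta> < j"
  defines "a \<equiv> 64 * j + \<alpha>" and "u \<equiv> 144 * j + \<beta>" and "v \<equiv> 96 * j + \<gamma>" and "w \<equiv> 120 * j + \<delta>"
  shows "[u, v, w, u, v, w] \<in> pair_words 3 N" "a < N" "fin N a [u, v, w, u, v, w] = a"
    "wt (cutoff d) N a [u, v, w, u, v, w] = 1" "wt (skew_cutoff d) N a [u, v, w, u, v, w] = - 1"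
proof -
  \<comment> \<open>In units of j the unperturbed points are a = 64, p1 = 80, p2 = 16, p3 = 104, p4
    = 40, p5 = 56. Each moves by less than \<open>2 * j\<close>, while the comparisons below hold
    with a margin of at least \<open>8 * j\<close>.\<close>
  define p1 where "p1 = u - a"
  define p2 where "p2 = v - p1"
  define p3 where "p3 = w - p2"
  define p4 where "p4 = u - p3"
  define p5 where "p5 = v - p4"
  have j: "j > 0" using lt by simp
  note defs = a_def u_def v_def w_def N
  have e1: "p1 + a = u" using lt unfolding p1_def defs by linarith
  have e2: "p2 + p1 = v" using lt e1 unfolding p2_def defs by linarith
  have e3: "p3 + p2 = w" using lt e1 e2 unfolding p3_def defs by linarith
  have e4: "p4 + p3 = u" using lt e1 e2 e3 unfolding p4_def defs by linarith
  have e5: "p5 + p4 = v" using lt e1 e2 e3 e4 unfolding p5_def defs by linarith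
  note e = e1 e2 e3 e4 e5
  \<comment> \<open>In \<open>abcabc\<close> each letter stands once at an odd and once at an even
    place, so the alternating sum of the labels is 0 and the walk returns for every choice of
    letters.\<close>
  have e6: "a + p5 = w" using e by linarith
  have lN: "u < N" "v < N" "w < N" "a < N" using lt unfolding defs by linarith+
  have s: "stp N a u = p1" "stp N p1 v = p2" "stp N p2 w = p3" "stp N p3 u = p4" "stp N p4 v = p5" "stp N p5 w = a"
    using stp_diff[of a u N] stp_diff[of p1 v N] stp_diff[of p2 w N] stp_diff[of p3 u N] stp_diff[of p4 v N]
      stp_diff[of p5 w N] e e6 lN by auto
  have dist: "u \<noteq> v" "v \<noteq> w" "u \<noteq> w" using lt unfolding defs by linarith+
  show "[u, v, w, u, v, w] \<in> pair_words 3 N"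
    using dist lN by (auto simp: pair_words_def words_def)
  show "a < N" by (rule lN)
  show "fin N a [u, v, w, u, v, w] = a" by (simp add: s)
  \<comment> \<open>All points lie below N/2, inside the corner for d = 2 as well.\<close>
  have half: "2 * a < N" "2 * p1 < N" "2 * p2 < N" "2 * p3 < N" "2 * p4 < N" "2 * p5 < N"
  proof -
    have "a < 128 * j" "p1 < 128 * j" "p2 < 128 * j" "p3 < 128 * j" "p4 < 128 * j" "p5 < 128 * j"
      using lt e unfolding defs by linarith+
    then show "2 * a < N" "2 * p1 < N" "2 * p2 < N" "2 * p3 < N" "2 * p4 < N" "2 * p5 < N" unfolding N by simp_all
  qed
  \<comment> \<open>The descents are the steps p1 to p2 and p3 to p4, each with weight
    \<open>- \<i>\<close>; the other four steps have weight \<open>\<i>\<close>.\<close>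
  have ord: "a < p1" "p2 < p1" "p2 < p3" "p4 < p3" "p4 < p5" "p5 < a"
    using lt e unfolding defs by linarith+
  have Np: "real N > 0" using j N by simp
  have c: "cutoff d (real p / real N) (real q / real N) = 1" if "2 * p < N" "2 * q < N" for p q
  proof -
    have "real d * (real r / real N) < 1" if "2 * r < N" for r
    proof -
      have "real (2 * r) < real N" using that by (simp only: of_nat_less_iff)
      then have "real d * real r < real N" using d by auto
      then show ?thesis using Np by (simp add: field_simps)
    qed
    then show ?thesis using that by (simp add: cutoff_def)
  qed
  have up: "skew_cutoff d (real p / real N) (real q / real N) = \<i>" if "2 * p < N" "2 * q < N" "p < q" for p q
  proof -
    have "real p / real N < real q / real N" using that Np by (intro divide_strict_right_mono) auto
    then show ?thesis by (simp add: skew_cutoff_def c that)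
  qed
  have down: "skew_cutoff d (real p / real N) (real q / real N) = - \<i>" if "2 * p < N" "2 * q < N" "q < p" for p q
  proof -
    have "real q / real N < real p / real N" using that Np by (intro divide_strict_right_mono) auto
    then show ?thesis by (simp add: skew_cutoff_def c that)
  qed
  show "wt (cutoff d) N a [u, v, w, u, v, w] = 1" by (simp add: s c half)
  show "wt (skew_cutoff d) N a [u, v, w, u, v, w] = - 1" by (simp add: s up down half ord)
qed

text \<open>By domination every term of the difference is nonnegative, so the walks of the box alone
  give a lower bound. Each contributes 1 - (-1) = 2, and there are \<open>j ^ 4\<close> of them: one
  factor for the start and one for each of the three letters.\<close>

lemma trace_main_gap:
  assumes d: "d \<in> {1, 2}" and N: "N = 256 * j"
  shows "2 * real j ^ 4 \<le> Re (weight.trace_main (cutoff d) 3 N) - Re (weight.trace_main (skew_cutoff d) 3 N)"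
proof -
  have W: "weight (cutoff d)" "weight (skew_cutoff d)"
    using d symH.weight_axioms skewH.weight_axioms symRC.weight_axioms skewRC.weight_axioms by auto
  define r where "r z = (case z of (w, a) \<Rightarrow> if fin N a w = a then Re (wt (cutoff d) N a w) - Re (wt (skew_cutoff d) N a w) else 0)"
    for z :: "nat list \<times> nat"
  have r0: "r z \<ge> 0" for z using skew_wt_le by (simp add: r_def case_prod_beta)
  let ?Z = "pair_words 3 N \<times> {..<N}"
  have "Re (weight.trace_main (cutoff d) 3 N) - Re (weight.trace_main (skew_cutoff d) 3 N) = sum r ?Z"
    unfolding weight.trace_main_def[OF W(1)] weight.trace_main_def[OF W(2)]
    by (simp add: sum_subtractf[symmetric] sum.cartesian_product[symmetric] r_def if_distrib[of Re] cong: if_cong)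
       (intro sum.cong refl, auto)
  moreover have "2 * real j ^ 4 \<le> sum r ?Z"
  proof -
    let ?B = "({..<j} \<times> {..<j}) \<times> ({..<j} \<times> {..<j})"
    define f where "f z = (case z of ((\<alpha>, \<beta>), (\<gamma>, \<delta>)) \<Rightarrow>
      ([144 * j + \<beta>, 96 * j + \<gamma>, 120 * j + \<delta>, 144 * j + \<beta>, 96 * j + \<gamma>, 120 * j + \<delta>], 64 * j + \<alpha>))"
      for z :: "(nat \<times> nat) \<times> (nat \<times> nat)"
    have inj: "inj_on f ?B" by (auto simp: inj_on_def f_def)
    have fz: "f z \<in> ?Z" "r (f z) = 2" if "z \<in> ?B" for z
    proof -
      obtain \<alpha> \<beta> \<gamma> \<delta> where z: "z = ((\<alpha>, \<beta>), (\<gamma>, \<delta>))" by (metis surj_pair)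
      with that have lt: "\<alpha> < j" "\<beta> < j" "\<gamma> < j" "\<delta> < j" by auto
      note b = box_walk[OF d N lt]
      show "f z \<in> ?Z" unfolding z f_def using b by simp
      show "r (f z) = 2" unfolding z f_def r_def prod.case b(3,4,5) by simp
    qed
    have "2 * real j ^ 4 = (\<Sum>z\<in>?B. 2)" by (simp add: card_cartesian_product power4_eq_xxxx)
    also have "\<dots> = (\<Sum>z\<in>?B. r (f z))" using fz by (intro sum.cong) auto
    also have "\<dots> = sum r (f ` ?B)" using inj by (simp add: sum.reindex)
    also have "\<dots> \<le> sum r ?Z"
    proof (rule sum_mono2)
      show "finite ?Z" by simp
      show "f ` ?B \<subseteq> ?Z" using fz(1) by (rule image_subsetI)
    qed (use r0 in auto)
    finally show ?thesis .
  qed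
  ultimately show ?thesis by simp
qed

text \<open>The box has a fixed share of all \<open>N ^ 4\<close> choices, so after normalisation
  the gap stays at least \<open>2 / 256 ^ 4\<close>. A subsequence of sizes suffices, since both
  limits are known to exist.\<close>

lemma limit_moment_gap:
  assumes d: "d \<in> {1, 2}"
  shows "Re (weight.limit_moment (cutoff d) 3) \<noteq> Re (weight.limit_moment (skew_cutoff d) 3)"
proof
  assume eq: "Re (weight.limit_moment (cutoff d) 3) = Re (weight.limit_moment (skew_cutoff d) 3)"
  have W: "weight (cutoff d)" "weight (skew_cutoff d)"
    using d symH.weight_axioms skewH.weight_axioms symRC.weight_axioms skewRC.weight_axioms by auto
  have sm: "strict_mono (\<lambda>j. 256 * Suc j)" by (simp add: strict_mono_def)
  have T: "(\<lambda>j. Re (weight.trace_main \<phi> 3 (256 * Suc j)) / real (256 * Suc j) ^ 4) \<longlonglongrightarrow> Re (weight.limit_moment \<phi> 3)"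
    if "weight \<phi>" for \<phi>
  proof -
    from LIMSEQ_subseq_LIMSEQ[OF weight.trace_main_tendsto[OF that, of 3] sm]
    have "(\<lambda>j. weight.trace_main \<phi> 3 (256 * Suc j) / of_nat (256 * Suc j) ^ Suc 3) \<longlonglongrightarrow> weight.limit_moment \<phi> 3"
      by (simp only: comp_def)
    from tendsto_Re[OF this] have "(\<lambda>j. Re (weight.trace_main \<phi> 3 (256 * Suc j) / of_nat (256 * Suc j) ^ Suc 3)) \<longlonglongrightarrow> Re (weight.limit_moment \<phi> 3)" .
    moreover have "Re (z / of_nat m ^ Suc 3) = Re z / real m ^ 4" for z m
    proof -
      have "of_nat m ^ Suc 3 = complex_of_real (real m ^ 4)" by (simp add: eval_nat_numeral)
      then show ?thesis by (simp only: Re_divide_of_real)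
    qed
    ultimately show ?thesis by (simp only:)
  qed
  have "(\<lambda>j. Re (weight.trace_main (cutoff d) 3 (256 * Suc j)) / real (256 * Suc j) ^ 4
      - Re (weight.trace_main (skew_cutoff d) 3 (256 * Suc j)) / real (256 * Suc j) ^ 4) \<longlonglongrightarrow> 0"
    using tendsto_diff[OF T[OF W(1)] T[OF W(2)]] eq by (simp only: diff_self)
  moreover have "2 / 256 ^ 4 \<le> Re (weight.trace_main (cutoff d) 3 (256 * Suc j)) / real (256 * Suc j) ^ 4
      - Re (weight.trace_main (skew_cutoff d) 3 (256 * Suc j)) / real (256 * Suc j) ^ 4" for j
  proof -
    have "2 / 256 ^ 4 = 2 * real (Suc j) ^ 4 / real (256 * Suc j) ^ 4"
      unfolding of_nat_mult power_mult_distrib by simp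
    also have "\<dots> \<le> (Re (weight.trace_main (cutoff d) 3 (256 * Suc j)) - Re (weight.trace_main (skew_cutoff d) 3 (256 * Suc j)))
        / real (256 * Suc j) ^ 4"
      by (intro divide_right_mono trace_main_gap[OF d refl]) simp
    finally show ?thesis by (simp only: diff_divide_distrib)
  qed
  ultimately have "(2 :: real) / 256 ^ 4 \<le> 0" by (intro LIMSEQ_le_const) auto
  then show False by simp
qed

lemma lim_mom_gap: "skewH.lim_mom 6 \<noteq> symH.lim_mom 6" "skewRC.lim_mom 6 \<noteq> symRC.lim_mom 6"
proof -
  have [simp]: "(6 :: nat) div 2 = 3" by simp
  show "skewH.lim_mom 6 \<noteq> symH.lim_mom 6"
    using limit_moment_gap[of 2] by (simp add: skewH.lim_mom_def symH.lim_mom_def)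
  show "skewRC.lim_mom 6 \<noteq> symRC.lim_mom 6"
    using limit_moment_gap[of 1] unfolding skewRC.lim_mom_def symRC.lim_mom_def by simp
qed

section \<open>Existence, universality and distinctness of the limits\<close>

lemma cdf_neq:
  assumes "real_distribution \<mu>" "char \<mu> = char_of_moments m" "tame_moments m"
    and "real_distribution \<nu>" "char \<nu> = char_of_moments m'" "tame_moments m'" and "m p \<noteq> m' p"
  shows "cdf \<mu> \<noteq> cdf \<nu>"
  using cdf_unique[OF assms(1,4)] char_of_moments_inj[OF assms(3,6)] assms(2,5,7) by auto

lemma lsd_all:
  assumes x: "input_sequence M x"
    and sH: "real_distribution \<mu>1" "char \<mu>1 = char_of_moments skewH.lim_mom"
    and sR: "real_distribution \<mu>2" "char \<mu>2 = char_of_moments skewRC.lim_mom"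
    and yH: "real_distribution \<mu>3" "char \<mu>3 = char_of_moments symH.lim_mom"
    and yR: "real_distribution \<mu>4" "char \<mu>4 = char_of_moments symRC.lim_mom"
  shows "is_lsd M esd_skew (\<lambda>n \<omega>. scaled skew_hankel n (\<lambda>i. x i \<omega>)) (cdf \<mu>1) \<and>
     is_lsd M esd_skew (\<lambda>n \<omega>. scaled skew_reverse_circulant n (\<lambda>i. x i \<omega>)) (cdf \<mu>2) \<and>
     is_lsd M esd_sym (\<lambda>n \<omega>. scaled hankel n (\<lambda>i. x i \<omega>)) (cdf \<mu>3) \<and>
     is_lsd M esd_sym (\<lambda>n \<omega>. scaled reverse_circulant n (\<lambda>i. x i \<omega>)) (cdf \<mu>4)"
  using skewH.is_lsdI[OF x sH, of esd_skew "scaled skew_hankel"] skewH.esd_spec(2)[OF skew_hankel_mat]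
    skewRC.is_lsdI[OF x sR, of esd_skew "scaled skew_reverse_circulant"] skewRC.esd_spec(2)[OF skew_rc_mat]
    symH.is_lsdI[OF x yH, of esd_sym "scaled hankel"] symH.esd_spec(1)[OF hankel_mat]
    symRC.is_lsdI[OF x yR, of esd_sym "scaled reverse_circulant"] symRC.esd_spec(1)[OF rc_mat]
  by blast

text \<open>The two type variables let inputs on probability spaces of different types share the
  limits, which expresses universality without quantifying over types. The symmetric ensembles are
  part of the claim so that the inequalities compare actual limits.\<close>

theorem theorem4p4:
  shows "\<exists>skewH skewRC symH symRC :: real \<Rightarrow> real.
    (\<forall>(M :: 'a measure) x. input_sequence M x \<longrightarrow>
       is_lsd M esd_skew (\<lambda>n \<omega>. scaled skew_hankel n (\<lambda>i. x i \<omega>)) skewH \<and>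
       is_lsd M esd_skew (\<lambda>n \<omega>. scaled skew_reverse_circulant n (\<lambda>i. x i \<omega>)) skewRC \<and>
       is_lsd M esd_sym (\<lambda>n \<omega>. scaled hankel n (\<lambda>i. x i \<omega>)) symH \<and>
       is_lsd M esd_sym (\<lambda>n \<omega>. scaled reverse_circulant n (\<lambda>i. x i \<omega>)) symRC) \<and>
    (\<forall>(N :: 'b measure) y. input_sequence N y \<longrightarrow>
       is_lsd N esd_skew (\<lambda>n \<omega>. scaled skew_hankel n (\<lambda>i. y i \<omega>)) skewH \<and>
       is_lsd N esd_skew (\<lambda>n \<omega>. scaled skew_reverse_circulant n (\<lambda>i. y i \<omega>)) skewRC \<and>
       is_lsd N esd_sym (\<lambda>n \<omega>. scaled hankel n (\<lambda>i. y i \<omega>)) symH \<and>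
       is_lsd N esd_sym (\<lambda>n \<omega>. scaled reverse_circulant n (\<lambda>i. y i \<omega>)) symRC) \<and>
    skewH \<noteq> symH \<and> skewRC \<noteq> symRC"
proof (cases "(\<exists>(M :: 'a measure) x. input_sequence M x) \<or> (\<exists>(N :: 'b measure) y. input_sequence N y)")
  case True
  have "\<exists>\<mu>. real_distribution \<mu> \<and> char \<mu> = char_of_moments skewH.lim_mom"
    using True by (elim disjE exE) (rule skewH.AE_emp_char_input(2), assumption)+
  then obtain \<mu>1 where 1: "real_distribution \<mu>1" "char \<mu>1 = char_of_moments skewH.lim_mom" by blast
  have "\<exists>\<mu>. real_distribution \<mu> \<and> char \<mu> = char_of_moments skewRC.lim_mom"
    using True by (elim disjE exE) (rule skewRC.AE_emp_char_input(2), assumption)+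
  then obtain \<mu>2 where 2: "real_distribution \<mu>2" "char \<mu>2 = char_of_moments skewRC.lim_mom" by blast
  have "\<exists>\<mu>. real_distribution \<mu> \<and> char \<mu> = char_of_moments symH.lim_mom"
    using True by (elim disjE exE) (rule symH.AE_emp_char_input(2), assumption)+
  then obtain \<mu>3 where 3: "real_distribution \<mu>3" "char \<mu>3 = char_of_moments symH.lim_mom" by blast
  have "\<exists>\<mu>. real_distribution \<mu> \<and> char \<mu> = char_of_moments symRC.lim_mom"
    using True by (elim disjE exE) (rule symRC.AE_emp_char_input(2), assumption)+
  then obtain \<mu>4 where 4: "real_distribution \<mu>4" "char \<mu>4 = char_of_moments symRC.lim_mom" by blast
  have "cdf \<mu>1 \<noteq> cdf \<mu>3"
    by (rule cdf_neq[OF 1 skewH.tame_lim_mom 3 symH.tame_lim_mom lim_mom_gap(1)])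
  moreover have "cdf \<mu>2 \<noteq> cdf \<mu>4"
    by (rule cdf_neq[OF 2 skewRC.tame_lim_mom 4 symRC.tame_lim_mom lim_mom_gap(2)])
  ultimately have neq: "cdf \<mu>1 \<noteq> cdf \<mu>3 \<and> cdf \<mu>2 \<noteq> cdf \<mu>4" ..
  show ?thesis
    by (rule exI[of _ "cdf \<mu>1"], rule exI[of _ "cdf \<mu>2"], rule exI[of _ "cdf \<mu>3"], rule exI[of _ "cdf \<mu>4"],
        rule conjI[OF _ conjI[OF _ neq]]; intro allI impI; rule lsd_all[OF _ 1 2 3 4])
next
  case False
  \<comment> \<open>If neither type carries an input sequence, as with finite types, the claims
    about limits hold vacuously and any two distinct functions serve as witnesses.\<close>
  have "(\<lambda>_. 0) \<noteq> (\<lambda>_ :: real. 1 :: real)" by (simp add: fun_eq_iff)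
  with False show ?thesis
    by (intro exI[of _ "\<lambda>_. 0"] exI[of _ "\<lambda>_. 0"] exI[of _ "\<lambda>_. 1"] exI[of _ "\<lambda>_. 1"]) blast
qed

end
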